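(* Let $f\in\mathcal{F}$ be a tile counting function. Then there exists an integer $m\ge 1$ such that for every $0\le i\le m-1$ the function $f_i:\mathbb{N}\to\mathbb{N}$, $f_i(n):=f(nm+i)$, either grows exponentially or is eventually polynomial.
   Context: $\mathbb{N}=\{0,1,2,\ldots\}$. A function $f$ is eventually polynomial if there exist $N\in\mathbb{N}$ and a polynomial $q$ such that $f(n)=q(n)$ for all $n\ge N$. A function $f$ grows exponentially if there exist $c_1,c_2>0$ and $N\in\mathbb{N}$ such that $e^{c_1 n}\le f(n)\le e^{c_2 n}$ for all $n\ge N$. Tile counting functions: A tile is an axis-parallel simply connected closed polygon in $\mathbb{R}^2$ (side lengths may be irrational); tiles are considered up to translation. A tile is tall if it has height exactly $1$. For real $a\ge 0$ let $R_a=[1\times a]$ be the rectangle of height $1$ and length $a$. A tiling of $R_a$ with a finite set of tiles $T$ is a collection of translates of tiles of $T$ (no rotations or reflections) with pairwise disjoint interiors whose union is $R_a$ (for $a=0$ the only tiling is the empty one). For a finite set $T$ of tall tiles and a fixed real $\varepsilon\ge 0$, let $f_{T,\varepsilon}(n)$ be the number of tilings of $R_{n+\varepsilon}$ with $T$, $n\in\mathbb{N}$. $\mathcal{F}$ denotes the set of all functions $f_{T,\varepsilon}:\mathbb{N}\to\mathbb{N}$ obtained in this way. *)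

theory Defs
  imports "HOL-Analysis.Analysis" "HOL-Computational_Algebra.Polynomial"
begin

text \<open>The plane is represented by the type of complex numbers, for which the library develops
  the theory of Jordan curves; the real part is the horizontal coordinate.\<close>

text \<open>A polygon is the closed region enclosed by a simple closed polygonal curve, i.e. the curve
  together with its inside.  Since the curve is simple, the region is simply connected, so there
  is no separate clause for this.\<close>

definition axis_parallel_segment :: "complex set \<Rightarrow> bool" where
  "axis_parallel_segment s \<longleftrightarrow>
     (\<exists>a b. (Re a = Re b \<or> Im a = Im b) \<and> s = closed_segment a b)"

definition is_tile :: "complex set \<Rightarrow> bool" where
  "is_tile P \<longleftrightarrow>
     (\<exists>g S. simple_path g \<and> pathfinish g = pathstart g \<and>
            finite S \<and> (\<forall>s\<in>S. axis_parallel_segment s) \<and> path_image g = \<Union>S \<and>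
            P = path_image g \<union> inside (path_image g))"

definition height :: "complex set \<Rightarrow> real" where
  "height P = Sup (Im ` P) - Inf (Im ` P)"

definition tall_tile :: "complex set \<Rightarrow> bool" where
  "tall_tile P \<longleftrightarrow> is_tile P \<and> height P = 1"

definition strip_rect :: "real \<Rightarrow> complex set" where
  "strip_rect a = {z. 0 \<le> Re z \<and> Re z \<le> a \<and> 0 \<le> Im z \<and> Im z \<le> 1}"

text \<open>A tiling is a set of placed tiles, i.e. of subsets of the plane.  Hence two members of
  \<open>T\<close> that are translates of each other count as the same tile.  For \<open>a = 0\<close> the rectangle
  degenerates to a segment, and by convention the empty tiling is its only tiling.\<close>

definition is_tiling :: "complex set set \<Rightarrow> real \<Rightarrow> complex set set \<Rightarrow> bool" where
  "is_tiling T a C \<longleftrightarrow>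
     (if a = 0 then C = {}
      else (\<forall>P\<in>C. \<exists>t\<in>T. \<exists>v. P = (\<lambda>z. v + z) ` t) \<and>
           (\<forall>P\<in>C. \<forall>Q\<in>C. P \<noteq> Q \<longrightarrow> interior P \<inter> interior Q = {}) \<and>
           \<Union>C = strip_rect a)"

definition tile_count :: "complex set set \<Rightarrow> real \<Rightarrow> nat \<Rightarrow> nat" where
  "tile_count T \<epsilon> n = card {C. is_tiling T (real n + \<epsilon>) C}"

definition tile_counting_functions :: "(nat \<Rightarrow> nat) set" where
  "tile_counting_functions =
     {tile_count T \<epsilon> | T \<epsilon>. finite T \<and> (\<forall>t\<in>T. tall_tile t) \<and> \<epsilon> \<ge> 0}"

definition eventually_polynomial :: "(nat \<Rightarrow> nat) \<Rightarrow> bool" where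
  "eventually_polynomial f \<longleftrightarrow>
     (\<exists>N. \<exists>q :: real poly. \<forall>n\<ge>N. real (f n) = poly q (real n))"

definition grows_exponentially :: "(nat \<Rightarrow> nat) \<Rightarrow> bool" where
  "grows_exponentially f \<longleftrightarrow>
     (\<exists>c1>0. \<exists>c2>0. \<exists>N. \<forall>n\<ge>N.
        exp (c1 * real n) \<le> real (f n) \<and> real (f n) \<le> exp (c2 * real n))"

end

theory Submission
  imports Defs "HOL-Library.Multiset"
begin

text \<open>Each tile of a tiling touches both long sides of the strip, so by Fashoda's theorem the tiles
  are linearly ordered from left to right, and two tiles whose interiors meet cannot be separated by
  a third one.  Hence disjointness and the bounds at the two ends only have to be checked for
  consecutive tiles, whose relative offset is determined by their bottom sides; that no gap is left
  is equivalent to the areas summing up to the area of the rectangle.  So tilings correspond to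
  words over a finite alphabet of tiles, with a condition on adjacent letters, of prescribed weight
  in \<open>\<real>\<^sup>2\<close> (total area and total width of the bottom sides).

  To count such words, fix the set \<open>H\<close> of letters used.  If some family of closed walks in \<open>H\<close> has
  a total weight that corresponds to an increase of \<open>n\<close> by \<open>k\<close>, and two members of the family that
  share a base point do not commute, then inserting the family repeatedly into a given word yields at
  least \<open>2\<^sup>j\<close> words when \<open>n\<close> is increased by \<open>j * k\<close>.  Otherwise the steps occurring in such families form a partial
  function, Dickson's lemma bounds the number of other steps, and the number of words is
  given by an analogue of a rational generating function, which makes it quasi-polynomial.\<close>

section \<open>Quasi-polynomials and rational generating functions\<close>

text \<open>Areas and bottom widths may be irrational and incommensurable, so words are counted by
  weight in the plane, and the tile count reads this off along the ray
  \<open>n * (1, 1) + (\<epsilon>, \<epsilon>)\<close>. Diagonals of multivariate rational series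
  can be wild: that of 1/(1 - x - y) gives the central binomial coefficients. The dichotomy has to
  confine such behaviour to the exponential case.

  A single closed walk usually leads off the ray, so an ordinary pumping argument fails. Only a
  family whose weights add up to a multiple of the direction can be inserted, possibly at several
  places of the word. This is why branching refers to families and not to pairs of cycles alone. The
  letter set is fixed because every base point must occur in the word; insertion over these letters
  does not change the set.

  The modulus m is a common multiple of a quasi-period and of one increment k for each branching
  letter set. Hence one branching word in a residue class forces exponential growth along the whole
  class, and a class without such a word is counted by the quasi-polynomial part only.\<close>

lemma Dickson_multiset:
  assumes "finite J" "\<And>c. c \<in> V \<Longrightarrow> set_mset c \<subseteq> J"
  shows "\<exists>F. finite F \<and> F \<subseteq> V \<and> (\<forall>c\<in>V. \<exists>d\<in>F. d \<subseteq># c)"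
  using assms
proof (induction J arbitrary: V rule: finite_induct)
  case empty
  then have "V \<subseteq> {{#}}" by auto
  then have "finite V" by (rule finite_subset) simp
  then show ?case
    by (intro exI[of _ V]) auto
next
  case (insert j J)
  define r where "r = filter_mset (\<lambda>x. x \<noteq> j)"
  have sub: "\<exists>F. finite F \<and> F \<subseteq> W \<and> (\<forall>c\<in>W. \<exists>d\<in>F. r d \<subseteq># r c)" if W: "W \<subseteq> V" for W
  proof -
    have "set_mset c \<subseteq> J" if "c \<in> r ` W" for c
    proof -
      from that obtain c' where "c' \<in> W" "c = r c'" by blast
      then show ?thesis using W insert.prems[of c'] by (auto simp: r_def)
    qed
    from insert.IH[of "r ` W", OF this]
    obtain F where F: "finite F" "F \<subseteq> r ` W" "\<forall>c\<in>r ` W. \<exists>d\<in>F. d \<subseteq># c"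
      by blast
    obtain G where G: "G \<subseteq> W" "finite G" "F = r ` G"
      using finite_subset_image[OF F(1,2)] by blast
    show ?thesis
      using F(3) G by (intro exI[of _ G]) auto
  qed
  \<comment> \<open>\<open>G\<close> works for all of \<open>V\<close> once the multiplicity of
    \<open>j\<close> is forgotten. A member of \<open>G\<close> can fail to lie below
    \<open>c\<close> only if \<open>c\<close> contains \<open>j\<close> fewer than \<open>N\<close>
    times; each of these finitely many levels receives its own finite set
    \<open>H k\<close>.\<close>
  obtain G where G: "finite G" "G \<subseteq> V" "\<forall>c\<in>V. \<exists>d\<in>G. r d \<subseteq># r c"
    using sub[of V] by auto
  have "\<forall>k. \<exists>F. finite F \<and> F \<subseteq> {c \<in> V. count c j = k} \<and>
      (\<forall>c\<in>{c \<in> V. count c j = k}. \<exists>d\<in>F. r d \<subseteq># r c)"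
    by (intro allI sub) auto
  from choice[OF this] obtain H where "\<forall>k. finite (H k) \<and> H k \<subseteq> {c \<in> V. count c j = k} \<and>
      (\<forall>c\<in>{c \<in> V. count c j = k}. \<exists>d\<in>H k. r d \<subseteq># r c)" ..
  then have H: "\<And>k. finite (H k)" "\<And>k. H k \<subseteq> {c \<in> V. count c j = k}"
     "\<And>k. \<forall>c\<in>{c \<in> V. count c j = k}. \<exists>d\<in>H k. r d \<subseteq># r c"
    by auto
  define N where "N = Max (insert 0 ((\<lambda>d. count d j) ` G))"
  have N: "count d j \<le> N" if "d \<in> G" for d
    unfolding N_def using that G(1) by (intro Max_ge) auto
  have le: "d \<subseteq># c" if "r d \<subseteq># r c" "count d j \<le> count c j" for c d
  proof (rule mset_subset_eqI)
    fix a
    show "count d a \<le> count c a"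
      using mset_subset_eq_count[OF that(1), of a] that(2) by (cases "a = j") (auto simp: r_def)
  qed
  show ?case
  proof (intro exI[of _ "G \<union> (\<Union>k<N. H k)"] conjI ballI)
    show "finite (G \<union> (\<Union>k<N. H k))" using G H by auto
    show "G \<union> (\<Union>k<N. H k) \<subseteq> V" using G H(2) by auto
    fix c assume c: "c \<in> V"
    obtain d where d: "d \<in> G" "r d \<subseteq># r c" using G c by blast
    show "\<exists>d\<in>G \<union> (\<Union>k<N. H k). d \<subseteq># c"
    proof (cases "count d j \<le> count c j")
      case True
      then show ?thesis using le d by auto
    next
      case False
      then have "count c j < N" using N[OF d(1)] by simp
      moreover obtain d' where d': "d' \<in> H (count c j)" "r d' \<subseteq># r c"
        using H(3)[of "count c j"] c by blast
      moreover have "count d' j = count c j" using H(2) d' by auto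
      ultimately have "d' \<in> G \<union> (\<Union>k<N. H k)" "d' \<subseteq># c" using le by auto
      then show ?thesis by blast
    qed
  qed
qed

section \<open>Eventual quasi-polynomials and their antidifferences\<close>

definition eventually_quasi_polynomial :: "(nat \<Rightarrow> real) \<Rightarrow> bool" where
  "eventually_quasi_polynomial g \<longleftrightarrow>
     (\<exists>p\<ge>1. \<exists>q. \<exists>N. \<forall>n\<ge>N. g n = poly (q (n mod p)) (real n))"

lemma eqpI:
  assumes "p \<ge> 1" "\<And>n. n \<ge> N \<Longrightarrow> g n = poly (q (n mod p)) (real n)"
  shows "eventually_quasi_polynomial g"
  using assms unfolding eventually_quasi_polynomial_def by blast

text \<open>Any multiple of a period is a period, so two quasi-polynomials can be written over a
  common one.\<close>

lemma eqp_periodE: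
  assumes "eventually_quasi_polynomial g"
  obtains p where "p \<ge> 1"
    "\<And>k. k \<ge> 1 \<Longrightarrow> \<exists>q. \<exists>N. \<forall>n\<ge>N. g n = poly (q (n mod (p * k))) (real n)"
proof -
  obtain p q N where p: "p \<ge> 1" "\<forall>n\<ge>N. g n = poly (q (n mod p)) (real n)"
    using assms unfolding eventually_quasi_polynomial_def by blast
  have "\<exists>q. \<exists>N. \<forall>n\<ge>N. g n = poly (q (n mod (p * k))) (real n)" if "k \<ge> 1" for k
    using p(2) by (intro exI[of _ "\<lambda>i. q (i mod p)"] exI[of _ N]) (simp add: mod_mod_cancel)
  then show thesis by (rule that[OF p(1)])
qed

lemma eqp_cong:
  assumes "eventually_quasi_polynomial g" "\<And>n. n \<ge> N \<Longrightarrow> h n = g n"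
  shows "eventually_quasi_polynomial h"
proof -
  obtain p q N' where "p \<ge> 1" "\<forall>n\<ge>N'. g n = poly (q (n mod p)) (real n)"
    using assms unfolding eventually_quasi_polynomial_def by blast
  with assms(2) show ?thesis
    by (intro eqpI[of p "max N N'" h q]) auto
qed

lemma eqp_lincomb:
  assumes "eventually_quasi_polynomial g" "eventually_quasi_polynomial h"
  shows "eventually_quasi_polynomial (\<lambda>n. g n + c * h n)"
proof -
  obtain p where p: "p \<ge> 1"
    "\<And>k. k \<ge> 1 \<Longrightarrow> \<exists>q. \<exists>N. \<forall>n\<ge>N. g n = poly (q (n mod (p * k))) (real n)"
    using eqp_periodE[OF assms(1)] by blast
  obtain r where r: "r \<ge> 1"
    "\<And>k. k \<ge> 1 \<Longrightarrow> \<exists>q. \<exists>N. \<forall>n\<ge>N. h n = poly (q (n mod (r * k))) (real n)"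
    using eqp_periodE[OF assms(2)] by blast
  obtain q N where q: "\<forall>n\<ge>N. g n = poly (q (n mod (p * r))) (real n)"
    using p(2)[OF r(1)] by blast
  obtain s M where s: "\<forall>n\<ge>M. h n = poly (s (n mod (p * r))) (real n)"
    using r(2)[OF p(1)] unfolding mult.commute[of r p] by blast
  have "1 \<le> p * r" using p(1) r(1) by (simp add: Suc_le_eq)
  then show ?thesis using q s
    by (intro eqpI[of "p * r" "max N M" _ "\<lambda>i. q i + smult c (s i)"]) simp_all
qed

lemma eqp_zero: "eventually_quasi_polynomial (\<lambda>n. 0)"
  by (rule eqpI[of 1 0 _ "\<lambda>_. 0"]) auto

lemma eqp_add:
  assumes "eventually_quasi_polynomial g" "eventually_quasi_polynomial h"
  shows "eventually_quasi_polynomial (\<lambda>n. g n + h n)"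
  using eqp_lincomb[OF assms, of 1] by simp

lemma eqp_diff:
  assumes "eventually_quasi_polynomial g" "eventually_quasi_polynomial h"
  shows "eventually_quasi_polynomial (\<lambda>n. g n - h n)"
  using eqp_lincomb[OF assms, of "-1"] by simp

lemma eqp_sum:
  assumes "\<And>x. x \<in> X \<Longrightarrow> eventually_quasi_polynomial (g x)"
  shows "eventually_quasi_polynomial (\<lambda>n. \<Sum>x\<in>X. g x n)"
  using assms
  by (induction X rule: infinite_finite_induct) (auto intro: eqp_zero eqp_add)

text \<open>Telescoping the differences of \<open>s ^ Suc n\<close> and expanding them binomially
  expresses the sum of n-th powers through the sums of lower powers.\<close>

lemma sum_power_polynomial: "\<exists>Q :: real poly. \<forall>t. (\<Sum>s<t. real s ^ n) = poly Q (real t)"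
proof (induction n rule: less_induct)
  case (less n)
  then obtain Q :: "nat \<Rightarrow> real poly"
    where Q: "\<And>k t. k < n \<Longrightarrow> (\<Sum>s<t. real s ^ k) = poly (Q k) (real t)"
    by metis
  have "(\<Sum>s<t. real s ^ n)
      = poly (smult (1 / real (Suc n)) (monom 1 (Suc n) - (\<Sum>k<n. smult (real (Suc n choose k)) (Q k)))) (real t)" for t
  proof -
    have "real (Suc s) ^ Suc n - real s ^ Suc n
        = real (Suc n) * real s ^ n + (\<Sum>k<n. real (Suc n choose k) * real s ^ k)" for s
    proof -
      have "real (Suc s) ^ Suc n = (\<Sum>k\<le>Suc n. real (Suc n choose k) * real s ^ k)"
        using binomial_ring[of "real s" 1 "Suc n"] by (simp add: add.commute del: power_Suc sum.atMost_Suc)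
      also have "\<dots> = real s ^ Suc n + (real (Suc n) * real s ^ n + (\<Sum>k<n. real (Suc n choose k) * real s ^ k))"
        by (simp del: power_Suc binomial_Suc_Suc flip: lessThan_Suc_atMost)
      finally show ?thesis by linarith
    qed
    then have 1: "(\<Sum>s<t. real (Suc s) ^ Suc n - real s ^ Suc n)
        = real (Suc n) * (\<Sum>s<t. real s ^ n) + (\<Sum>s<t. \<Sum>k<n. real (Suc n choose k) * real s ^ k)"
      by (simp only: sum.distrib sum_distrib_left)
    have 2: "(\<Sum>s<t. real (Suc s) ^ Suc n - real s ^ Suc n) = real t ^ Suc n"
      using sum_lessThan_telescope[of "\<lambda>s. real s ^ Suc n" t] by simp
    have 3: "(\<Sum>s<t. \<Sum>k<n. real (Suc n choose k) * real s ^ k)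
        = (\<Sum>k<n. real (Suc n choose k) * poly (Q k) (real t))"
      by (subst sum.swap) (simp add: Q del: binomial_Suc_Suc flip: sum_distrib_left)
    have "real (Suc n) * (\<Sum>s<t. real s ^ n)
        = real t ^ Suc n - (\<Sum>k<n. real (Suc n choose k) * poly (Q k) (real t))"
      using 1 2 3 by linarith
    then have "(\<Sum>s<t. real s ^ n)
        = (real t ^ Suc n - (\<Sum>k<n. real (Suc n choose k) * poly (Q k) (real t))) / real (Suc n)"
      by (metis nonzero_mult_div_cancel_left of_nat_0_neq of_nat_eq_0_iff old.nat.distinct(2))
    then show ?thesis
      by (simp add: poly_sum poly_monom del: of_nat_Suc power_Suc binomial_Suc_Suc)
  qed
  then show ?case by blast
qed

lemma sum_poly_polynomial: "\<exists>Q :: real poly. \<forall>t. (\<Sum>s<t. poly q (real s)) = poly Q (real t)"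
proof -
  obtain Q :: "nat \<Rightarrow> real poly" where Q: "\<And>k t. (\<Sum>s<t. real s ^ k) = poly (Q k) (real t)"
  proof -
    have "\<forall>k. \<exists>Q :: real poly. \<forall>t. (\<Sum>s<t. real s ^ k) = poly Q (real t)"
      using sum_power_polynomial by blast
    then show thesis using that by metis
  qed
  have "(\<Sum>s<t. poly q (real s)) = poly (\<Sum>k\<le>degree q. smult (coeff q k) (Q k)) (real t)" for t
    unfolding poly_altdef[of q] poly_sum
    by (subst sum.swap) (simp add: Q flip: sum_distrib_left)
  then show ?thesis by blast
qed

text \<open>Along each residue class modulo \<open>p * d\<close> the increments of \<open>g\<close>
  are eventually polynomial in the index within the class, and sums of polynomial values are
  polynomial.\<close>

lemma eqp_of_difference:
  fixes g :: "nat \<Rightarrow> real"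
  assumes h: "eventually_quasi_polynomial h" and d: "d \<ge> 1"
    and gh: "\<And>n. g (n + d) - g n = h n"
  shows "eventually_quasi_polynomial g"
proof -
  obtain p q N where p: "p \<ge> 1" and q: "\<And>n. n \<ge> N \<Longrightarrow> h n = poly (q (n mod p)) (real n)"
    using h unfolding eventually_quasi_polynomial_def by blast
  define P where "P = p * d"
  have P: "P \<ge> 1" using p d by (simp add: P_def Suc_le_eq)
  \<comment> \<open>\<open>p\<close> steps of length \<open>d\<close> lead from
    \<open>i + P * t\<close> to \<open>i + P * Suc t\<close>. The residues modulo \<open>p\<close>
    met on the way do not depend on \<open>t\<close>, so the whole increment is one polynomial in
    \<open>t\<close>.\<close>
  define r where
    "r i = (\<Sum>s<p. pcompose (q ((i + s * d) mod p)) [:real (i + s * d), real P:])" for i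
  have diff_step: "g (i + P * Suc t) - g (i + P * t) = poly (r i) (real t)" if "t \<ge> N" for i t
  proof -
    have "g (m + s * d) - g m = (\<Sum>k<s. h (m + k * d))" for m s
    proof (induction s)
      case (Suc s)
      then show ?case using gh[of "m + s * d"] by (simp add: algebra_simps)
    qed simp
    from this[of "i + P * t" p]
    have "g (i + P * Suc t) - g (i + P * t) = (\<Sum>s<p. h (i + P * t + s * d))"
      by (simp add: P_def algebra_simps)
    also have "\<dots> = (\<Sum>s<p. poly (q ((i + s * d) mod p)) (real (i + s * d) + real P * real t))"
    proof (intro sum.cong refl)
      fix s
      have "t \<le> P * t" using P by (cases P) auto
      then have "h (i + P * t + s * d) = poly (q ((i + P * t + s * d) mod p)) (real (i + P * t + s * d))"
        using that by (intro q) linarith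
      moreover have "(i + P * t + s * d) mod p = (i + s * d) mod p"
        by (metis P_def ab_semigroup_add_class.add_ac(1) add.commute mod_mult_self2 mult.assoc)
      ultimately show "h (i + P * t + s * d)
          = poly (q ((i + s * d) mod p)) (real (i + s * d) + real P * real t)"
        by (simp add: algebra_simps)
    qed
    also have "\<dots> = poly (r i) (real t)"
      by (simp add: r_def poly_sum poly_pcompose mult.commute)
    finally show ?thesis .
  qed
  obtain Q :: "nat \<Rightarrow> real poly" where Q: "\<And>i t. (\<Sum>s<t. poly (r i) (real s)) = poly (Q i) (real t)"
  proof -
    have "\<forall>i. \<exists>Q :: real poly. \<forall>t. (\<Sum>s<t. poly (r i) (real s)) = poly Q (real t)"
      using sum_poly_polynomial by blast
    then show thesis using that by metis
  qed
  have gi: "g (i + P * t) = g (i + P * N) - poly (Q i) (real N) + poly (Q i) (real t)"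
    if "t \<ge> N" for i t
    using that
  proof (induction t rule: dec_induct)
    case (step t)
    have "poly (Q i) (real (Suc t)) = poly (Q i) (real t) + poly (r i) (real t)"
      unfolding Q[symmetric] by simp
    moreover have "g (i + P * Suc t) - g (i + P * t) = poly (r i) (real t)"
      using step.hyps by (intro diff_step)
    ultimately show ?case using step.IH by linarith
  qed simp
  \<comment> \<open>The inner polynomial recovers the index \<open>t = (n - i) / P\<close> of
    \<open>n\<close> within its class.\<close>
  define q' where "q' i = [:g (i + P * N) - poly (Q i) (real N):]
      + pcompose (Q i) [: - real i / real P, 1 / real P:]" for i
  have "g n = poly (q' (n mod P)) (real n)" if "n \<ge> P * N" for n
  proof -
    have "n div P \<ge> N" using that P by (simp add: less_eq_div_iff_mult_less_eq mult.commute)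
    from gi[OF this, of "n mod P"]
    have "g n = g (n mod P + P * N) - poly (Q (n mod P)) (real N) + poly (Q (n mod P)) (real (n div P))"
      by simp
    moreover have "real (n div P) = - real (n mod P) / real P + real n / real P"
    proof -
      have "real n = real P * real (n div P) + real (n mod P)"
        by (metis mult_div_mod_eq of_nat_add of_nat_mult)
      then show ?thesis using P by (simp add: field_simps)
    qed
    ultimately show ?thesis by (simp add: q'_def poly_pcompose)
  qed
  then show ?thesis unfolding eventually_quasi_polynomial_def using P by blast
qed

section \<open>Formal series with exponents in the plane\<close>

definition backward_diff :: "complex \<Rightarrow> (complex \<Rightarrow> real) \<Rightarrow> complex \<Rightarrow> real" where
  "backward_diff L \<phi> = (\<lambda>z. \<phi> z - \<phi> (z - L))"

interpretation backward_diff: comp_fun_commute backward_diff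
  by unfold_locales (auto simp: backward_diff_def fun_eq_iff algebra_simps)

text \<open>Multiplication of the series with coefficients \<phi> by the product of the factors 1 -
  x^L. The factors commute, so the fold over a multiset is well defined.\<close>

definition backward_diffs :: "complex multiset \<Rightarrow> (complex \<Rightarrow> real) \<Rightarrow> complex \<Rightarrow> real" where
  "backward_diffs M \<phi> = fold_mset backward_diff \<phi> M"

lemma backward_diffs_empty [simp]: "backward_diffs {#} \<phi> = \<phi>"
  by (simp add: backward_diffs_def)

lemma backward_diffs_add_mset:
  "backward_diffs (add_mset L M) \<phi> = backward_diff L (backward_diffs M \<phi>)"
  by (simp add: backward_diffs_def)

lemma backward_diffs_add_mset':
  "backward_diffs (add_mset L M) \<phi> = backward_diffs M (backward_diff L \<phi>)"
  by (simp add: backward_diffs_def backward_diff.fold_mset_fun_left_comm)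

lemma backward_diffs_union:
  "backward_diffs (M + N) \<phi> = backward_diffs M (backward_diffs N \<phi>)"
  by (induction M) (auto simp: backward_diffs_add_mset)

lemma backward_diffs_add:
  "backward_diffs M (\<lambda>z. \<phi> z + \<psi> z) = (\<lambda>z. backward_diffs M \<phi> z + backward_diffs M \<psi> z)"
  by (induction M) (auto simp: backward_diffs_add_mset backward_diff_def fun_eq_iff)

lemma backward_diffs_shift:
  "backward_diffs M (\<lambda>z. \<phi> (z - v)) = (\<lambda>z. backward_diffs M \<phi> (z - v))"
  by (induction M) (auto simp: backward_diffs_add_mset backward_diff_def fun_eq_iff algebra_simps)

lemma finite_support_shift:
  fixes \<phi> :: "complex \<Rightarrow> real"
  assumes "finite {z. \<phi> z \<noteq> 0}"
  shows "finite {z. \<phi> (z - v) \<noteq> 0}"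
proof -
  have "{z. \<phi> (z - v) \<noteq> 0} = (\<lambda>z. z + v) ` {z. \<phi> z \<noteq> 0}"
    by (auto simp: image_iff) (metis diff_add_cancel)
  then show ?thesis using assms by simp
qed

lemma finite_support_add:
  fixes \<phi> :: "complex \<Rightarrow> real"
  assumes "finite {z. \<phi> z \<noteq> 0}" "finite {z. \<psi> z \<noteq> 0}"
  shows "finite {z. \<phi> z + \<psi> z \<noteq> 0}"
  by (rule finite_subset[OF _ finite_UnI[OF assms]]) auto

lemma finite_support_backward_diffs:
  assumes "finite {z. \<phi> z \<noteq> 0}"
  shows "finite {z. backward_diffs M \<phi> z \<noteq> 0}"
proof (induction M)
  case (add L M)
  show ?case
    by (rule finite_subset[OF _ finite_UnI[OF add finite_support_shift[OF add, of L]]])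
      (auto simp: backward_diffs_add_mset backward_diff_def)
qed (use assms in simp)

text \<open>The analogue of a rational generating function \<open>\<Sum>z. \<phi> z * x\<^sup>z\<close> with denominator
  \<open>\<Prod>L\<in>M. (1 - x\<^sup>L)\<close>.\<close>
definition rational_gf :: "(complex \<Rightarrow> real) \<Rightarrow> bool" where
  "rational_gf \<phi> \<longleftrightarrow> (\<exists>K. \<forall>z. Re z < K \<longrightarrow> \<phi> z = 0) \<and>
     (\<exists>M. (\<forall>L\<in>#M. Re L > 0) \<and> finite {z. backward_diffs M \<phi> z \<noteq> 0})"

lemma rational_gf_finite_support:
  assumes "finite {z. \<phi> z \<noteq> 0}"
  shows "rational_gf \<phi>"
proof -
  define K where "K = Min (insert 0 (Re ` {z. \<phi> z \<noteq> 0}))"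
  have "\<phi> z = 0" if "Re z < K" for z
  proof (rule ccontr)
    assume "\<phi> z \<noteq> 0"
    then have "K \<le> Re z" unfolding K_def using assms by (intro Min_le) auto
    with that show False by simp
  qed
  then show ?thesis using assms unfolding rational_gf_def
    by (intro conjI exI[of _ K] exI[of _ "{#}"]) auto
qed

lemma rational_gf_add:
  assumes "rational_gf \<phi>" "rational_gf \<psi>"
  shows "rational_gf (\<lambda>z. \<phi> z + \<psi> z)"
proof -
  obtain K M where K: "\<forall>z. Re z < K \<longrightarrow> \<phi> z = 0" and M: "\<forall>L\<in>#M. Re L > 0"
    "finite {z. backward_diffs M \<phi> z \<noteq> 0}" using assms unfolding rational_gf_def by blast
  obtain K' M' where K': "\<forall>z. Re z < K' \<longrightarrow> \<psi> z = 0" and M': "\<forall>L\<in>#M'. Re L > 0"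
    "finite {z. backward_diffs M' \<psi> z \<noteq> 0}" using assms unfolding rational_gf_def by blast
  have 1: "finite {z. backward_diffs (M + M') \<phi> z \<noteq> 0}"
    using finite_support_backward_diffs[OF M(2), of M']
    by (simp add: add.commute[of M] backward_diffs_union)
  have 2: "finite {z. backward_diffs (M + M') \<psi> z \<noteq> 0}"
    using finite_support_backward_diffs[OF M'(2), of M] by (simp add: backward_diffs_union)
  from finite_support_add[OF 1 2] show ?thesis
    unfolding rational_gf_def using K K' M(1) M'(1)
    by (intro conjI exI[of _ "min K K'"] exI[of _ "M + M'"])
      (auto simp: backward_diffs_add)
qed

lemma rational_gf_zero: "rational_gf (\<lambda>z. 0)"
  by (rule rational_gf_finite_support) simp

lemma rational_gf_sum:
  assumes "\<And>x. x \<in> X \<Longrightarrow> rational_gf (\<phi> x)"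
  shows "rational_gf (\<lambda>z. \<Sum>x\<in>X. \<phi> x z)"
  using assms
  by (induction X rule: infinite_finite_induct) (auto intro: rational_gf_zero rational_gf_add)

lemma rational_gf_shift:
  assumes "rational_gf \<phi>"
  shows "rational_gf (\<lambda>z. \<phi> (z - v))"
proof -
  obtain K M where K: "\<forall>z. Re z < K \<longrightarrow> \<phi> z = 0" and M: "\<forall>L\<in>#M. Re L > 0"
    "finite {z. backward_diffs M \<phi> z \<noteq> 0}" using assms unfolding rational_gf_def by blast
  show ?thesis
    unfolding rational_gf_def using K M(1) finite_support_shift[OF M(2), of v]
    by (intro conjI exI[of _ "K + Re v"] exI[of _ M]) (auto simp: backward_diffs_shift)
qed

text \<open>Division by 1 - x^L. The vanishing of \<phi> far to the left is a separate hypothesis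
  because the difference determines \<phi> only up to an L-periodic function.\<close>

lemma rational_gf_of_difference:
  assumes "rational_gf (\<lambda>z. \<phi> z - \<phi> (z - L))" "Re L > 0" "\<And>z. Re z < K \<Longrightarrow> \<phi> z = 0"
  shows "rational_gf \<phi>"
proof -
  obtain M where M: "\<forall>L\<in>#M. Re L > 0" "finite {z. backward_diffs M (backward_diff L \<phi>) z \<noteq> 0}"
    using assms(1) unfolding rational_gf_def backward_diff_def by blast
  then show ?thesis
    unfolding rational_gf_def using assms(2,3)
    by (intro conjI exI[of _ K] exI[of _ "add_mset L M"]) (auto simp: backward_diffs_add_mset')
qed

text \<open>Geometric series expansion of the denominator: the support of \<phi> lies in the support
  of the numerator plus the cone of sums over \<open>M\<close>. If all differences along z, z - L, z
  - 2L, ... vanished, \<phi> would be constant on this sequence, which ends up where \<phi> is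
  zero.\<close>

lemma support_backward_diffs:
  assumes "\<And>z. Re z < K \<Longrightarrow> \<phi> z = 0" "\<forall>L\<in>#M. Re L > 0" "\<phi> z \<noteq> 0"
  shows "\<exists>c. set_mset c \<subseteq> set_mset M \<and> backward_diffs M \<phi> (z - sum_mset c) \<noteq> 0"
  using assms
proof (induction M arbitrary: \<phi> z K)
  case empty
  then show ?case by (intro exI[of _ "{#}"]) simp
next
  case (add L M)
  have L: "Re L > 0" using add.prems by simp
  have "\<exists>k. backward_diff L \<phi> (z - of_nat k * L) \<noteq> 0"
  proof (rule ccontr)
    assume "\<not> ?thesis"
    then have *: "\<phi> (z - of_nat k * L) = \<phi> (z - of_nat k * L - L)" for k
      by (auto simp: backward_diff_def)
    have **: "\<phi> (z - of_nat k * L) = \<phi> z" for k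
    proof (induction k)
      case (Suc k)
      then show ?case using *[of k] by (simp add: algebra_simps)
    qed simp
    obtain k where "real k * Re L > Re z - K" using reals_Archimedean3[OF L] by blast
    then have "Re (z - of_nat k * L) < K" by simp
    then show False using ** add.prems(1,3) by metis
  qed
  then obtain k where k: "backward_diff L \<phi> (z - of_nat k * L) \<noteq> 0" by blast
  have "\<exists>c. set_mset c \<subseteq> set_mset M \<and>
      backward_diffs M (backward_diff L \<phi>) (z - of_nat k * L - sum_mset c) \<noteq> 0"
  proof (rule add.IH)
    show "backward_diff L \<phi> z = 0" if "Re z < K" for z
      using that L add.prems(1) by (simp add: backward_diff_def)
  qed (use add.prems k in auto)
  then obtain c where c: "set_mset c \<subseteq> set_mset M"
      "backward_diffs M (backward_diff L \<phi>) (z - of_nat k * L - sum_mset c) \<noteq> 0" by blast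
  show ?case using c
    by (intro exI[of _ "replicate_mset k L + c"])
      (auto simp: backward_diffs_add_mset' sum_mset_replicate_mset algebra_simps)
qed

text \<open>If some nonempty combination of the exponents in \<open>M\<close> equals
  \<open>d * e\<close>, then the differences with step \<open>d\<close> along the ray telescope into
  series with a smaller denominator, and taking the antidifference finishes. Otherwise Dickson's
  lemma shows that the ray meets the finitely many translated cones carrying \<phi> only finitely
  often, so \<phi> eventually vanishes on it. The offset \<delta> varies because telescoping moves
  it.\<close>

lemma eqp_rational_gf_aux:
  assumes e: "Re e > 0"
  shows "(\<And>z. Re z < K \<Longrightarrow> \<phi> z = 0) \<Longrightarrow> \<forall>L\<in>#M. Re L > 0 \<Longrightarrow> finite {z. backward_diffs M \<phi> z \<noteq> 0}
    \<Longrightarrow> eventually_quasi_polynomial (\<lambda>n. \<phi> (of_nat n * e + \<delta>))"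
proof (induction "size M" arbitrary: M \<phi> K \<delta> rule: less_induct)
  case less
  have Dmem: "eventually_quasi_polynomial (\<lambda>n. backward_diff L \<phi> (of_nat n * e + \<delta>))"
    if L: "L \<in># M" for L \<delta>
  proof (rule less.hyps)
    show "size (M - {#L#}) < size M" using L by (rule size_Diff1_less)
    show "backward_diff L \<phi> z = 0" if "Re z < K" for z
      using that L less.prems(1,2) by (auto simp: backward_diff_def)
    show "\<forall>L\<in>#M - {#L#}. Re L > 0" using less.prems(2) by (meson in_diffD)
    show "finite {z. backward_diffs (M - {#L#}) (backward_diff L \<phi>) z \<noteq> 0}"
      using less.prems(3) L by (simp flip: backward_diffs_add_mset')
  qed
  have Dsum: "eventually_quasi_polynomial
      (\<lambda>n. \<phi> (of_nat n * e + \<delta>) - \<phi> (of_nat n * e + \<delta> - sum_mset u))"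
    if "set_mset u \<subseteq> set_mset M" for u \<delta>
    using that
  proof (induction u arbitrary: \<delta>)
    case empty
    then show ?case by (simp add: eqp_zero)
  next
    case (add L u)
    have "eventually_quasi_polynomial (\<lambda>n. backward_diff L \<phi> (of_nat n * e + \<delta>) +
       (\<phi> (of_nat n * e + (\<delta> - L)) - \<phi> (of_nat n * e + (\<delta> - L) - sum_mset u)))"
      using add by (intro eqp_add Dmem) auto
    then show ?case by (simp add: backward_diff_def algebra_simps)
  qed
  have pos: "Re (sum_mset u) > 0" if "u \<noteq> {#}" "set_mset u \<subseteq> set_mset M" for u
    using that
  proof (induction u)
    case (add L u)
    then have "Re L > 0" using less.prems(2) by simp
    moreover have "Re (sum_mset u) \<ge> 0"
      using add by (cases "u = {#}") (auto intro: less_imp_le)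
    ultimately show ?case by simp
  qed simp
  show ?case
  proof (cases "\<exists>u d. u \<noteq> {#} \<and> set_mset u \<subseteq> set_mset M \<and> sum_mset u = of_nat d * e")
    case True
    then obtain u d where u: "u \<noteq> {#}" "set_mset u \<subseteq> set_mset M" "sum_mset u = of_nat d * e"
      by blast
    from pos[OF u(1,2)] e u(3) have "d \<ge> 1" by (cases d) auto
    show ?thesis
    proof (rule eqp_of_difference[OF _ \<open>d \<ge> 1\<close>])
      show "eventually_quasi_polynomial (\<lambda>n. \<phi> (of_nat n * e + (\<delta> + sum_mset u))
          - \<phi> (of_nat n * e + (\<delta> + sum_mset u) - sum_mset u))"
        by (rule Dsum[OF u(2)])
      fix n
      show "\<phi> (of_nat (n + d) * e + \<delta>) - \<phi> (of_nat n * e + \<delta>) =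
         \<phi> (of_nat n * e + (\<delta> + sum_mset u)) - \<phi> (of_nat n * e + (\<delta> + sum_mset u) - sum_mset u)"
        by (simp add: u(3) algebra_simps)
    qed
  next
    case False
    define S where "S = {z. backward_diffs M \<phi> z \<noteq> 0}"
    \<comment> \<open>\<open>V s\<close> lists the ways to reach the ray from \<open>s\<close>. Two
      comparable members would differ by a combination that is a multiple of \<open>e\<close>, which
      is excluded here; so the finite set of minimal members is everything.\<close>
    define V where "V s = {c. set_mset c \<subseteq> set_mset M \<and> (\<exists>n. s + sum_mset c = of_nat n * e + \<delta>)}" for s
    have finV: "finite (V s)" for s
    proof -
      obtain F where F: "finite F" "F \<subseteq> V s" "\<forall>c\<in>V s. \<exists>d\<in>F. d \<subseteq># c"
      proof -
        have "set_mset c \<subseteq> set_mset M" if "c \<in> V s" for c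
          using that unfolding V_def by blast
        from Dickson_multiset[OF finite_set_mset this] that show thesis by blast
      qed
      have "c \<in> F" if c: "c \<in> V s" for c
      proof -
        obtain d where d: "d \<in> F" "d \<subseteq># c" using F c by blast
        obtain n where n: "s + sum_mset c = of_nat n * e + \<delta>" using c unfolding V_def by blast
        obtain k where k: "s + sum_mset d = of_nat k * e + \<delta>" using d(1) F(2) unfolding V_def by blast
        define u where "u = c - d"
        have cu: "c = d + u" using d(2) by (simp add: u_def)
        have usub: "set_mset u \<subseteq> set_mset M" using c cu by (auto simp: V_def)
        have "(s + sum_mset d) + sum_mset u = of_nat n * e + \<delta>"
          using n cu by (simp add: add.assoc)
        then have ueq: "sum_mset u = (of_nat n - of_nat k) * e"
          unfolding k by (simp add: algebra_simps)
        have "0 \<le> Re (sum_mset u)"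
          using pos[OF _ usub] by (cases "u = {#}") (auto intro: less_imp_le)
        then have "k \<le> n" using ueq e by (simp add: zero_le_mult_iff)
        then have "sum_mset u = of_nat (n - k) * e" using ueq by (simp add: of_nat_diff)
        with False usub have "u = {#}" by blast
        then show ?thesis using cu d by simp
      qed
      then have "V s \<subseteq> F" ..
      then show ?thesis using F(1) by (rule finite_subset)
    qed
    define X where "X = (\<Union>s\<in>S. (\<lambda>c. Re (s + sum_mset c)) ` V s)"
    have "finite X" using finV less.prems(3) by (auto simp: X_def S_def)
    obtain B where B: "\<And>x. x \<in> X \<Longrightarrow> x \<le> B"
      using \<open>finite X\<close> by (meson bdd_above.unfold bdd_above_finite)
    obtain N where N: "real N * Re e > B - Re \<delta>" using reals_Archimedean3[OF e] by blast
    show ?thesis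
    proof (rule eqp_cong[OF eqp_zero])
      fix n assume n: "N \<le> n"
      show "\<phi> (of_nat n * e + \<delta>) = 0"
      proof (rule ccontr)
        assume nz: "\<phi> (of_nat n * e + \<delta>) \<noteq> 0"
        have "\<exists>c. set_mset c \<subseteq> set_mset M \<and>
            backward_diffs M \<phi> (of_nat n * e + \<delta> - sum_mset c) \<noteq> 0"
          by (rule support_backward_diffs[where K = K]) (use less.prems nz in auto)
        then obtain c where c: "set_mset c \<subseteq> set_mset M"
          "backward_diffs M \<phi> (of_nat n * e + \<delta> - sum_mset c) \<noteq> 0" by blast
        define s where "s = of_nat n * e + \<delta> - sum_mset c"
        have s: "s + sum_mset c = of_nat n * e + \<delta>" by (simp add: s_def)
        have "s \<in> S" using c(2) by (simp add: S_def s_def)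
        moreover have "c \<in> V s" using c(1) s unfolding V_def by blast
        ultimately have "Re (s + sum_mset c) \<in> X" unfolding X_def by blast
        from B[OF this] have "real n * Re e + Re \<delta> \<le> B" unfolding s by simp
        moreover have "real N * Re e \<le> real n * Re e" using n e by simp
        ultimately show False using N by simp
      qed
    qed
  qed
qed

lemma eqp_rational_gf:
  assumes "rational_gf \<phi>" "Re e > 0"
  shows "eventually_quasi_polynomial (\<lambda>n. \<phi> (of_nat n * e + \<delta>))"
proof -
  obtain K M where "\<forall>z. Re z < K \<longrightarrow> \<phi> z = 0" "\<forall>L\<in>#M. Re L > 0"
    "finite {z. backward_diffs M \<phi> z \<noteq> 0}" using assms unfolding rational_gf_def by blast
  then show ?thesis by (intro eqp_rational_gf_aux[OF assms(2), of K _ M]) auto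
qed

section \<open>Words of prescribed weight\<close>

lemma successively_append_Cons:
  "successively P (u @ x # v) \<longleftrightarrow> successively P (u @ [x]) \<and> successively P (x # v)"
  by (auto simp: successively_append_iff)

text \<open>The complex numbers serve as the real plane. The real part of a weight bounds the length
  of a word, which makes all counts finite; the imaginary part is a second linear
  constraint.\<close>

locale weighted_words =
  fixes A :: "'a set" and R :: "'a \<Rightarrow> 'a \<Rightarrow> bool" and St En :: "'a set"
    and wt :: "'a \<Rightarrow> complex" and e \<delta> :: complex
  assumes finite_A: "finite A"
    and wt_pos: "a \<in> A \<Longrightarrow> Re (wt a) > 0"
    and e_pos: "Re e > 0"
begin

definition weight :: "'a list \<Rightarrow> complex" where
  "weight w = sum_list (map wt w)"

definition walk :: "'a set \<Rightarrow> 'a list \<Rightarrow> bool" where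
  "walk H w \<longleftrightarrow> w \<noteq> [] \<and> set w \<subseteq> H \<and> successively R w"

text \<open>The step back to the base point \<open>hd c\<close> is checked, but the letter is not
  repeated: inserting \<open>c\<close> in front of an occurrence of \<open>hd c\<close> then adds
  exactly \<open>weight c\<close>.\<close>

definition closed_walk :: "'a set \<Rightarrow> 'a list \<Rightarrow> bool" where
  "closed_walk H c \<longleftrightarrow> c \<noteq> [] \<and> set c \<subseteq> H \<and> successively R (c @ [hd c])"

definition accepted :: "'a list \<Rightarrow> bool" where
  "accepted w \<longleftrightarrow> walk A w \<and> hd w \<in> St \<and> last w \<in> En"

definition words :: "nat \<Rightarrow> 'a list set" where
  "words n = {w. accepted w \<and> weight w = of_nat n * e + \<delta>}"

definition total :: "'a list multiset \<Rightarrow> complex" where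
  "total \<Gamma> = (\<Sum>c\<in>#\<Gamma>. weight c)"

text \<open>Only the total weight has to be a multiple of \<open>e\<close>; the members may have
  arbitrary weights and different base points.\<close>

definition family :: "'a set \<Rightarrow> 'a list multiset \<Rightarrow> nat \<Rightarrow> bool" where
  "family H \<Gamma> k \<longleftrightarrow> (\<forall>c\<in>#\<Gamma>. closed_walk H c) \<and> total \<Gamma> = of_nat k * e"

text \<open>Two members with a common base point can be inserted one after the other in either
  order. Failure to commute makes the two results different words of equal length and
  weight.\<close>

definition branching_with :: "'a set \<Rightarrow> nat \<Rightarrow> bool" where
  "branching_with H k \<longleftrightarrow>
     (\<exists>\<Gamma> c d. family H \<Gamma> k \<and> {#c, d#} \<subseteq># \<Gamma> \<and> hd c = hd d \<and> c @ d \<noteq> d @ c)"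

definition branching :: "'a set \<Rightarrow> bool" where
  "branching H \<longleftrightarrow> (\<exists>k. branching_with H k)"

lemma weight_simps [simp]:
  "weight [] = 0" "weight (x # w) = wt x + weight w" "weight (u @ v) = weight u + weight v"
  by (auto simp: weight_def)

lemma total_simps [simp]:
  "total {#} = 0" "total (add_mset c \<Gamma>) = weight c + total \<Gamma>" "total (\<Gamma> + \<Delta>) = total \<Gamma> + total \<Delta>"
  by (auto simp: total_def)

lemma length_le_weight:
  "\<exists>\<mu>>0. \<forall>w. set w \<subseteq> A \<longrightarrow> \<mu> * real (length w) \<le> Re (weight w)"
proof -
  define \<mu> where "\<mu> = Min (insert 1 ((\<lambda>a. Re (wt a)) ` A))"
  have "\<mu> > 0" unfolding \<mu>_def using finite_A wt_pos by (subst Min_gr_iff) auto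
  moreover have "\<mu> \<le> Re (wt a)" if "a \<in> A" for a
    unfolding \<mu>_def using finite_A that by (intro Min_le) auto
  then have "\<mu> * real (length w) \<le> Re (weight w)" if "set w \<subseteq> A" for w
    using that by (induction w) (fastforce simp: algebra_simps)+
  ultimately show ?thesis by blast
qed

lemma weight_nonneg: "set w \<subseteq> A \<Longrightarrow> Re (weight w) \<ge> 0"
  by (induction w) (auto intro: add_nonneg_nonneg less_imp_le wt_pos)

lemma weight_pos: "set w \<subseteq> A \<Longrightarrow> w \<noteq> [] \<Longrightarrow> Re (weight w) > 0"
  by (cases w) (auto intro: add_pos_nonneg weight_nonneg wt_pos)

lemma finite_bounded_weight: "finite {w. set w \<subseteq> A \<and> Re (weight w) \<le> B}"
proof -
  obtain \<mu> where \<mu>: "\<mu> > 0" "\<And>w. set w \<subseteq> A \<Longrightarrow> \<mu> * real (length w) \<le> Re (weight w)"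
    using length_le_weight by blast
  obtain N where N: "real N > B / \<mu>" using reals_Archimedean2 by blast
  have "length w \<le> N" if "set w \<subseteq> A" "Re (weight w) \<le> B" for w
  proof -
    have "\<mu> * real (length w) \<le> B" using \<mu>(2) that by fastforce
    then have "real (length w) \<le> B / \<mu>" using \<mu>(1) by (simp add: field_simps)
    then show ?thesis using N by linarith
  qed
  then have "{w. set w \<subseteq> A \<and> Re (weight w) \<le> B} \<subseteq> {w. set w \<subseteq> A \<and> length w \<le> N}" by auto
  then show ?thesis using finite_lists_length_le[OF finite_A] by (rule finite_subset)
qed

lemma finite_words: "finite (words n)"
  by (rule finite_subset[OF _ finite_bounded_weight[of "Re (of_nat n * e + \<delta>)"]])
    (auto simp: words_def accepted_def walk_def)

lemma card_words_le: "\<exists>K>0. \<forall>n\<ge>1. real (card (words n)) \<le> exp (K * real n)"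
proof -
  obtain \<mu> where \<mu>: "\<mu> > 0" "\<And>w. set w \<subseteq> A \<Longrightarrow> \<mu> * real (length w) \<le> Re (weight w)"
    using length_le_weight by blast
  obtain N where N: "real N > (Re e + \<bar>Re \<delta>\<bar>) / \<mu>" using reals_Archimedean2 by blast
  \<comment> \<open>\<open>card A + 1\<close> of these units bound the longest words and the last
    one absorbs all shorter words in the induction below; moreover \<open>b \<ge> 2\<close> keeps
    \<open>ln b\<close> positive.\<close>
  define b where "b = card A + 2"
  have le: "(\<Sum>i\<le>M. card A ^ i) \<le> b ^ M" for M
  proof (induction M)
    case (Suc M)
    have "card A ^ Suc M \<le> (card A + 1) * b ^ M"
      by (simp add: b_def) (intro trans_le_add2 mult_le_mono power_mono; simp)
    then show ?case using Suc by (simp add: b_def)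
  qed simp
  have "real (card (words n)) \<le> exp ((real N + 1) * ln (real b) * real n)" if n: "n \<ge> 1" for n
  proof -
    have "length w \<le> N * n" if "w \<in> words n" for w
    proof -
      have "\<mu> * real (length w) \<le> real n * Re e + Re \<delta>"
        using \<mu>(2)[of w] that by (auto simp: words_def accepted_def walk_def)
      also have "\<dots> \<le> real n * Re e + real n * \<bar>Re \<delta>\<bar>"
        using n mult_right_mono[of 1 "real n" "\<bar>Re \<delta>\<bar>"] by simp
      also have "\<dots> = real n * (Re e + \<bar>Re \<delta>\<bar>)" by (simp add: algebra_simps)
      also have "\<dots> \<le> real n * (real N * \<mu>)"
        using N \<mu>(1) by (intro mult_left_mono) (auto simp: field_simps)
      finally have "\<mu> * real (length w) \<le> \<mu> * real (N * n)" by (simp add: algebra_simps)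
      then have "real (length w) \<le> real (N * n)" using \<mu>(1) by simp
      then show ?thesis by linarith
    qed
    then have "words n \<subseteq> {w. set w \<subseteq> A \<and> length w \<le> N * n}"
      by (auto simp: words_def accepted_def walk_def)
    then have "card (words n) \<le> card {w. set w \<subseteq> A \<and> length w \<le> N * n}"
      by (intro card_mono finite_lists_length_le finite_A)
    also have "\<dots> \<le> b ^ (N * n)" using le by (simp add: card_lists_length_le finite_A)
    finally have "real (card (words n)) \<le> real b ^ (N * n)"
      by (metis of_nat_le_iff of_nat_power)
    also have "\<dots> = exp (real N * ln (real b) * real n)"
      using exp_of_nat_mult[of "N * n" "ln (real b)"] by (simp add: b_def algebra_simps)
    also have "\<dots> \<le> exp ((real N + 1) * ln (real b) * real n)"
      by (simp add: b_def algebra_simps)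
    finally show ?thesis .
  qed
  moreover have "(real N + 1) * ln (real b) > 0" by (simp add: b_def)
  ultimately show ?thesis by blast
qed

section \<open>Insertion of closed walks and the exponential lower bound\<close>

lemma accepted_insert:
  assumes "accepted (p @ x # q)" "closed_walk A c" "hd c = x"
  shows "accepted (p @ c @ x # q)"
proof -
  obtain c' where c: "c = x # c'" using assms by (cases c) (auto simp: closed_walk_def)
  have "successively R (p @ [x])" "successively R (x # q)"
    using assms(1) successively_append_Cons[of R p x q] by (auto simp: accepted_def walk_def)
  moreover have "successively R ((x # c') @ [x])"
    using assms(2) by (simp add: c closed_walk_def)
  ultimately have "successively R (p @ x # (c' @ x # q))"
    by (metis append_Cons successively_append_Cons)
  then have "successively R (p @ (x # c') @ x # q)" by simp
  then show ?thesis
    using assms unfolding c accepted_def walk_def closed_walk_def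
    by (auto simp: hd_append)
qed

lemma closed_walk_mono: "closed_walk H c \<Longrightarrow> H \<subseteq> H' \<Longrightarrow> closed_walk H' c"
  by (auto simp: closed_walk_def)

text \<open>The closed walks use only letters of \<open>w\<close>, so every base point occurs in the
  word. The letter set is preserved, which allows the insertion to be iterated.\<close>

lemma accepted_insert_family:
  assumes "accepted w" "\<forall>c\<in>#\<Gamma>. closed_walk (set w) c"
  shows "\<exists>w'. accepted w' \<and> set w' = set w \<and> weight w' = weight w + total \<Gamma>"
  using assms
proof (induction \<Gamma> arbitrary: w)
  case empty
  then show ?case by auto
next
  case (add c \<Gamma>)
  have "\<forall>c\<in>#\<Gamma>. closed_walk (set w) c" using add.prems(2) by simp
  from add.IH[OF add.prems(1) this]
  obtain w' where w': "accepted w'" "set w' = set w" "weight w' = weight w + total \<Gamma>" by blast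
  have c: "closed_walk (set w) c" using add.prems by auto
  then have "hd c \<in> set w'" unfolding w'(2) by (auto simp: closed_walk_def)
  then obtain p q where pq: "w' = p @ hd c # q" by (meson split_list)
  have "accepted (p @ c @ hd c # q)"
  proof (rule accepted_insert)
    show "closed_walk A c"
      using w'(1,2) by (intro closed_walk_mono[OF c]) (simp add: accepted_def walk_def)
  qed (use w'(1) pq in auto)
  moreover have "set (p @ c @ hd c # q) = set w"
    using c w'(2) unfolding pq by (auto simp: closed_walk_def)
  moreover have "weight (p @ c @ hd c # q) = weight w + total (add_mset c \<Gamma>)"
    using w'(3) unfolding pq by (simp add: algebra_simps)
  ultimately show ?case by blast
qed

lemma accepted_insert_family_repeat:
  assumes "accepted w" "\<forall>c\<in>#\<Gamma>. closed_walk (set w) c"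
  shows "\<exists>w'. accepted w' \<and> set w' = set w \<and> weight w' = weight w + of_nat j * total \<Gamma>"
proof (induction j)
  case 0
  then show ?case using assms by auto
next
  case (Suc j)
  then obtain w' where w': "accepted w'" "set w' = set w" "weight w' = weight w + of_nat j * total \<Gamma>"
    by blast
  from accepted_insert_family[OF w'(1), of \<Gamma>] assms(2) w'(2)
  obtain w'' where "accepted w''" "set w'' = set w'" "weight w'' = weight w' + total \<Gamma>" by auto
  then show ?case using w' by (intro exI[of _ w'']) (simp add: algebra_simps)
qed

text \<open>A bit string is encoded by choosing the order of \<open>c\<close> and \<open>d\<close>
  in each block. All blocks have equal length, so the bits can be decoded when \<open>c\<close> and
  \<open>d\<close> do not commute.\<close>

definition blocks :: "'a list \<Rightarrow> 'a list \<Rightarrow> bool list \<Rightarrow> 'a list" where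
  "blocks c d bs = concat (map (\<lambda>b. if b then c @ d else d @ c) bs)"

lemma blocks_simps [simp]:
  "blocks c d [] = []" "blocks c d (b # bs) = (if b then c @ d else d @ c) @ blocks c d bs"
  by (auto simp: blocks_def)

lemma weight_blocks: "weight (blocks c d bs) = of_nat (length bs) * (weight c + weight d)"
  by (induction bs) (auto simp: algebra_simps)

lemma blocks_inj:
  assumes "c @ d \<noteq> d @ c" "length bs = length bs'" "blocks c d bs = blocks c d bs'"
  shows "bs = bs'"
  using assms(2,3)
proof (induction bs bs' rule: list_induct2)
  case (Cons b bs b' bs')
  have "length (if b then c @ d else d @ c) = length (if b' then c @ d else d @ c)" by auto
  then show ?case using Cons assms(1) by (auto split: if_splits)
qed simp

lemma accepted_blocks:
  assumes "accepted (p @ x # q)" "closed_walk A c" "closed_walk A d" "hd c = x" "hd d = x"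
  shows "accepted (p @ blocks c d bs @ x # q)"
  using assms(1)
proof (induction bs arbitrary: p)
  case (Cons b bs)
  have step: "accepted (p @ (u @ v) @ x # q)"
    if u: "closed_walk A u" "hd u = x" and v: "closed_walk A v" "hd v = x" for u v
  proof -
    obtain v' where v': "v = x # v'" using v unfolding closed_walk_def by (cases v) auto
    have "accepted (p @ x # v' @ x # q)"
      using accepted_insert[OF Cons.prems v] v' by simp
    from accepted_insert[OF this u] show ?thesis by (simp add: v')
  qed
  have "accepted ((p @ (if b then c @ d else d @ c)) @ x # q)"
    using step assms by auto
  from Cons.IH[OF this] show ?case by simp
qed simp

lemma branching_with_pos:
  assumes "branching_with H k" "H \<subseteq> A"
  shows "k \<ge> 1"
proof -
  obtain \<Gamma> c d where \<Gamma>: "family H \<Gamma> k" "{#c, d#} \<subseteq># \<Gamma>"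
    using assms(1) unfolding branching_with_def by blast
  then have "c \<in># \<Gamma>" using mset_subset_eqD by fastforce
  have nn: "Re (total \<Delta>) \<ge> 0" if "\<forall>c\<in>#\<Delta>. closed_walk H c" for \<Delta>
    using that
    by (induction \<Delta>) (use assms(2) in \<open>auto intro!: add_nonneg_nonneg weight_nonneg simp: closed_walk_def\<close>)
  obtain \<Delta> where \<Delta>: "\<Gamma> = add_mset c \<Delta>" using \<open>c \<in># \<Gamma>\<close> by (metis insert_DiffM)
  have cl: "\<forall>c\<in>#\<Gamma>. closed_walk H c" using \<Gamma>(1) by (auto simp: family_def)
  then have "Re (weight c) > 0" using assms(2) \<Delta>
    by (auto intro!: weight_pos simp: closed_walk_def)
  moreover have "Re (total \<Delta>) \<ge> 0" using cl \<Delta> by (intro nn) auto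
  ultimately have "Re (total \<Gamma>) > 0" by (simp add: \<Delta>)
  then show ?thesis using \<Gamma>(1) e_pos by (cases k) (auto simp: family_def)
qed

text \<open>The remaining members \<Delta> of the family are inserted \<open>j\<close> times in a
  fixed manner, then \<open>c\<close> and \<open>d\<close> are inserted as \<open>j\<close> blocks
  with free order. Together this adds \<open>j\<close> times the total of the family, that is,
  \<open>j * k\<close> in the index.\<close>

lemma card_words_ge:
  assumes "w \<in> words n" "branching_with (set w) k"
  shows "2 ^ j \<le> card (words (n + j * k))"
proof -
  obtain \<Gamma> c d where \<Gamma>: "family (set w) \<Gamma> k" "{#c, d#} \<subseteq># \<Gamma>" "hd c = hd d" "c @ d \<noteq> d @ c"
    using assms(2) unfolding branching_with_def by blast
  have w: "accepted w" "weight w = of_nat n * e + \<delta>" "set w \<subseteq> A"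
    using assms(1) by (auto simp: words_def accepted_def walk_def)
  define \<Delta> where "\<Delta> = \<Gamma> - {#c, d#}"
  have \<Gamma>eq: "\<Gamma> = {#c, d#} + \<Delta>"
    unfolding \<Delta>_def by (rule subset_mset.add_diff_inverse[OF \<Gamma>(2), symmetric])
  have cl: "closed_walk (set w) c" "closed_walk (set w) d" "\<forall>c\<in>#\<Delta>. closed_walk (set w) c"
    using \<Gamma>(1) unfolding family_def \<Gamma>eq by auto
  have tot: "weight c + weight d + total \<Delta> = of_nat k * e"
    using \<Gamma>(1) unfolding family_def \<Gamma>eq by (simp add: algebra_simps)
  obtain w' where w': "accepted w'" "set w' = set w" "weight w' = weight w + of_nat j * total \<Delta>"
    using accepted_insert_family_repeat[OF w(1) cl(3)] by blast
  have "hd c \<in> set w'" using cl(1) w'(2) by (auto simp: closed_walk_def)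
  then obtain p q where pq: "w' = p @ hd c # q" by (meson split_list)
  define f where "f bs = p @ blocks c d bs @ hd c # q" for bs
  have "f ` {bs. length bs = j} \<subseteq> words (n + j * k)"
  proof clarify
    fix bs :: "bool list" assume "j = length bs"
    have "accepted (f bs)" unfolding f_def
      using w'(1) cl w(3) \<Gamma>(3) unfolding pq
      by (intro accepted_blocks closed_walk_mono[OF cl(1)] closed_walk_mono[OF cl(2)]) auto
    moreover have "weight (f bs) = of_nat n * e + \<delta> + of_nat j * (weight c + weight d + total \<Delta>)"
      using w'(3) w(2) \<open>j = length bs\<close> unfolding pq f_def by (simp add: weight_blocks algebra_simps)
    ultimately show "f bs \<in> words (n + length bs * k)"
      unfolding words_def tot \<open>j = length bs\<close> by (simp add: algebra_simps)
  qed
  moreover have inj: "inj_on f {bs. length bs = j}"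
  proof (rule inj_onI)
    fix bs bs' assume *: "bs \<in> {bs. length bs = j}" "bs' \<in> {bs. length bs = j}" "f bs = f bs'"
    show "bs = bs'"
      by (rule blocks_inj[OF \<Gamma>(4)]) (use * in \<open>simp_all add: f_def\<close>)
  qed
  moreover have "card {bs :: bool list. length bs = j} = 2 ^ j"
    using card_lists_length_eq[of "UNIV :: bool set" j] by simp
  ultimately show ?thesis using card_inj_on_le[OF inj _ finite_words[of "n + j * k"]] by simp
qed

lemma words_restrict:
  assumes "H \<subseteq> A"
  shows "finite {w. walk H w \<and> Q w \<and> weight w = z}"
  by (rule finite_subset[OF _ finite_bounded_weight[of "Re z"]]) (use assms in \<open>auto simp: walk_def\<close>)

lemma total_nonneg:
  assumes "\<forall>c\<in>#\<Gamma>. closed_walk H c" "H \<subseteq> A"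
  shows "Re (total \<Gamma>) \<ge> 0"
  using assms(1)
proof (induction \<Gamma>)
  case (add c \<Gamma>)
  then have "Re (weight c) \<ge> 0" using assms(2) by (intro weight_nonneg) (auto simp: closed_walk_def)
  with add show ?case by simp
qed simp

lemma branching_mono: "branching H' \<Longrightarrow> H' \<subseteq> H \<Longrightarrow> branching H"
  unfolding branching_def branching_with_def family_def
  using closed_walk_mono by blast

end

section \<open>Letter sets without branching\<close>

locale nonbranching_words = weighted_words +
  fixes H
  assumes H_subset: "H \<subseteq> A" and nonbranching: "\<not> branching H"
begin

definition good :: "'a list \<Rightarrow> bool" where
  "good c \<longleftrightarrow> (\<exists>\<Gamma> k. family H \<Gamma> k \<and> c \<in># \<Gamma>)"

text \<open>Appending \<open>a\<close> to \<open>tl c\<close> includes the closing step, so that a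
  walk with the single letter \<open>a\<close> yields the step from \<open>a\<close> to
  itself.\<close>

definition good_step :: "'a \<Rightarrow> 'a \<Rightarrow> bool" where
  "good_step a b \<longleftrightarrow> (\<exists>c. good c \<and> hd c = a \<and> b = hd (tl c @ [a]))"

lemma good_closed_walk: "good c \<Longrightarrow> closed_walk H c"
  by (auto simp: good_def family_def)

text \<open>The union of two families is a family, so commutation holds across different families as
  well.\<close>

lemma good_commute:
  assumes "good c" "good d" "hd c = hd d"
  shows "c @ d = d @ c"
proof (rule ccontr)
  assume ne: "c @ d \<noteq> d @ c"
  obtain \<Gamma> k where \<Gamma>: "family H \<Gamma> k" "c \<in># \<Gamma>" using assms(1) by (auto simp: good_def)
  obtain \<Delta> l where \<Delta>: "family H \<Delta> l" "d \<in># \<Delta>" using assms(2) by (auto simp: good_def)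
  have "family H (\<Gamma> + \<Delta>) (k + l)"
    using \<Gamma>(1) \<Delta>(1) by (auto simp: family_def algebra_simps)
  moreover have "{#c, d#} \<subseteq># \<Gamma> + \<Delta>"
    using subset_mset.add_mono[of "{#c#}" \<Gamma> "{#d#}" \<Delta>] \<Gamma>(2) \<Delta>(2)
    by (simp add: add_mset_commute)
  ultimately have "branching_with H (k + l)"
    unfolding branching_with_def using assms(3) ne by blast
  then show False using nonbranching by (auto simp: branching_def)
qed

text \<open>The second letters of \<open>c @ d\<close> and \<open>d @ c\<close> agree. Thus a walk
  that continues with good steps has no choice.\<close>

lemma good_step_unique:
  assumes "good_step a b" "good_step a b'"
  shows "b = b'"
proof -
  obtain c where c: "good c" "hd c = a" "b = hd (tl c @ [a])"
    using assms(1) by (auto simp: good_step_def)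
  obtain d where d: "good d" "hd d = a" "b' = hd (tl d @ [a])"
    using assms(2) by (auto simp: good_step_def)
  obtain c' where c': "c = a # c'"
    using good_closed_walk[OF c(1)] c(2) by (cases c) (auto simp: closed_walk_def)
  obtain d' where d': "d = a # d'"
    using good_closed_walk[OF d(1)] d(2) by (cases d) (auto simp: closed_walk_def)
  have "c @ d = d @ c" using c d by (intro good_commute) auto
  then have "c' @ a # d' = d' @ a # c'" by (simp add: c' d')
  moreover have "hd (c' @ a # d') = b" using c by (cases c') (auto simp: c')
  moreover have "hd (d' @ a # c') = b'" using d by (cases d') (auto simp: d')
  ultimately show ?thesis by simp
qed

lemma closed_walk_rotate:
  assumes "closed_walk H (u @ v)"
  shows "closed_walk H (v @ u)"
proof (cases "u = [] \<or> v = []")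
  case False
  then show ?thesis using assms
    by (auto simp: closed_walk_def successively_append_iff)
qed (use assms in auto)

lemma good_rotate:
  assumes "good (u @ v)"
  shows "good (v @ u)"
proof -
  obtain \<Gamma> k where \<Gamma>: "family H \<Gamma> k" "u @ v \<in># \<Gamma>" using assms by (auto simp: good_def)
  then obtain \<Delta> where \<Delta>: "\<Gamma> = add_mset (u @ v) \<Delta>" by (metis insert_DiffM)
  have "family H (add_mset (v @ u) \<Delta>) k"
    using \<Gamma>(1) unfolding \<Delta> family_def by (auto intro: closed_walk_rotate simp: add.commute)
  then show ?thesis by (auto simp: good_def intro!: exI[of _ "add_mset (v @ u) \<Delta>"])
qed

text \<open>Rotating a member keeps its weight and hence the family; every step of a good walk
  becomes the first step of one of its rotations.\<close>

lemma good_steps: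
  assumes "good c"
  shows "successively good_step (c @ [hd c])"
  unfolding successively_conv_nth
proof (intro allI impI)
  fix i assume "Suc i < length (c @ [hd c])"
  then have i: "i < length c" by simp
  have "good (drop i c @ take i c)" using assms good_rotate[of "take i c" "drop i c"] by simp
  moreover have "hd (drop i c @ take i c) = c ! i" using i by (simp add: hd_drop_conv_nth)
  moreover have "(c @ [hd c]) ! Suc i = hd (tl (drop i c @ take i c) @ [c ! i])"
  proof (cases "Suc i < length c")
    case True
    then have "tl (drop i c) \<noteq> []" by (metis drop_Suc drop_eq_Nil not_le tl_drop)
    moreover have "hd (tl (drop i c)) = c ! Suc i"
      using True by (metis drop_Suc hd_drop_conv_nth tl_drop)
    moreover have "drop i c \<noteq> []" using i by simp
    ultimately show ?thesis using True by (simp add: nth_append hd_append)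
  next
    case False
    then have "Suc i = length c" using i by simp
    then have "drop i c = [c ! i]" using i by (simp add: Cons_nth_drop_Suc[symmetric])
    moreover have "hd (take i c @ [c ! i]) = hd c"
      using i by (cases c; cases i) auto
    ultimately show ?thesis using \<open>Suc i = length c\<close> by (simp add: nth_append)
  qed
  ultimately show "good_step ((c @ [hd c]) ! i) ((c @ [hd c]) ! Suc i)"
    unfolding good_step_def using i by (auto simp: nth_append)
qed

fun bad :: "'a list \<Rightarrow> nat" where
  "bad [] = 0"
| "bad [x] = 0"
| "bad (x # y # w) = (if good_step x y then 0 else 1) + bad (y # w)"

lemma bad_append_Cons: "bad (u @ y # v) = bad (u @ [y]) + bad (y # v)"
proof (induction u)
  case (Cons x u)
  then show ?case by (cases u) auto
qed simp

lemma bad_eq_0: "successively good_step w \<Longrightarrow> bad w = 0"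
  by (induction w rule: bad.induct) auto

text \<open>Cutting at a repeated letter distributes the cyclic steps over two shorter closed walks,
  so both the weight and the number of bad steps are additive. There are only finitely many walks
  without repetition, as Dickson's lemma requires.\<close>

lemma closed_walk_decomp:
  assumes "closed_walk H c"
  shows "\<exists>\<Gamma>. (\<forall>d\<in>#\<Gamma>. closed_walk H d \<and> distinct d) \<and> total \<Gamma> = weight c \<and>
    bad (c @ [hd c]) = (\<Sum>d\<in>#\<Gamma>. bad (d @ [hd d]))"
  using assms
proof (induction c rule: length_induct)
  case (1 c)
  show ?case
  proof (cases "distinct c")
    case True
    then show ?thesis using 1 by (intro exI[of _ "{#c#}"]) auto
  next
    case False
    then obtain xs ys zs y where c: "c = xs @ [y] @ ys @ [y] @ zs"
      using not_distinct_decomp by blast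
    have cs: "successively R (xs @ y # (ys @ y # (zs @ [hd c])))"
      using "1.prems" by (simp add: closed_walk_def c)
    have s1: "successively R (xs @ [y])" "successively R (y # (ys @ y # (zs @ [hd c])))"
      using cs successively_append_Cons[of R xs y "ys @ y # (zs @ [hd c])"] by blast+
    have "successively R ((y # ys) @ y # (zs @ [hd c]))" using s1(2) by simp
    then have s2: "successively R ((y # ys) @ [y])" "successively R (y # (zs @ [hd c]))"
      using successively_append_Cons[of R "y # ys" y "zs @ [hd c]"] by blast+
    have hd: "hd (xs @ [y] @ zs) = hd c" by (cases xs) (auto simp: c)
    have "successively R (xs @ y # (zs @ [hd c]))"
      using s1(1) s2(2) successively_append_Cons[of R xs y] by blast
    then have cw1: "closed_walk H (xs @ [y] @ zs)"
      using "1.prems" unfolding closed_walk_def hd by (simp add: c)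
    have cw2: "closed_walk H (y # ys)"
      using "1.prems" s2 by (simp add: closed_walk_def c)
    obtain \<Gamma> where \<Gamma>: "\<forall>d\<in>#\<Gamma>. closed_walk H d \<and> distinct d" "total \<Gamma> = weight (xs @ [y] @ zs)"
       "bad ((xs @ [y] @ zs) @ [hd c]) = (\<Sum>d\<in>#\<Gamma>. bad (d @ [hd d]))"
      using "1.IH"[rule_format, of "xs @ [y] @ zs"] cw1 hd by (auto simp: c)
    obtain \<Delta> where \<Delta>: "\<forall>d\<in>#\<Delta>. closed_walk H d \<and> distinct d" "total \<Delta> = weight (y # ys)"
       "bad ((y # ys) @ [y]) = (\<Sum>d\<in>#\<Delta>. bad (d @ [hd d]))"
      using "1.IH"[rule_format, of "y # ys"] cw2 by (auto simp: c)
    have "bad (c @ [hd c]) = bad (xs @ [y]) + (bad ((y # ys) @ [y]) + bad (y # (zs @ [hd c])))"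
      using bad_append_Cons[of xs y "ys @ y # zs @ [hd c]"]
        bad_append_Cons[of "y # ys" y "zs @ [hd c]"] by (simp add: c)
    moreover have "bad ((xs @ [y] @ zs) @ [hd c]) = bad (xs @ [y]) + bad (y # (zs @ [hd c]))"
      using bad_append_Cons[of xs y "zs @ [hd c]"] by simp
    ultimately have "bad (c @ [hd c]) = (\<Sum>d\<in>#\<Gamma> + \<Delta>. bad (d @ [hd d]))"
      using \<Gamma>(3) \<Delta>(3) by simp
    moreover have "total (\<Gamma> + \<Delta>) = weight c" using \<Gamma>(2) \<Delta>(2) by (simp add: c)
    moreover have "\<forall>d\<in>#\<Gamma> + \<Delta>. closed_walk H d \<and> distinct d" using \<Gamma>(1) \<Delta>(1) by auto
    ultimately show ?thesis by (intro exI[of _ "\<Gamma> + \<Delta>"] conjI)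
  qed
qed

text \<open>The same cutting for open walks; what remains after removing all cycles is the
  repetition-free word \<open>p\<close>.\<close>

lemma walk_decomp:
  assumes "walk H w"
  shows "\<exists>p \<Gamma>. set p \<subseteq> H \<and> distinct p \<and> (\<forall>d\<in>#\<Gamma>. closed_walk H d \<and> distinct d) \<and>
    weight w = weight p + total \<Gamma> \<and> bad w = bad p + (\<Sum>d\<in>#\<Gamma>. bad (d @ [hd d]))"
  using assms
proof (induction w rule: length_induct)
  case (1 w)
  show ?case
  proof (cases "distinct w")
    case True
    then show ?thesis using 1 by (intro exI[of _ w] exI[of _ "{#}"]) (auto simp: walk_def)
  next
    case False
    then obtain xs ys zs y where w: "w = xs @ [y] @ ys @ [y] @ zs"
      using not_distinct_decomp by blast
    have ws: "successively R (xs @ y # (ys @ y # zs))"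
      using "1.prems" by (simp add: walk_def w)
    have s1: "successively R (xs @ [y])" "successively R (y # (ys @ y # zs))"
      using ws successively_append_Cons[of R xs y "ys @ y # zs"] by blast+
    have "successively R ((y # ys) @ y # zs)" using s1(2) by simp
    then have s2: "successively R ((y # ys) @ [y])" "successively R (y # zs)"
      using successively_append_Cons[of R "y # ys" y zs] by blast+
    have "successively R (xs @ y # zs)"
      using s1(1) s2(2) successively_append_Cons[of R xs y] by blast
    then have w1: "walk H (xs @ [y] @ zs)"
      using "1.prems" unfolding walk_def by (simp add: w)
    have cw2: "closed_walk H (y # ys)"
      using "1.prems" s2 by (simp add: closed_walk_def walk_def w)
    obtain p \<Gamma> where \<Gamma>: "set p \<subseteq> H" "distinct p" "\<forall>d\<in>#\<Gamma>. closed_walk H d \<and> distinct d"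
       "weight (xs @ [y] @ zs) = weight p + total \<Gamma>"
       "bad (xs @ [y] @ zs) = bad p + (\<Sum>d\<in>#\<Gamma>. bad (d @ [hd d]))"
      using "1.IH"[rule_format, of "xs @ [y] @ zs"] w1 by (auto simp: w)
    obtain \<Delta> where \<Delta>: "\<forall>d\<in>#\<Delta>. closed_walk H d \<and> distinct d" "total \<Delta> = weight (y # ys)"
       "bad ((y # ys) @ [y]) = (\<Sum>d\<in>#\<Delta>. bad (d @ [hd d]))"
      using closed_walk_decomp[OF cw2] by auto
    have "bad w = bad (xs @ [y]) + (bad ((y # ys) @ [y]) + bad (y # zs))"
      using bad_append_Cons[of xs y "ys @ y # zs"] bad_append_Cons[of "y # ys" y zs] by (simp add: w)
    moreover have "bad (xs @ [y] @ zs) = bad (xs @ [y]) + bad (y # zs)"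
      using bad_append_Cons[of xs y zs] by simp
    ultimately have "bad w = bad p + (\<Sum>d\<in>#\<Gamma> + \<Delta>. bad (d @ [hd d]))"
      using \<Gamma>(5) \<Delta>(3) by simp
    moreover have "weight w = weight p + total (\<Gamma> + \<Delta>)"
      using \<Gamma>(4) \<Delta>(2) by (simp add: w algebra_simps)
    moreover have "\<forall>d\<in>#\<Gamma> + \<Delta>. closed_walk H d \<and> distinct d" using \<Gamma>(3) \<Delta>(1) by auto
    ultimately show ?thesis using \<Gamma>(1,2)
      by (intro exI[of _ p] exI[of _ "\<Gamma> + \<Delta>"] conjI)
  qed
qed

lemma finite_H: "finite H"
  using H_subset finite_A by (rule finite_subset)

text \<open>By Dickson's lemma all but boundedly many of the cycles in a solution belong to a family
  of total weight in \<open>\<nat> * e\<close>; these are good and contribute no bad step.\<close>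
lemma bad_bounded: "\<exists>B. \<forall>w n. walk H w \<longrightarrow> weight w = of_nat n * e + \<delta> \<longrightarrow> bad w \<le> B"
proof -
  define P where "P = {p. set p \<subseteq> H \<and> distinct p}"
  have finP: "finite P" unfolding P_def by (rule finite_subset_distinct[OF finite_H])
  define V where "V p = {\<Gamma>. (\<forall>d\<in>#\<Gamma>. closed_walk H d \<and> distinct d) \<and>
     (\<exists>n. weight p + total \<Gamma> = of_nat n * e + \<delta>)}" for p
  have "\<exists>B. \<forall>\<Gamma>\<in>V p. (\<Sum>d\<in>#\<Gamma>. bad (d @ [hd d])) \<le> B" for p
  proof -
    have VP: "set_mset \<Gamma> \<subseteq> P" if "\<Gamma> \<in> V p" for \<Gamma>
      using that by (auto simp: V_def P_def closed_walk_def)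
    from Dickson_multiset[OF finP VP]
    obtain F where "finite F \<and> F \<subseteq> V p \<and> (\<forall>\<Gamma>\<in>V p. \<exists>\<Delta>\<in>F. \<Delta> \<subseteq># \<Gamma>)" ..
    then have F: "finite F" "F \<subseteq> V p" "\<forall>\<Gamma>\<in>V p. \<exists>\<Delta>\<in>F. \<Delta> \<subseteq># \<Gamma>" by simp_all
    define B where "B = Max (insert 0 ((\<lambda>\<Gamma>. \<Sum>d\<in>#\<Gamma>. bad (d @ [hd d])) ` F))"
    have "(\<Sum>d\<in>#\<Gamma>. bad (d @ [hd d])) \<le> B" if \<Gamma>: "\<Gamma> \<in> V p" for \<Gamma>
    proof -
      obtain \<Delta> where \<Delta>: "\<Delta> \<in> F" "\<Delta> \<subseteq># \<Gamma>" using F \<Gamma> by blast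
      \<comment> \<open>\<Theta> is the difference of two solutions with the same \<open>p\<close>.
        Its total is therefore an integer multiple of \<open>e\<close>, and nonnegativity of the
        real part makes the factor a natural number: \<Theta> is a family.\<close>
      define \<Theta> where "\<Theta> = \<Gamma> - \<Delta>"
      have \<Gamma>eq: "\<Gamma> = \<Delta> + \<Theta>"
        unfolding \<Theta>_def by (rule subset_mset.add_diff_inverse[OF \<Delta>(2), symmetric])
      obtain n where n: "weight p + total \<Gamma> = of_nat n * e + \<delta>"
        using \<Gamma> unfolding V_def by blast
      obtain k where k: "weight p + total \<Delta> = of_nat k * e + \<delta>"
        using \<Delta>(1) F(2) unfolding V_def by blast
      have cl: "\<forall>d\<in>#\<Theta>. closed_walk H d" using \<Gamma> unfolding V_def \<Gamma>eq by auto
      have "(weight p + total \<Delta>) + total \<Theta> = of_nat n * e + \<delta>"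
        using n by (simp add: \<Gamma>eq add.assoc)
      then have tot: "total \<Theta> = (of_nat n - of_nat k) * e"
        unfolding k by (simp add: algebra_simps)
      moreover have "Re (total \<Theta>) \<ge> 0" using cl H_subset by (rule total_nonneg)
      ultimately have "k \<le> n" using e_pos by (simp add: zero_le_mult_iff)
      then have "family H \<Theta> (n - k)" using tot cl by (simp add: family_def of_nat_diff)
      then have "good d" if "d \<in># \<Theta>" for d using that by (auto simp: good_def)
      then have "(\<Sum>d\<in>#\<Theta>. bad (d @ [hd d])) = 0"
        using bad_eq_0 good_steps by (simp add: sum_mset_0_iff)
      moreover have "(\<Sum>d\<in>#\<Delta>. bad (d @ [hd d])) \<le> B"
        unfolding B_def using F(1) \<Delta>(1) by (intro Max_ge) auto
      ultimately show ?thesis unfolding \<Gamma>eq image_mset_union sum_mset.union by linarith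
    qed
    then show ?thesis by blast
  qed
  then have "\<forall>p. \<exists>B. \<forall>\<Gamma>\<in>V p. (\<Sum>d\<in>#\<Gamma>. bad (d @ [hd d])) \<le> B" by blast
  from choice[OF this] obtain B where B: "\<forall>p. \<forall>\<Gamma>\<in>V p. (\<Sum>d\<in>#\<Gamma>. bad (d @ [hd d])) \<le> B p" ..
  have "bad w \<le> Max ((\<lambda>p. bad p + B p) ` P)"
    if w: "walk H w" "weight w = of_nat n * e + \<delta>" for w n
  proof -
    obtain p \<Gamma> where p: "set p \<subseteq> H" "distinct p" "\<forall>d\<in>#\<Gamma>. closed_walk H d \<and> distinct d"
      "weight w = weight p + total \<Gamma>" "bad w = bad p + (\<Sum>d\<in>#\<Gamma>. bad (d @ [hd d]))"
      using walk_decomp[OF w(1)] by blast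
    have "weight p + total \<Gamma> = of_nat n * e + \<delta>" using p(4) w(2) by simp
    then have "\<Gamma> \<in> V p" unfolding V_def using p(3) by blast
    then have "bad w \<le> bad p + B p" using p(5) B by auto
    also have "\<dots> \<le> Max ((\<lambda>p. bad p + B p) ` P)"
      using finP p(1,2) by (intro Max_ge) (auto simp: P_def)
    finally show ?thesis .
  qed
  then show ?thesis by blast
qed

definition walks_from :: "nat \<Rightarrow> 'a \<Rightarrow> complex \<Rightarrow> 'a list set" where
  "walks_from k x z = {w. walk H w \<and> (hd w = x \<and> last w \<in> En \<and> bad w = k) \<and> weight w = z}"

definition num_walks :: "nat \<Rightarrow> 'a \<Rightarrow> complex \<Rightarrow> real" where
  "num_walks k x z = real (card (walks_from k x z))"

lemma finite_walks_from: "finite (walks_from k x z)"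
  unfolding walks_from_def by (rule words_restrict[OF H_subset])

lemma num_walks_neg: "Re z < 0 \<Longrightarrow> num_walks k x z = 0"
proof -
  assume "Re z < 0"
  moreover have "Re (weight w) \<ge> 0" if "walk H w" for w
    using that H_subset by (intro weight_nonneg) (auto simp: walk_def)
  ultimately have "walks_from k x z = {}"
    unfolding walks_from_def by fastforce
  then show ?thesis by (simp add: num_walks_def)
qed

lemma good_step_R: "good_step x y \<Longrightarrow> x \<in> H \<and> y \<in> H \<and> R x y"
proof -
  assume "good_step x y"
  then obtain c where c: "good c" "hd c = x" "y = hd (tl c @ [x])" by (auto simp: good_step_def)
  obtain c' where c': "c = x # c'"
    using good_closed_walk[OF c(1)] c(2) by (cases c) (auto simp: closed_walk_def)
  show ?thesis using good_closed_walk[OF c(1)] c(3) unfolding closed_walk_def c'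
    by (cases c') (auto simp: successively_Cons)
qed

text \<open>Case distinction on the first step: the walk stops, makes a good step and keeps
  \<open>k\<close>, or makes a bad step and uses up one. The guard for \<open>k = 0\<close>
  compensates for truncated subtraction.\<close>

lemma num_walks_rec:
  assumes x: "x \<in> H"
  shows "num_walks k x z = of_bool (k = 0 \<and> x \<in> En \<and> z = wt x)
    + (\<Sum>y | good_step x y. num_walks k y (z - wt x))
    + (\<Sum>y | y \<in> H \<and> R x y \<and> \<not> good_step x y. if k = 0 then 0 else num_walks (k - 1) y (z - wt x))"
proof -
  define S1 where "S1 = (if k = 0 \<and> x \<in> En \<and> z = wt x then {[x]} else {})"
  define Y2 where "Y2 = {y. good_step x y}"
  define Y3 where "Y3 = {y. y \<in> H \<and> R x y \<and> \<not> good_step x y}"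
  define S2 where "S2 = (\<Union>y\<in>Y2. walks_from k y (z - wt x))"
  define S3 where "S3 = (\<Union>y\<in>Y3. if k = 0 then {} else walks_from (k - 1) y (z - wt x))"
  have fin: "finite Y2" "finite Y3"
    by (rule finite_subset[OF _ finite_H], use good_step_R in \<open>auto simp: Y2_def Y3_def\<close>)+
  have hdS2: "hd w \<in> Y2" if "w \<in> S2" for w using that by (auto simp: S2_def walks_from_def)
  have hdS3: "hd w \<in> Y3" if "w \<in> S3" for w
    using that by (auto simp: S3_def walks_from_def split: if_splits)
  have neS: "w \<noteq> []" if "w \<in> S2 \<union> S3" for w
    using that by (auto simp: S2_def S3_def walks_from_def walk_def split: if_splits)
  have "walks_from k x z = S1 \<union> (#) x ` (S2 \<union> S3)"
  proof (intro set_eqI iffI)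
    fix w assume w: "w \<in> walks_from k x z"
    then have "w \<noteq> []" "hd w = x" by (auto simp: walks_from_def walk_def)
    then consider "w = [x]" | y v where "w = x # y # v"
      by (cases w rule: bad.cases) auto
    then show "w \<in> S1 \<union> (#) x ` (S2 \<union> S3)"
    proof cases
      case 1
      then show ?thesis using w by (auto simp: S1_def walks_from_def)
    next
      case 2
      have "y # v \<in> S2 \<union> S3"
        using w unfolding 2
        by (cases "good_step x y")
          (auto simp: walks_from_def walk_def S2_def S3_def Y2_def Y3_def)
      then show ?thesis unfolding 2 by blast
    qed
  next
    fix w assume "w \<in> S1 \<union> (#) x ` (S2 \<union> S3)"
    then consider "w \<in> S1" | v where "w = x # v" "v \<in> S2" | v where "w = x # v" "v \<in> S3" by blast
    then show "w \<in> walks_from k x z"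
    proof cases
      case 1
      then show ?thesis using x by (auto simp: S1_def walks_from_def walk_def split: if_splits)
    next
      case 2
      then obtain y v' where v: "v = y # v'" "good_step x y" "v \<in> walks_from k y (z - wt x)"
        by (cases v) (auto simp: S2_def Y2_def walks_from_def walk_def)
      then show ?thesis using good_step_R[OF v(2)] 2
        by (auto simp: walks_from_def walk_def)
    next
      case 3
      then obtain y v' where v: "v = y # v'" "y \<in> Y3" "v \<in> walks_from (k - 1) y (z - wt x)" "k \<noteq> 0"
        by (cases v) (auto simp: S3_def walks_from_def walk_def split: if_splits)
      then show ?thesis using 3 x
        by (auto simp: walks_from_def walk_def Y3_def)
    qed
  qed
  moreover have "S1 \<inter> (#) x ` (S2 \<union> S3) = {}" using neS by (auto simp: S1_def)
  moreover have "finite S1" "finite S2" "finite S3"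
    using fin by (auto simp: S1_def S2_def S3_def finite_walks_from)
  moreover have "S2 \<inter> S3 = {}" using hdS2 hdS3 by (fastforce simp: Y2_def Y3_def)
  ultimately have "card (walks_from k x z) = card S1 + (card S2 + card S3)"
    by (simp add: card_Un_disjoint card_image)
  moreover have "card S2 = (\<Sum>y\<in>Y2. card (walks_from k y (z - wt x)))"
    unfolding S2_def using fin finite_walks_from
    by (intro card_UN_disjoint) (auto simp: walks_from_def)
  moreover have "card S3 = (\<Sum>y\<in>Y3. card (if k = 0 then {} else walks_from (k - 1) y (z - wt x)))"
    unfolding S3_def using fin finite_walks_from
    by (intro card_UN_disjoint) (auto simp: walks_from_def)
  ultimately show ?thesis
    unfolding num_walks_def Y2_def[symmetric] Y3_def[symmetric]
    by (cases "k = 0") (auto simp: S1_def)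
qed

text \<open>Stopping and bad steps contribute \<open>G\<close>, which involves only
  \<open>k - 1\<close> and is rational by induction. If \<open>x\<close> has a good step, it lies on
  a good closed walk \<open>c\<close>; following the forced steps once around \<open>c\<close>
  expresses the difference of the counts at \<open>z\<close> and \<open>z - weight c\<close> by
  shifted copies of \<open>G\<close>. Hence the only new denominator factor is the one belonging to
  \<open>weight c\<close>.\<close>

lemma rational_num_walks: "x \<in> H \<Longrightarrow> rational_gf (num_walks k x)"
proof (induction k arbitrary: x rule: less_induct)
  case (less k)
  define G where "G x z = of_bool (k = 0 \<and> x \<in> En \<and> z = wt x)
    + (\<Sum>y | y \<in> H \<and> R x y \<and> \<not> good_step x y. if k = 0 then 0 else num_walks (k - 1) y (z - wt x))"
    for x z
  have G: "rational_gf (G x)" for x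
    unfolding G_def
  proof (intro rational_gf_add rational_gf_sum)
    show "rational_gf (\<lambda>z. of_bool (k = 0 \<and> x \<in> En \<and> z = wt x))"
      by (rule rational_gf_finite_support, rule finite_subset[of _ "{wt x}"]) auto
    fix y assume "y \<in> {y. y \<in> H \<and> R x y \<and> \<not> good_step x y}"
    then show "rational_gf (\<lambda>z. if k = 0 then 0 else num_walks (k - 1) y (z - wt x))"
      using rational_gf_shift[OF less.IH[of "k - 1" y], of "wt x"]
      by (cases "k = 0") (auto intro: rational_gf_zero)
  qed
  have step: "num_walks k x z = G x z + num_walks k y (z - wt x)" if "good_step x y" for x y z
  proof -
    have "{y. good_step x y} = {y}" using that good_step_unique by blast
    then show ?thesis using num_walks_rec[of x k z] good_step_R[OF that] by (simp add: G_def)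
  qed
  have path: "rational_gf (\<lambda>z. num_walks k (hd (c @ [y])) z - num_walks k y (z - weight c))"
    if "successively good_step (c @ [y])" for c y
    using that
  proof (induction c)
    case Nil
    then show ?case by (simp add: rational_gf_zero)
  next
    case (Cons x c)
    define x' where "x' = hd (c @ [y])"
    have "good_step x x'" using Cons.prems by (auto simp: successively_Cons x'_def)
    from step[OF this] have "num_walks k (hd ((x # c) @ [y])) z - num_walks k y (z - weight (x # c))
        = G x z + (num_walks k x' (z - wt x) - num_walks k y (z - wt x - weight c))" for z
      by (simp add: algebra_simps)
    moreover have "rational_gf (\<lambda>z. num_walks k x' z - num_walks k y (z - weight c))"
      unfolding x'_def using Cons by (intro Cons.IH) (auto simp: successively_Cons)
    note rational_gf_add[OF G rational_gf_shift[OF this], of x "wt x"]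
    ultimately show ?case by simp
  qed
  show ?case
  proof (cases "\<exists>y. good_step x y")
    case True
    then obtain c where c: "good c" "hd c = x" by (auto simp: good_step_def)
    have cl: "closed_walk H c" using c(1) by (rule good_closed_walk)
    then have "c \<noteq> []" "set c \<subseteq> A" using H_subset by (auto simp: closed_walk_def)
    show ?thesis
    proof (rule rational_gf_of_difference)
      show "rational_gf (\<lambda>z. num_walks k x z - num_walks k x (z - weight c))"
        using path[of c x] good_steps[OF c(1)] c(2) \<open>c \<noteq> []\<close> by simp
      show "Re (weight c) > 0" using \<open>c \<noteq> []\<close> \<open>set c \<subseteq> A\<close> by (intro weight_pos)
      show "\<And>z. Re z < 0 \<Longrightarrow> num_walks k x z = 0" by (rule num_walks_neg)
    qed
  next
    case False
    then have "num_walks k x = G x"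
      using num_walks_rec[OF less.prems] by (simp add: G_def fun_eq_iff)
    then show ?thesis using G by simp
  qed
qed

text \<open>The bound on bad steps is uniform in \<open>n\<close>, so the count is a fixed finite
  sum of rational series evaluated along the ray.\<close>

lemma eqp_words_within:
  "eventually_quasi_polynomial (\<lambda>n. real (card {w \<in> words n. set w \<subseteq> H}))"
proof -
  obtain B where B: "\<And>w n. walk H w \<Longrightarrow> weight w = of_nat n * e + \<delta> \<Longrightarrow> bad w \<le> B"
    using bad_bounded by blast
  have "real (card {w \<in> words n. set w \<subseteq> H})
      = (\<Sum>k\<le>B. \<Sum>x\<in>H \<inter> St. num_walks k x (of_nat n * e + \<delta>))" for n
  proof -
    have eq: "{w \<in> words n. set w \<subseteq> H}
        = (\<Union>k\<in>{..B}. \<Union>x\<in>H \<inter> St. walks_from k x (of_nat n * e + \<delta>))" (is "?L = ?Rr")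
    proof (intro set_eqI iffI)
      fix w assume "w \<in> ?L"
      then have w: "walk H w" "weight w = of_nat n * e + \<delta>" "hd w \<in> St" "last w \<in> En"
        by (auto simp: words_def accepted_def walk_def)
      then have "hd w \<in> H \<inter> St" by (auto simp: walk_def)
      then show "w \<in> ?Rr" using w B[OF w(1,2)] by (auto simp: walks_from_def)
    next
      fix w assume "w \<in> ?Rr"
      then show "w \<in> ?L" using H_subset
        by (auto simp: words_def accepted_def walk_def walks_from_def)
    qed
    have "card ?L = (\<Sum>k\<le>B. card (\<Union>x\<in>H \<inter> St. walks_from k x (of_nat n * e + \<delta>)))"
      unfolding eq using finite_H finite_walks_from
      by (intro card_UN_disjoint) (auto simp: walks_from_def)
    also have "\<dots> = (\<Sum>k\<le>B. \<Sum>x\<in>H \<inter> St. card (walks_from k x (of_nat n * e + \<delta>)))"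
      using finite_H finite_walks_from
      by (intro sum.cong refl card_UN_disjoint) (auto simp: walks_from_def)
    finally show ?thesis by (simp add: num_walks_def)
  qed
  then show ?thesis
    using rational_num_walks e_pos by (auto intro!: eqp_sum eqp_rational_gf)
qed

end

section \<open>The dichotomy for words\<close>

context weighted_words
begin

text \<open>Words using exactly \<open>H\<close> arise from those within \<open>H\<close> by
  subtracting the counts for the proper subsets, which inherit the absence of branching.\<close>

lemma eqp_words_exact:
  assumes "H \<subseteq> A" "\<not> branching H"
  shows "eventually_quasi_polynomial (\<lambda>n. real (card {w \<in> words n. set w = H}))"
proof -
  have "finite H" using assms(1) finite_A by (rule finite_subset)
  then show ?thesis using assms
  proof (induction H rule: finite_psubset_induct)
    case (psubset H)
    interpret nonbranching_words A R St En wt e \<delta> H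
      by unfold_locales (use psubset.prems in auto)
    have "real (card {w \<in> words n. set w = H}) = real (card {w \<in> words n. set w \<subseteq> H})
        - (\<Sum>H'\<in>Pow H - {H}. real (card {w \<in> words n. set w = H'}))" for n
    proof -
      have "{w \<in> words n. set w \<subseteq> H} = (\<Union>H'\<in>Pow H. {w \<in> words n. set w = H'})" by auto
      also have "card \<dots> = (\<Sum>H'\<in>Pow H. card {w \<in> words n. set w = H'})"
        using psubset.hyps finite_words by (intro card_UN_disjoint) auto
      also have "\<dots> = card {w \<in> words n. set w = H} + (\<Sum>H'\<in>Pow H - {H}. card {w \<in> words n. set w = H'})"
        using psubset.hyps by (intro sum.remove) auto
      finally show ?thesis by simp
    qed
    moreover have "eventually_quasi_polynomial (\<lambda>n. real (card {w \<in> words n. set w = H'}))"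
      if "H' \<in> Pow H - {H}" for H'
      using that psubset.prems branching_mono by (intro psubset.IH) auto
    ultimately show ?case
      by (simp only:) (intro eqp_diff eqp_words_within eqp_sum)
  qed
qed

lemma words_exponential_or_polynomial:
  assumes f: "\<And>n. n \<ge> 1 \<Longrightarrow> f n = card (words n)"
  shows "\<exists>m\<ge>1. \<forall>i\<le>m - 1. grows_exponentially (\<lambda>n. f (n * m + i)) \<or>
    eventually_polynomial (\<lambda>n. f (n * m + i))"
proof -
  define NB where "NB = {H. H \<subseteq> A \<and> \<not> branching H}"
  define BR where "BR = {H. H \<subseteq> A \<and> branching H}"
  have fin: "finite NB" "finite BR"
    using finite_A by (auto simp: NB_def BR_def intro: finite_subset[of _ "Pow A"])
  define g where "g n = (\<Sum>H\<in>NB. real (card {w \<in> words n. set w = H}))" for n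
  have "eventually_quasi_polynomial g"
    unfolding g_def by (intro eqp_sum eqp_words_exact) (auto simp: NB_def)
  then obtain p q N where p: "p \<ge> 1" and g: "\<And>n. n \<ge> N \<Longrightarrow> g n = poly (q (n mod p)) (real n)"
    unfolding eventually_quasi_polynomial_def by blast
  have "\<forall>H. \<exists>k. branching H \<longrightarrow> branching_with H k" by (auto simp: branching_def)
  from choice[OF this] obtain k where "\<forall>H. branching H \<longrightarrow> branching_with H (k H)" ..
  then have k: "branching_with H (k H)" if "branching H" for H using that by blast
  have kpos: "k H \<ge> 1" if "H \<in> BR" for H
    using that k branching_with_pos by (auto simp: BR_def)
  \<comment> \<open>Divisibility by \<open>p\<close> makes the quasi-polynomial a single polynomial
    on each class modulo \<open>m\<close>; divisibility by each \<open>k H\<close> keeps the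
    inserted families within the class.\<close>
  define m where "m = p * (\<Prod>H\<in>BR. k H)"
  have m: "m \<ge> 1" unfolding m_def using p prod_ge_1[of BR k] kpos by (simp add: Suc_le_eq)
  have kdvd: "k H dvd m" if "H \<in> BR" for H
    unfolding m_def using that fin by (intro dvd_mult dvd_prodI)
  have "grows_exponentially (\<lambda>n. f (n * m + i)) \<or> eventually_polynomial (\<lambda>n. f (n * m + i))"
    if i: "i < m" for i
  proof (cases "\<exists>t. \<exists>w\<in>words (t * m + i). branching (set w)")
    case True
    then obtain t w where w: "w \<in> words (t * m + i)" "branching (set w)" by blast
    have H: "set w \<in> BR" using w by (auto simp: BR_def words_def accepted_def walk_def)
    obtain r where r: "m = k (set w) * r" using kdvd[OF H] by blast
    have "r \<ge> 1" using m r by (cases r) auto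
    obtain K where K: "K > 0" "\<And>n. n \<ge> 1 \<Longrightarrow> real (card (words n)) \<le> exp (K * real n)"
      using card_words_le by blast
    \<comment> \<open>From \<open>n \<ge> 2 * t + 1\<close> follows
      \<open>n - t \<ge> n / 2\<close>, which turns \<open>2 ^ (n - t)\<close> into the rate
      \<open>ln 2 / 2\<close>. The upper rate comes from
      \<open>n * m + i \<le> (m + i) * n\<close>.\<close>
    have "exp (ln 2 / 2 * real n) \<le> real (f (n * m + i)) \<and>
       real (f (n * m + i)) \<le> exp (K * (real m + real i) * real n)" if n: "n \<ge> 2 * t + 1" for n
    proof
      have fn: "f (n * m + i) = card (words (n * m + i))" using n m by (intro f) (simp add: Suc_le_eq)
      have "n * m + i = (t * m + i) + ((n - t) * r) * k (set w)"
      proof -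
        have "n * m = t * m + (n - t) * m" using n by (simp flip: add_mult_distrib)
        then show ?thesis by (simp add: r algebra_simps)
      qed
      then have "2 ^ ((n - t) * r) \<le> f (n * m + i)"
        unfolding fn using card_words_ge[OF w(1) k[OF w(2)], of "(n - t) * r"] by presburger
      moreover have "n - t \<le> (n - t) * r" using \<open>r \<ge> 1\<close> by simp
      then have "(2::nat) ^ (n - t) \<le> 2 ^ ((n - t) * r)" by (intro power_increasing) auto
      ultimately have "2 ^ (n - t) \<le> f (n * m + i)" by linarith
      then have "real (2 ^ (n - t)) \<le> real (f (n * m + i))" by (simp only: of_nat_le_iff)
      moreover have "exp (ln 2 / 2 * real n) \<le> real (2 ^ (n - t))"
      proof -
        have "exp (ln 2 / 2 * real n) = exp (real n / 2 * ln 2)" by (simp add: algebra_simps)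
        also have "\<dots> \<le> exp (real (n - t) * ln 2)"
          using n by (simp add: mult_right_mono of_nat_diff)
        also have "\<dots> = real (2 ^ (n - t))" by (simp add: exp_of_nat_mult)
        finally show ?thesis .
      qed
      ultimately show "exp (ln 2 / 2 * real n) \<le> real (f (n * m + i))" by linarith
      have "real (f (n * m + i)) \<le> exp (K * real (n * m + i))"
        unfolding fn using n m by (intro K) (simp add: Suc_le_eq)
      also have "real (n * m + i) \<le> (real m + real i) * real n"
        using n mult_left_mono[of 1 "real n" "real i"] by (simp add: algebra_simps)
      then have "exp (K * real (n * m + i)) \<le> exp (K * (real m + real i) * real n)"
        using K(1) by (simp add: mult.assoc)
      finally show "real (f (n * m + i)) \<le> exp (K * (real m + real i) * real n)" .
    qed
    moreover have "ln 2 / 2 > (0::real)" "K * (real m + real i) > 0" using K m by auto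
    ultimately show ?thesis unfolding grows_exponentially_def by blast
  next
    case False
    \<comment> \<open>No word of this class has a branching letter set, so the sum over the
      non-branching sets counts all of them.\<close>
    have fg: "real (f (n * m + i)) = g (n * m + i)" if "n \<ge> 1" for n
    proof -
      have "words (n * m + i) = (\<Union>H\<in>NB. {w \<in> words (n * m + i). set w = H})"
        using False by (auto simp: NB_def words_def accepted_def walk_def)
      also have "card \<dots> = (\<Sum>H\<in>NB. card {w \<in> words (n * m + i). set w = H})"
        using fin finite_words by (intro card_UN_disjoint) auto
      finally show ?thesis using that m by (simp add: f g_def Suc_le_eq)
    qed
    have "real (f (n * m + i)) = poly (pcompose (q (i mod p)) [:real i, real m:]) (real n)"
      if "n \<ge> N + 1" for n
    proof -
      have "n \<le> n * m" using m by simp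
      then have "g (n * m + i) = poly (q ((n * m + i) mod p)) (real (n * m + i))"
        using that by (intro g) linarith
      moreover have "(n * m + i) mod p = i mod p" by (simp add: m_def mult.left_commute[of n])
      ultimately show ?thesis using that fg[of n] by (simp add: poly_pcompose algebra_simps)
    qed
    then show ?thesis unfolding eventually_polynomial_def by blast
  qed
  then show ?thesis using m by (intro exI[of _ m]) auto
qed

end

section \<open>Tiles in the strip\<close>

lemma axis_parallel_segment_cases:
  assumes "axis_parallel_segment s"
  obtains r where "s \<subseteq> {z. Re z = r}" | h where "s \<subseteq> {z. Im z = h}"
proof -
  obtain a b where s: "s = closed_segment a b" and "Re a = Re b \<or> Im a = Im b"
    using assms by (auto simp: axis_parallel_segment_def)
  then show thesis
  proof (elim disjE)
    assume "Re a = Re b"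
    then have "s \<subseteq> {z. Re z = Re b}" unfolding s by (auto simp: in_segment) (simp add: algebra_simps)
    then show thesis by (rule that(1))
  next
    assume "Im a = Im b"
    then have "s \<subseteq> {z. Im z = Im b}" unfolding s by (auto simp: in_segment) (simp add: algebra_simps)
    then show thesis by (rule that(2))
  qed
qed

lemma axis_parallel_segment_closed_connected:
  "axis_parallel_segment s \<Longrightarrow> closed s \<and> connected s"
  by (auto simp: axis_parallel_segment_def)

lemma negligible_axis_parallel_segment:
  assumes "axis_parallel_segment s"
  shows "negligible s"
  using assms
proof (cases rule: axis_parallel_segment_cases)
  case (1 r)
  moreover have "negligible {z::complex. Re z = r}"
    using negligible_hyperplane[of "1::complex" r] by (simp add: inner_complex_def)
  ultimately show ?thesis by (rule negligible_subset[rotated])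
next
  case (2 h)
  moreover have "negligible {z::complex. Im z = h}"
    using negligible_hyperplane[of \<i> h] by (simp add: inner_complex_def)
  ultimately show ?thesis by (rule negligible_subset[rotated])
qed

text \<open>The point \<open>x + \<i>y\<close> is the centre of a half-disc contained in \<open>U\<close>, lying above
  the line of height \<open>y\<close> for \<open>\<sigma> = 1\<close> and below it for \<open>\<sigma> = -1\<close>.\<close>
definition accessible :: "real \<Rightarrow> real \<Rightarrow> complex set \<Rightarrow> real \<Rightarrow> bool" where
  "accessible \<sigma> y U x \<longleftrightarrow>
     (\<exists>\<eta>>0. \<forall>z. dist z (Complex x y) < \<eta> \<and> \<sigma> * (Im z - y) > 0 \<longrightarrow> z \<in> U)"

text \<open>\<open>U\<close> stands for the interior of a tile and \<open>S\<close> for its boundary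
  segments. The sign \<sigma> lets one argument treat the bottom and the top of the strip.\<close>

locale polygonal_region =
  fixes U :: "complex set" and S :: "complex set set" and \<sigma> y :: real
  assumes open_U: "open U" and frontier_U: "frontier U = \<Union>S" and finite_S: "finite S"
    and S_segments: "s \<in> S \<Longrightarrow> axis_parallel_segment s"
    and \<sigma>: "\<sigma> = 1 \<or> \<sigma> = -1"
    and U_side: "z \<in> U \<Longrightarrow> \<sigma> * (Im z - y) > 0"
    and S_side: "z \<in> \<Union>S \<Longrightarrow> \<sigma> * (Im z - y) \<ge> 0"
begin

lemma local_ball:
  obtains \<eta> where "\<eta> > 0" "\<And>s. s \<in> S \<Longrightarrow> p \<notin> s \<Longrightarrow> ball p \<eta> \<inter> s = {}"
proof -
  have "closed (\<Union>{s \<in> S. p \<notin> s})"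
    using finite_S S_segments axis_parallel_segment_closed_connected by (intro closed_Union) auto
  then have "open (- \<Union>{s \<in> S. p \<notin> s})" "p \<in> - \<Union>{s \<in> S. p \<notin> s}" by auto
  then obtain \<eta> where "\<eta> > 0" "ball p \<eta> \<subseteq> - \<Union>{s \<in> S. p \<notin> s}"
    by (meson open_contains_ball)
  then show thesis by (intro that[of \<eta>]) auto
qed

lemma U_near:
  assumes "p \<in> \<Union>S" "\<eta> > 0"
  obtains u where "u \<in> U" "u \<in> ball p \<eta>"
proof -
  have "p \<in> closure U" using assms(1) frontier_U by (auto simp: frontier_def)
  then obtain u where "u \<in> U" "dist u p < \<eta>" using assms(2) by (meson closure_approachable)
  then show thesis by (intro that[of u]) (auto simp: dist_commute)
qed

lemma connected_avoiding_subset: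
  assumes "connected Q" "Q \<inter> \<Union>S = {}" "Q \<inter> U \<noteq> {}"
  shows "Q \<subseteq> U"
  using connected_Int_frontier[OF assms(1,3)] assms(2) frontier_U by blast

text \<open>Away from the finitely many abscissas of vertical segments, all segments through the
  point run along the line. A small open half-disc then avoids the boundary, and it meets
  \<open>U\<close> because the point is in the frontier; being connected, it lies in
  \<open>U\<close>.\<close>

lemma finite_inaccessible: "finite {x. Complex x y \<in> \<Union>S \<and> \<not> accessible \<sigma> y U x}"
proof -
  have "\<exists>r. \<forall>p\<in>s. Re p = r \<or> s \<subseteq> {z. Im z = Im p}" if "s \<in> S" for s
    using S_segments[OF that] by (cases rule: axis_parallel_segment_cases) blast+
  then have "\<forall>s. \<exists>r. s \<in> S \<longrightarrow> (\<forall>p\<in>s. Re p = r \<or> s \<subseteq> {z. Im z = Im p})" by blast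
  from choice[OF this] obtain r
    where r: "\<forall>s. s \<in> S \<longrightarrow> (\<forall>p\<in>s. Re p = r s \<or> s \<subseteq> {z. Im z = Im p})" ..
  have "accessible \<sigma> y U x" if x: "Complex x y \<in> \<Union>S" "x \<notin> r ` S" for x
  proof -
    define p where "p = Complex x y"
    obtain \<eta> where \<eta>: "\<eta> > 0" "\<And>s. s \<in> S \<Longrightarrow> p \<notin> s \<Longrightarrow> ball p \<eta> \<inter> s = {}"
      using local_ball by blast
    define Q where "Q = ball p \<eta> \<inter> {z. \<sigma> * (Im z - y) > 0}"
    have "{z. \<sigma> * (Im z - y) > 0} = {z. inner (\<sigma> *\<^sub>R \<i>) z > \<sigma> * y}"
      by (auto simp: inner_complex_def algebra_simps)
    then have "convex {z. \<sigma> * (Im z - y) > 0}"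
      using convex_halfspace_gt[of "\<sigma> * y" "\<sigma> *\<^sub>R \<i>"] by simp
    then have "convex Q" unfolding Q_def by (intro convex_Int) auto
    then have conn: "connected Q" by (rule convex_connected)
    have disj: "Q \<inter> \<Union>S = {}"
    proof -
      have "z \<notin> s" if "z \<in> Q" "s \<in> S" for z s
      proof (cases "p \<in> s")
        case True
        have "Re p \<noteq> r s" using x(2) that(2) by (auto simp: p_def)
        moreover have "Re p = r s \<or> s \<subseteq> {z. Im z = Im p}" using r that(2) True by blast
        ultimately have "s \<subseteq> {z. Im z = y}" by (simp add: p_def)
        then show ?thesis using that(1) by (auto simp: Q_def)
      next
        case False
        then show ?thesis using \<eta>(2)[OF that(2)] that(1) by (auto simp: Q_def)
      qed
      then show ?thesis by blast
    qed
    obtain u where "u \<in> U" "u \<in> ball p \<eta>" using U_near[of p \<eta>] x(1) \<eta>(1) by (auto simp: p_def)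
    then have "Q \<inter> U \<noteq> {}" using U_side by (auto simp: Q_def)
    from connected_avoiding_subset[OF conn disj this]
    show ?thesis unfolding accessible_def using \<eta>(1)
      by (intro exI[of _ \<eta>]) (auto simp: Q_def p_def dist_commute)
  qed
  then have "{x. Complex x y \<in> \<Union>S \<and> \<not> accessible \<sigma> y U x} \<subseteq> r ` S" by auto
  then show ?thesis using finite_S finite_subset by blast
qed

text \<open>If the boundary met the line in finitely many points, then near such a point it would be
  contained in a vertical ray; its complement in a disc is connected and reaches the other side.\<close>
lemma accessible_exists:
  assumes p: "p \<in> \<Union>S" "Im p = y"
  shows "\<exists>x. accessible \<sigma> y U x"
proof (rule ccontr)
  assume none: "\<not> ?thesis"
  have fin: "finite {z \<in> \<Union>S. Im z = y}"
  proof -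
    have "{z \<in> \<Union>S. Im z = y} = (\<lambda>x. Complex x y) ` {x. Complex x y \<in> \<Union>S \<and> \<not> accessible \<sigma> y U x}"
    proof (intro set_eqI iffI)
      fix z assume z: "z \<in> {z \<in> \<Union>S. Im z = y}"
      then have "z = Complex (Re z) y" by (simp add: complex_eq_iff)
      then show "z \<in> (\<lambda>x. Complex x y) ` {x. Complex x y \<in> \<Union>S \<and> \<not> accessible \<sigma> y U x}"
        using z none by (intro image_eqI[of _ _ "Re z"]) auto
    qed (use none in auto)
    then show ?thesis using finite_inaccessible by simp
  qed
  obtain \<eta> where \<eta>: "\<eta> > 0" "\<And>s. s \<in> S \<Longrightarrow> p \<notin> s \<Longrightarrow> ball p \<eta> \<inter> s = {}"
    using local_ball by blast
  have ray: "Re z = Re p" if "z \<in> s" "s \<in> S" "p \<in> s" for z s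
    using S_segments[OF that(2)]
  proof (cases rule: axis_parallel_segment_cases)
    case (1 r)
    then show ?thesis using that by auto
  next
    case (2 h)
    then have "s \<subseteq> {z \<in> \<Union>S. Im z = y}" using that p(2) by auto
    then have "finite s" using fin finite_subset by blast
    moreover have "connected s" using axis_parallel_segment_closed_connected S_segments that(2) by blast
    ultimately have "\<exists>q. s = {q}" using connected_finite_iff_sing[of s] \<open>p \<in> s\<close> by auto
    then obtain q where "s = {q}" by blast
    then show ?thesis using that by auto
  qed
  \<comment> \<open>A disc with the vertical ray from \<open>p\<close> into the \<sigma>-side
    removed. It is starlike about the point \<open>w\<close> chosen below, which lies beyond the
    line, where \<open>U\<close> has no points.\<close>
  define Q where "Q = ball p \<eta> \<inter> {z. Re z \<noteq> Re p \<or> \<sigma> * (Im z - y) < 0}"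
  define w where "w = Complex (Re p) (y - \<sigma> * (\<eta> / 2))"
  have ss: "\<sigma> * \<sigma> = 1" using \<sigma> by auto
  have w: "\<sigma> * (Im w - y) = - (\<eta> / 2)"
    using ss by (simp add: w_def)
  have "dist p w = \<bar>\<sigma> * (\<eta> / 2)\<bar>"
    using p(2) by (simp add: dist_norm w_def cmod_def)
  also have "\<dots> = \<eta> / 2" using \<sigma> \<eta>(1) by auto
  finally have wb: "w \<in> ball p \<eta>" using \<eta>(1) by simp
  have wQ: "w \<in> Q" using wb w \<eta>(1) by (simp add: Q_def)
  have "closed_segment w z \<subseteq> Q" if z: "z \<in> Q" for z
  proof
    fix v assume v: "v \<in> closed_segment w z"
    then obtain t where t: "0 \<le> t" "t \<le> 1" "v = (1 - t) *\<^sub>R w + t *\<^sub>R z" by (auto simp: in_segment)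
    have "v \<in> ball p \<eta>"
      using closed_segment_subset[OF wb _ convex_ball, of z] z v by (auto simp: Q_def)
    moreover have "Re v - Re p = t * (Re z - Re p)" by (simp add: t w_def algebra_simps)
    moreover have "\<sigma> * (Im v - y) = (1 - t) * (\<sigma> * (Im w - y)) + t * (\<sigma> * (Im z - y))"
      by (simp add: t algebra_simps)
    then have \<sigma>v: "\<sigma> * (Im v - y) = (1 - t) * (- (\<eta> / 2)) + t * (\<sigma> * (Im z - y))"
      unfolding w .
    have "\<sigma> * (Im v - y) < 0" if "Re z = Re p \<or> t = 0"
    proof (cases "t = 0")
      case True
      then show ?thesis using \<sigma>v \<eta>(1) by simp
    next
      case False
      then have "\<sigma> * (Im z - y) < 0" using that z by (auto simp: Q_def)
      then have "t * (\<sigma> * (Im z - y)) < 0" using False t(1) by (simp add: mult_pos_neg)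
      moreover have "(1 - t) * (- (\<eta> / 2)) \<le> 0"
        using t(2) \<eta>(1) by (intro mult_nonneg_nonpos) auto
      ultimately show ?thesis unfolding \<sigma>v by linarith
    qed
    ultimately show "v \<in> Q" by (auto simp: Q_def)
  qed
  then have "starlike Q" unfolding starlike_def using wQ by blast
  then have conn: "connected Q" by (rule starlike_imp_connected)
  have disj: "Q \<inter> \<Union>S = {}"
  proof -
    have "z \<notin> s" if "z \<in> Q" "s \<in> S" for z s
    proof
      assume "z \<in> s"
      have "z \<in> ball p \<eta>" using that(1) by (simp add: Q_def)
      then have "p \<in> s" using \<eta>(2)[OF that(2)] \<open>z \<in> s\<close> by blast
      then have "\<sigma> * (Im z - y) < 0" using ray[OF \<open>z \<in> s\<close> that(2)] that(1) by (auto simp: Q_def)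
      then show False using S_side[of z] \<open>z \<in> s\<close> that(2) by auto
    qed
    then show ?thesis by blast
  qed
  have "w \<notin> U" using U_side[of w] w \<eta>(1) by auto
  \<comment> \<open>Near \<open>p\<close> the open set \<open>U\<close> is now confined to the ray,
    which a small horizontal displacement refutes.\<close>
  then have "Q \<inter> U = {}" using connected_avoiding_subset[OF conn disj] wQ by blast
  moreover obtain u where u: "u \<in> U" "u \<in> ball p \<eta>" using U_near[OF p(1) \<eta>(1)] by blast
  have "open (U \<inter> ball p \<eta>)" using open_U by auto
  then obtain \<epsilon> where \<epsilon>: "\<epsilon> > 0" "ball u \<epsilon> \<subseteq> U \<inter> ball p \<eta>"
    using u by (meson IntI open_contains_ball)
  have "u + of_real (\<epsilon> / 2) \<in> ball u \<epsilon>" "u \<in> ball u \<epsilon>" using \<epsilon>(1) by (auto simp: dist_norm)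
  then have "u + of_real (\<epsilon> / 2) \<in> U \<inter> ball p \<eta>" "u \<in> U \<inter> ball p \<eta>" using \<epsilon>(2) by blast+
  then have "Re (u + of_real (\<epsilon> / 2)) = Re p" "Re u = Re p"
    using \<open>Q \<inter> U = {}\<close> by (auto simp: Q_def)
  then show False using \<epsilon>(1) by simp
qed

end

text \<open>These properties are all that the ordering and area arguments use of the polygonal
  shape.\<close>

definition strip_tile :: "real \<Rightarrow> complex set \<Rightarrow> bool" where
  "strip_tile y P \<longleftrightarrow> compact P \<and> connected (interior P) \<and> closure (interior P) = P \<and>
     negligible (P - interior P) \<and> P \<subseteq> {z. y \<le> Im z \<and> Im z \<le> y + 1} \<and>
     (\<exists>x. accessible 1 y (interior P) x) \<and> (\<exists>x. accessible (- 1) (y + 1) (interior P) x) \<and>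
     finite {x. Complex x y \<in> P \<and> \<not> accessible 1 y (interior P) x}"

lemma interior_strip:
  assumes "P \<subseteq> {z. a \<le> Im z \<and> Im z \<le> b}"
  shows "interior P \<subseteq> {z. a < Im z \<and> Im z < b}"
proof
  fix z assume "z \<in> interior P"
  then obtain \<epsilon> where \<epsilon>: "\<epsilon> > 0" "ball z \<epsilon> \<subseteq> P" by (meson mem_interior)
  have "z + of_real (\<epsilon> / 2) * \<i> \<in> ball z \<epsilon>" "z - of_real (\<epsilon> / 2) * \<i> \<in> ball z \<epsilon>"
    using \<epsilon>(1) by (auto simp: dist_norm norm_mult)
  then have "z + of_real (\<epsilon> / 2) * \<i> \<in> P" "z - of_real (\<epsilon> / 2) * \<i> \<in> P" using \<epsilon>(2) by blast+
  then show "z \<in> {z. a < Im z \<and> Im z < b}" using assms \<epsilon>(1) by fastforce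
qed

text \<open>By the Jordan curve theorem the curve is the frontier of both its inside and its
  outside. Hence no curve point is interior to \<open>P\<close>, and \<open>P\<close> is the closure
  of its interior. The extreme heights are attained on the curve, so the half-disc lemmas apply at
  both ends.\<close>

lemma tall_tile_strip_tile:
  assumes "tall_tile P"
  shows "strip_tile (Inf (Im ` P)) P"
proof -
  obtain g S where g: "simple_path g" "pathfinish g = pathstart g" and S: "finite S"
    "\<And>s. s \<in> S \<Longrightarrow> axis_parallel_segment s" "path_image g = \<Union>S"
    and P: "P = path_image g \<union> inside (path_image g)"
    using assms unfolding tall_tile_def is_tile_def by blast
  define c where "c = path_image g"
  define U where "U = inside c"
  have J: "U \<noteq> {}" "open U" "connected U" "bounded U" "frontier U = c" "frontier (outside c) = c"
    "U \<inter> outside c = {}"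
    using Jordan_inside_outside[OF g] by (auto simp: U_def c_def)
  have PU: "P = c \<union> U" by (simp add: P c_def U_def)
  have clU: "closure U = P" using closure_Un_frontier[of U] J(5) by (auto simp: PU)
  have intP: "interior P = U"
  proof
    show "interior P \<subseteq> U"
    proof
      fix z assume z: "z \<in> interior P"
      have "z \<notin> c"
      proof
        assume "z \<in> c"
        then have "z \<in> closure (outside c)" using J(6) by (auto simp: frontier_def)
        then have "interior P \<inter> outside c \<noteq> {}"
          using z open_Int_closure_eq_empty[of "interior P" "outside c"] by auto
        moreover have "interior P \<subseteq> c \<union> U" using interior_subset PU by metis
        moreover have "outside c \<inter> c = {}" by (rule outside_no_overlap)
        ultimately show False using J(7) by blast
      qed
      then show "z \<in> U" using z interior_subset PU by auto
    qed
    show "U \<subseteq> interior P" by (rule interior_maximal) (auto simp: PU J)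
  qed
  have comp: "compact P" using J(4) clU by (metis compact_closure)
  have ne: "P \<noteq> {}" using J(1) PU by auto
  define y where "y = Inf (Im ` P)"
  have comp': "compact (Im ` P)" using comp by (intro compact_continuous_image continuous_intros)
  have bdd: "bdd_below (Im ` P)" "bdd_above (Im ` P)"
    using compact_imp_bounded[OF comp'] by (auto intro: bounded_imp_bdd_below bounded_imp_bdd_above)
  have y1: "y + 1 = Sup (Im ` P)" using assms by (simp add: y_def tall_tile_def height_def)
  have strip: "P \<subseteq> {z. y \<le> Im z \<and> Im z \<le> y + 1}"
    unfolding y1 unfolding y_def using bdd by (auto intro: cInf_lower cSup_upper)
  have Ustrip: "U \<subseteq> {z. y < Im z \<and> Im z < y + 1}"
    using interior_strip[OF strip] by (simp only: intP)
  have "y \<in> Im ` P" unfolding y_def using comp' ne bdd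
    by (intro closed_contains_Inf compact_imp_closed) auto
  then obtain p where p: "p \<in> P" "Im p = y" by auto
  have "y + 1 \<in> Im ` P" unfolding y1 using comp' ne bdd
    by (intro closed_contains_Sup compact_imp_closed) auto
  then obtain q where q: "q \<in> P" "Im q = y + 1" by auto
  have pc: "p \<in> c" "q \<in> c" using p q Ustrip PU by auto
  interpret bot: polygonal_region U S 1 y
    using J S Ustrip strip by unfold_locales (auto simp: c_def PU)
  interpret top: polygonal_region U S "-1" "y + 1"
    using J S Ustrip strip by unfold_locales (auto simp: c_def PU)
  have "negligible c" unfolding c_def S(3) using S negligible_axis_parallel_segment by auto
  moreover have "P - U \<subseteq> c" by (auto simp: PU)
  ultimately have neg: "negligible (P - U)" by (rule negligible_subset)
  have "Complex x y \<in> P \<longleftrightarrow> Complex x y \<in> \<Union>S" for x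
    using Ustrip S(3) by (auto simp: PU c_def)
  then have fin: "finite {x. Complex x y \<in> P \<and> \<not> accessible 1 y U x}"
    using bot.finite_inaccessible by simp
  show ?thesis
    unfolding strip_tile_def y_def[symmetric] intP
    using comp J(3) clU neg strip fin bot.accessible_exists[of p] top.accessible_exists[of q] p q pc S(3)
    by (simp add: c_def)
qed

lemma accessible_translation:
  assumes "accessible \<sigma> y U x"
  shows "accessible \<sigma> (y + Im v) ((+) v ` U) (x + Re v)"
proof -
  obtain \<eta> where \<eta>: "\<eta> > 0" "\<And>z. dist z (Complex x y) < \<eta> \<Longrightarrow> \<sigma> * (Im z - y) > 0 \<Longrightarrow> z \<in> U"
    using assms by (auto simp: accessible_def)
  have "z \<in> (+) v ` U"
    if "dist z (Complex (x + Re v) (y + Im v)) < \<eta>" "\<sigma> * (Im z - (y + Im v)) > 0" for z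
  proof -
    have "z - v - Complex x y = z - Complex (x + Re v) (y + Im v)" by (simp add: complex_eq_iff)
    then have "z - v \<in> U" using that by (intro \<eta>(2)) (auto simp: dist_norm algebra_simps)
    then show ?thesis by (intro image_eqI[of _ _ "z - v"]) auto
  qed
  then show ?thesis unfolding accessible_def using \<eta>(1) by blast
qed

lemma accessible_translation_iff:
  "accessible \<sigma> y ((+) v ` U) x \<longleftrightarrow> accessible \<sigma> (y - Im v) U (x - Re v)"
proof
  assume "accessible \<sigma> y ((+) v ` U) x"
  from accessible_translation[OF this, of "- v"] show "accessible \<sigma> (y - Im v) U (x - Re v)"
    by (simp add: image_image)
next
  assume "accessible \<sigma> (y - Im v) U (x - Re v)"
  from accessible_translation[OF this, of v] show "accessible \<sigma> y ((+) v ` U) x" by simp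
qed

lemma strip_tile_translation:
  assumes "strip_tile y P"
  shows "strip_tile (y + Im v) ((+) v ` P)"
proof -
  have "(+) v ` P - interior ((+) v ` P) = (+) v ` (P - interior P)"
    by (auto simp: interior_translation)
  moreover have "negligible ((+) v ` (P - interior P))"
    using assms by (intro negligible_translation) (simp add: strip_tile_def)
  moreover have "{x. Complex x (y + Im v) \<in> (+) v ` P \<and> \<not> accessible 1 y (interior P) (x - Re v)}
     \<subseteq> (+) (Re v) ` {x. Complex x y \<in> P \<and> \<not> accessible 1 y (interior P) x}" (is "?L \<subseteq> (+) (Re v) ` ?M")
  proof
    fix x assume x: "x \<in> ?L"
    then obtain z where z: "z \<in> P" "Complex x (y + Im v) = v + z" by auto
    then have "z = Complex (x - Re v) y" by (simp add: complex_eq_iff)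
    then have "x - Re v \<in> ?M" using x z(1) by simp
    then show "x \<in> (+) (Re v) ` ?M" by (intro image_eqI[of _ _ "x - Re v"]) auto
  qed
  then have "finite {x. Complex x (y + Im v) \<in> (+) v ` P \<and> \<not> accessible 1 y (interior P) (x - Re v)}"
    by (rule finite_subset) (use assms in \<open>simp add: strip_tile_def\<close>)
  moreover have "\<exists>x. accessible 1 y (interior P) (x - Re v)"
    using assms unfolding strip_tile_def by (metis add_diff_cancel)
  moreover have "\<exists>x. accessible (- 1) (y + 1) (interior P) (x - Re v)"
    using assms unfolding strip_tile_def by (metis add_diff_cancel)
  moreover have "connected ((+) v ` interior P)"
    using assms by (intro connected_continuous_image continuous_intros) (simp add: strip_tile_def)
  moreover have "(+) v ` P \<subseteq> {z. y + Im v \<le> Im z \<and> Im z \<le> y + Im v + 1}"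
    using assms by (auto simp: strip_tile_def)
  moreover have "y + Im v + 1 - Im v = y + 1" "y + Im v - Im v = y" by simp_all
  ultimately show ?thesis
    using assms
    unfolding strip_tile_def interior_translation accessible_translation_iff
    by (simp only: closure_translation compact_translation)
qed

section \<open>The left-to-right order of tiles\<close>

text \<open>Fashoda's theorem, transported from \<open>real^2\<close>.\<close>

lemma crossing_paths_complex:
  fixes f g :: "real \<Rightarrow> complex"
  assumes "path f" "path g"
    and f: "\<And>z. z \<in> path_image f \<Longrightarrow> a \<le> Re z \<and> Re z \<le> b \<and> c \<le> Im z \<and> Im z \<le> d"
    and g: "\<And>z. z \<in> path_image g \<Longrightarrow> a \<le> Re z \<and> Re z \<le> b \<and> c \<le> Im z \<and> Im z \<le> d"
    and ends: "Re (pathstart f) = a" "Re (pathfinish f) = b" "Im (pathstart g) = c" "Im (pathfinish g) = d"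
  shows "path_image f \<inter> path_image g \<noteq> {}"
proof -
  define h :: "complex \<Rightarrow> real^2" where "h z = (\<chi> i. if i = 1 then Re z else Im z)" for z
  have h1: "h z $ 1 = Re z" and h2: "h z $ 2 = Im z" for z by (simp_all add: h_def)
  have inj: "h z = h w \<Longrightarrow> z = w" for z w
    by (metis h1 h2 complex_eqI)
  have cont: "continuous_on X h" for X
    unfolding h_def
  proof (rule continuous_on_vec_lambda)
    show "continuous_on X (\<lambda>z. if i = 1 then Re z else Im z)" for i :: 2
      by (cases "i = 1") (auto intro: continuous_intros)
  qed
  define u v :: "real^2" where "u = (\<chi> i. if i = 1 then a else c)" and "v = (\<chi> i. if i = 1 then b else d)"
  have uv: "u $ 1 = a" "u $ 2 = c" "v $ 1 = b" "v $ 2 = d" by (simp_all add: u_def v_def)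
  have "\<exists>w. w \<in> path_image (h \<circ> f) \<and> w \<in> path_image (h \<circ> g)"
  proof (rule fashoda[of "h \<circ> f" "h \<circ> g" u v])
    show "path (h \<circ> f)" "path (h \<circ> g)"
      using assms(1,2) cont by (auto intro: path_continuous_image)
    show "path_image (h \<circ> f) \<subseteq> cbox u v" "path_image (h \<circ> g) \<subseteq> cbox u v"
      using f g by (auto simp: path_image_compose mem_box_cart forall_2 h1 h2 uv)
  qed (auto simp: pathstart_compose pathfinish_compose h1 h2 uv ends)
  then show ?thesis using inj by (auto simp: path_image_compose)
qed

text \<open>A path in \<open>L\<close> from \<open>l1\<close> to \<open>l2\<close> is prolonged
  horizontally to the sides of a bounding box. The prolongations stay at the heights of
  \<open>l1\<close> and \<open>l2\<close>, where all of \<open>K\<close> lies on the other side, so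
  the crossing forced by Fashoda's theorem happens inside \<open>L\<close>.\<close>

lemma strip_crossing:
  assumes K: "path_connected K" "K \<subseteq> {z. 0 \<le> Im z \<and> Im z \<le> 1}"
    and L: "path_connected L" "L \<subseteq> {z. 0 \<le> Im z \<and> Im z \<le> 1}"
    and k: "k0 \<in> K" "k1 \<in> K" "Im k0 = 0" "Im k1 = 1"
    and l: "l1 \<in> L" "l2 \<in> L"
    and left: "\<And>z. z \<in> K \<Longrightarrow> Im z = Im l1 \<Longrightarrow> Re l1 < Re z"
    and right: "\<And>z. z \<in> K \<Longrightarrow> Im z = Im l2 \<Longrightarrow> Re z < Re l2"
  shows "K \<inter> L \<noteq> {}"
proof -
  obtain g where g: "path g" "path_image g \<subseteq> K" "pathstart g = k0" "pathfinish g = k1"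
    using K(1) k unfolding path_connected_def by blast
  obtain t where t: "path t" "path_image t \<subseteq> L" "pathstart t = l1" "pathfinish t = l2"
    using L(1) l unfolding path_connected_def by blast
  have "bounded (path_image g \<union> path_image t)"
    using g(1) t(1) by (simp add: bounded_path_image)
  then obtain B where B: "\<And>z. z \<in> path_image g \<union> path_image t \<Longrightarrow> norm z \<le> B"
    unfolding bounded_iff by blast
  have ReB: "- B \<le> Re z \<and> Re z \<le> B" if "z \<in> path_image g \<union> path_image t" for z
    using B[OF that] abs_Re_le_cmod[of z] by linarith
  define m1 m2 where "m1 = Complex (- B) (Im l1)" and "m2 = Complex B (Im l2)"
  have lt: "l1 \<in> path_image t" "l2 \<in> path_image t" using t by auto
  have seg1: "Im z = Im l1 \<and> - B \<le> Re z \<and> Re z \<le> Re l1" if z: "z \<in> closed_segment m1 l1" for z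
  proof -
    obtain u where u: "0 \<le> u" "u \<le> 1" "z = (1 - u) *\<^sub>R m1 + u *\<^sub>R l1" using z by (auto simp: in_segment)
    have "- B \<le> Re l1" using ReB lt by auto
    then have "0 \<le> u * (Re l1 + B)" "0 \<le> (1 - u) * (Re l1 + B)" using u by auto
    then show ?thesis by (simp add: u m1_def algebra_simps)
  qed
  have seg2: "Im z = Im l2 \<and> Re l2 \<le> Re z \<and> Re z \<le> B" if z: "z \<in> closed_segment l2 m2" for z
  proof -
    obtain u where u: "0 \<le> u" "u \<le> 1" "z = (1 - u) *\<^sub>R l2 + u *\<^sub>R m2" using z by (auto simp: in_segment)
    have "Re l2 \<le> B" using ReB lt by auto
    then have "0 \<le> u * (B - Re l2)" "0 \<le> (1 - u) * (B - Re l2)" using u by auto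
    then show ?thesis by (simp add: u m2_def algebra_simps)
  qed
  define f where "f = linepath m1 l1 +++ t +++ linepath l2 m2"
  have pf: "path_image f = closed_segment m1 l1 \<union> path_image t \<union> closed_segment l2 m2"
    unfolding f_def using t by (subst path_image_join; simp add: path_image_join Un_assoc)
  have "path_image f \<inter> path_image g \<noteq> {}"
  proof (rule crossing_paths_complex[of f g "- B" B 0 1])
    show "path f" "path g" using t g by (auto simp: f_def)
    fix z
    show "- B \<le> Re z \<and> Re z \<le> B \<and> 0 \<le> Im z \<and> Im z \<le> 1" if "z \<in> path_image f"
    proof -
      have im: "0 \<le> Im l1 \<and> Im l1 \<le> 1" "0 \<le> Im l2 \<and> Im l2 \<le> 1" using l L(2) by auto
      have re: "Re l1 \<le> B" "- B \<le> Re l2" using ReB lt by auto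
      from that consider "z \<in> closed_segment m1 l1" | "z \<in> path_image t" | "z \<in> closed_segment l2 m2"
        unfolding pf by blast
      then show ?thesis
      proof cases
        case 1
        from seg1[OF this] im re show ?thesis by simp
      next
        case 2
        then have "z \<in> L" using t(2) by blast
        then show ?thesis using ReB[of z] 2 L(2) by auto
      next
        case 3
        from seg2[OF this] im re show ?thesis by simp
      qed
    qed
    show "- B \<le> Re z \<and> Re z \<le> B \<and> 0 \<le> Im z \<and> Im z \<le> 1" if "z \<in> path_image g"
      using that ReB[of z] g(2) K(2) by auto
  qed (use g t k in \<open>auto simp: f_def m1_def m2_def\<close>)
  then obtain z where z: "z \<in> path_image f" "z \<in> K" using g(2) by blast
  have "z \<notin> closed_segment m1 l1" "z \<notin> closed_segment l2 m2"
    using seg1[of z] seg2[of z] left[OF z(2)] right[OF z(2)] by auto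
  then have "z \<in> path_image t" using z(1) unfolding pf by blast
  then show ?thesis using z t(2) by blast
qed

text \<open>The half-disc contains a vertical segment ending at the point. Paths can thus start on
  the border of the strip and otherwise stay in the interior of a tile, where distinct tiles cannot
  meet.\<close>

lemma path_connected_insert_accessible:
  assumes U: "open U" "connected U" and acc: "accessible \<sigma> y U x" and \<sigma>: "\<sigma> = 1 \<or> \<sigma> = -1"
  shows "path_connected (insert (Complex x y) U)"
proof -
  obtain \<eta> where \<eta>: "\<eta> > 0" "\<And>z. dist z (Complex x y) < \<eta> \<Longrightarrow> \<sigma> * (Im z - y) > 0 \<Longrightarrow> z \<in> U"
    using acc by (auto simp: accessible_def)
  define p where "p = Complex x y"
  define w where "w = Complex x (y + \<sigma> * (\<eta> / 2))"
  have ss: "\<sigma> * \<sigma> = 1" using \<sigma> by auto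
  have "z \<in> insert p U" if z: "z \<in> closed_segment p w" for z
  proof -
    obtain u where u: "0 \<le> u" "u \<le> 1" "z = (1 - u) *\<^sub>R p + u *\<^sub>R w" using z by (auto simp: in_segment)
    have z: "z = Complex x (y + u * (\<sigma> * (\<eta> / 2)))"
      by (simp add: u p_def w_def complex_eq_iff algebra_simps)
    show ?thesis
    proof (cases "u = 0")
      case True
      then show ?thesis by (simp add: z p_def)
    next
      case False
      have "\<sigma> * (Im z - y) = u * (\<eta> / 2) * (\<sigma> * \<sigma>)" by (simp add: z)
      also have "\<dots> > 0" using False u(1) \<eta>(1) by (simp add: ss)
      finally have 1: "\<sigma> * (Im z - y) > 0" .
      have "dist z (Complex x y) = \<bar>u * (\<sigma> * (\<eta> / 2))\<bar>" by (simp add: dist_norm z cmod_def)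
      also have "\<dots> = u * (\<eta> / 2)" using \<sigma> u \<eta>(1) by (auto simp: abs_mult)
      also have "\<dots> < \<eta>" using u(2) \<eta>(1) mult_right_mono[of u 1 "\<eta> / 2"] by simp
      finally show ?thesis using \<eta>(2) 1 by blast
    qed
  qed
  then have seg: "closed_segment p w \<subseteq> insert p U" by blast
  have "w \<in> closed_segment p w" "w \<noteq> p" using \<eta>(1) \<sigma> by (auto simp: w_def p_def)
  then have "w \<in> U" using seg by auto
  have "path_connected U" using U by (simp add: connected_open_path_connected)
  then have "path_connected (U \<union> closed_segment p w)"
    using \<open>w \<in> U\<close> \<open>w \<in> closed_segment p w\<close>
    by (intro path_connected_Un) (auto intro: convex_imp_path_connected)
  moreover have "U \<union> closed_segment p w = insert p U" using seg by auto
  ultimately show ?thesis by (simp add: p_def)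
qed

text \<open>Accessible points replace the full intersection with the bottom line: neighbouring
  closed tiles may share corners, but an accessible point never belongs to two tiles with disjoint
  interiors.\<close>

definition bots :: "complex set \<Rightarrow> real set" where
  "bots P = {x. accessible 1 0 (interior P) x}"

definition lft :: "complex set \<Rightarrow> real" where
  "lft P = Inf (bots P)"

definition rgt :: "complex set \<Rightarrow> real" where
  "rgt P = Sup (bots P)"

locale tile_in_strip =
  fixes P
  assumes strip_tile: "strip_tile 0 P"
begin

lemma compact: "compact P" and connected: "connected (interior P)" and closure: "closure (interior P) = P"
  and negligible: "negligible (P - interior P)" and subset: "P \<subseteq> {z. 0 \<le> Im z \<and> Im z \<le> 1}"
  and finite_bad: "finite {x. Complex x 0 \<in> P \<and> x \<notin> bots P}"
  using strip_tile by (simp_all add: strip_tile_def bots_def)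

lemma interior: "z \<in> interior P \<Longrightarrow> 0 < Im z \<and> Im z < 1"
  using interior_strip[OF subset] by auto

lemma bots_ne: "\<exists>x. x \<in> bots P"
  using strip_tile by (simp add: strip_tile_def bots_def)

lemma tops_ne: "\<exists>x. accessible (- 1) 1 (interior P) x"
  using strip_tile by (simp add: strip_tile_def)

lemma accessible_in: 
  assumes "accessible \<sigma> y (interior P) x" "\<sigma> = 1 \<or> \<sigma> = -1"
  shows "Complex x y \<in> P"
proof -
  obtain \<eta> where \<eta>: "\<eta> > 0" "\<And>z. dist z (Complex x y) < \<eta> \<Longrightarrow> \<sigma> * (Im z - y) > 0 \<Longrightarrow> z \<in> interior P"
    using assms(1) by (auto simp: accessible_def)
  have "\<exists>z\<in>interior P. dist z (Complex x y) < \<epsilon>" if "\<epsilon> > 0" for \<epsilon>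
  proof -
    define r where "r = min \<eta> \<epsilon> / 2"
    have r: "0 < r" "r < \<eta>" "r < \<epsilon>" using \<eta>(1) that by (auto simp: r_def)
    define z where "z = Complex x (y + \<sigma> * r)"
    have "\<sigma> * \<sigma> = 1" using assms(2) by auto
    then have "\<sigma> * (Im z - y) = r" by (simp add: z_def flip: mult.assoc)
    moreover have "dist z (Complex x y) = r"
      using assms(2) r(1) by (auto simp: z_def dist_norm cmod_def)
    ultimately show ?thesis using r \<eta>(2)[of z] by (intro bexI[of _ z]) linarith+
  qed
  then have "Complex x y \<in> closure (interior P)" by (simp add: closure_approachable)
  then show ?thesis by (simp add: closure)
qed

lemma bots_in: "x \<in> bots P \<Longrightarrow> Complex x 0 \<in> P"
  using accessible_in[of 1 0] by (simp add: bots_def)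

lemma bots_bounded: "bdd_below (bots P)" "bdd_above (bots P)"
proof -
  have "bounded (bots P)"
  proof -
    obtain B where B: "\<And>z. z \<in> P \<Longrightarrow> norm z \<le> B"
      using compact_imp_bounded[OF compact] unfolding bounded_iff by blast
    have "norm x \<le> B" if "x \<in> bots P" for x
      using B[OF bots_in[OF that]] by (simp add: cmod_def)
    then show ?thesis unfolding bounded_iff by blast
  qed
  then show "bdd_below (bots P)" "bdd_above (bots P)"
    by (auto intro: bounded_imp_bdd_below bounded_imp_bdd_above)
qed

lemma bots_bounds: "x \<in> bots P \<Longrightarrow> lft P \<le> x \<and> x \<le> rgt P"
  unfolding lft_def rgt_def using bots_bounded by (auto intro: cInf_lower cSup_upper)

text \<open>The half-disc at an accessible point contains a smaller one centred further to the
  right.\<close>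

lemma lft_less_rgt: "lft P < rgt P"
proof -
  obtain x where x: "x \<in> bots P" using bots_ne by blast
  then obtain \<eta> where \<eta>: "\<eta> > 0" "\<And>z. dist z (Complex x 0) < \<eta> \<Longrightarrow> Im z > 0 \<Longrightarrow> z \<in> interior P"
    by (auto simp: bots_def accessible_def)
  have "z \<in> interior P" if "dist z (Complex (x + \<eta> / 2) 0) < \<eta> / 2" "Im z > 0" for z
  proof (rule \<eta>(2)[OF _ that(2)])
    have "dist (Complex (x + \<eta> / 2) 0) (Complex x 0) = \<eta> / 2"
      using \<eta>(1) by (simp add: dist_norm cmod_def)
    then show "dist z (Complex x 0) < \<eta>"
      using that(1) dist_triangle[of z "Complex x 0" "Complex (x + \<eta> / 2) 0"] by simp
  qed
  then have "accessible 1 0 (interior P) (x + \<eta> / 2)"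
    unfolding accessible_def using \<eta>(1) by (intro exI[of _ "\<eta> / 2"]) auto
  then have "x + \<eta> / 2 \<in> bots P" by (simp add: bots_def)
  from bots_bounds[OF this] bots_bounds[OF x] \<eta>(1) show ?thesis by linarith
qed

lemma path_connected_insert_bots:
  assumes "x \<in> bots P"
  shows "path_connected (insert (Complex x 0) (interior P))"
  using assms connected by (intro path_connected_insert_accessible[of _ 1]) (auto simp: bots_def)

lemma interior_ne: "interior P \<noteq> {}"
  using bots_ne bots_in closure by (metis closure_empty empty_iff)

text \<open>Supplies the barriers for \<open>strip_crossing\<close>. Allowing a single bottom point
  makes the comparison at height 0 a comparison of two numbers.\<close>

lemma spanning_set:
  assumes "x \<in> bots P"
  obtains K where "path_connected K" "interior P \<subseteq> K" "K \<subseteq> P" "Complex x 0 \<in> K" "\<exists>k\<in>K. Im k = 1"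
    "\<And>z. z \<in> K \<Longrightarrow> Im z = 0 \<Longrightarrow> z = Complex x 0"
    "\<And>z. z \<in> K \<Longrightarrow> z \<in> interior P \<or> Im z = 1 \<or> z = Complex x 0"
proof -
  obtain t where t: "accessible (- 1) 1 (interior P) t" using tops_ne by blast
  define K where "K = insert (Complex x 0) (interior P) \<union> insert (Complex t 1) (interior P)"
  have "path_connected (insert (Complex t 1) (interior P))"
    using connected t by (intro path_connected_insert_accessible[of _ "-1"]) auto
  then have 1: "path_connected K" unfolding K_def
    using path_connected_insert_bots[OF assms] interior_ne by (intro path_connected_Un) auto
  have 2: "K \<subseteq> P"
    using bots_in[OF assms] accessible_in[OF t] interior_subset by (auto simp: K_def)
  show thesis
    by (rule that[OF 1 _ 2]) (use interior in \<open>fastforce simp: K_def\<close>)+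
qed

end

section \<open>Two tiles with disjoint interiors\<close>

locale two_tiles_in_strip = P: tile_in_strip P + Q: tile_in_strip Q for P Q +
  assumes disjoint: "interior P \<inter> interior Q = {}"
begin

lemma bots_neq:
  assumes "p \<in> bots P" "q \<in> bots Q"
  shows "p \<noteq> q"
proof
  assume "p = q"
  obtain \<eta> where \<eta>: "\<eta> > 0" "\<And>z. dist z (Complex p 0) < \<eta> \<Longrightarrow> Im z > 0 \<Longrightarrow> z \<in> interior P"
    using assms(1) by (auto simp: bots_def accessible_def)
  obtain \<epsilon> where \<epsilon>: "\<epsilon> > 0" "\<And>z. dist z (Complex p 0) < \<epsilon> \<Longrightarrow> Im z > 0 \<Longrightarrow> z \<in> interior Q"
    using assms(2) \<open>p = q\<close> by (auto simp: bots_def accessible_def)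
  define r where "r = min \<eta> \<epsilon> / 2"
  have r: "0 < r" "r < \<eta>" "r < \<epsilon>" using \<eta>(1) \<epsilon>(1) by (auto simp: r_def)
  have "dist (Complex p r) (Complex p 0) = r" using r(1) by (simp add: dist_norm cmod_def)
  then have "Complex p r \<in> interior P \<inter> interior Q" using \<eta>(2) \<epsilon>(2) r by simp
  then show False using disjoint by simp
qed

text \<open>A spanning set of \<open>Q\<close> based at \<open>q\<close> would separate the two
  bottom points, which are joined through the interior of \<open>P\<close>.\<close>

lemma not_between:
  assumes "p \<in> bots P" "p' \<in> bots P" "q \<in> bots Q"
  shows "\<not> (p < q \<and> q < p')"
proof
  assume lt: "p < q \<and> q < p'"
  obtain K where K: "path_connected K" "interior Q \<subseteq> K" "K \<subseteq> Q" "Complex q 0 \<in> K" "\<exists>k\<in>K. Im k = 1"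
    "\<And>z. z \<in> K \<Longrightarrow> Im z = 0 \<Longrightarrow> z = Complex q 0"
    "\<And>z. z \<in> K \<Longrightarrow> z \<in> interior Q \<or> Im z = 1 \<or> z = Complex q 0"
    using Q.spanning_set[OF assms(3)] by blast
  define L where "L = insert (Complex p 0) (interior P) \<union> insert (Complex p' 0) (interior P)"
  have L: "path_connected L" unfolding L_def
    using P.path_connected_insert_bots assms(1,2) P.interior_ne by (intro path_connected_Un) auto
  obtain k where k: "k \<in> K" "Im k = 1" using K(5) by blast
  have "K \<inter> L \<noteq> {}"
  proof (rule strip_crossing[OF K(1) _ L _ K(4) k(1) _ k(2)])
    show "K \<subseteq> {z. 0 \<le> Im z \<and> Im z \<le> 1}" using K(3) Q.subset by blast
    show "L \<subseteq> {z. 0 \<le> Im z \<and> Im z \<le> 1}" using P.interior by (fastforce simp: L_def)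
    show "Complex p 0 \<in> L" "Complex p' 0 \<in> L" by (auto simp: L_def)
    show "Re (Complex p 0) < Re z" if "z \<in> K" "Im z = Im (Complex p 0)" for z
      using K(6)[OF that(1)] that(2) lt by simp
    show "Re z < Re (Complex p' 0)" if "z \<in> K" "Im z = Im (Complex p' 0)" for z
      using K(6)[OF that(1)] that(2) lt by simp
  qed simp
  then obtain z where z: "z \<in> K" "z \<in> L" by blast
  then show False
    using K(7)[OF z(1)] K(6)[OF z(1)] disjoint P.interior[of z] Q.interior[of z] lt by (auto simp: L_def)
qed

end

lemma two_tiles_sym: "two_tiles_in_strip P Q \<Longrightarrow> two_tiles_in_strip Q P"
  by (auto simp: two_tiles_in_strip_def two_tiles_in_strip_axioms_def)

context two_tiles_in_strip
begin

text \<open>By two applications of \<open>not_between\<close>, replacing first \<open>p\<close> and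
  then \<open>q\<close>, a single comparison of bottom points decides all others.\<close>

lemma bots_less:
  assumes "p \<in> bots P" "q \<in> bots Q" "p < q" "p' \<in> bots P" "q' \<in> bots Q"
  shows "p' < q'"
proof -
  interpret QP: two_tiles_in_strip Q P by (rule two_tiles_sym) unfold_locales
  have "p' < q"
    using not_between[OF assms(1,4,2)] bots_neq[OF assms(4,2)] assms(3) by linarith
  then show ?thesis
    using QP.not_between[OF assms(5,2,4)] bots_neq[OF assms(4,5)] by linarith
qed

lemma rgt_le_lft:
  assumes "p \<in> bots P" "q \<in> bots Q" "p < q"
  shows "rgt P \<le> lft Q"
proof -
  have "rgt P \<le> q'" if "q' \<in> bots Q" for q'
    unfolding rgt_def using P.bots_ne bots_less[OF assms _ that]
    by (intro cSup_least) (auto intro: less_imp_le)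
  then show ?thesis unfolding lft_def using Q.bots_ne by (intro cInf_greatest) auto
qed

lemma separated: "rgt P \<le> lft Q \<or> rgt Q \<le> lft P"
proof -
  interpret QP: two_tiles_in_strip Q P by (rule two_tiles_sym) unfold_locales
  obtain p q where pq: "p \<in> bots P" "q \<in> bots Q" using P.bots_ne Q.bots_ne by blast
  then consider "p < q" | "q < p" using bots_neq by fastforce
  then show ?thesis using rgt_le_lft[OF pq] QP.rgt_le_lft[OF pq(2,1)] by blast
qed

lemma less_of_rgt_le_lft:
  assumes "rgt P \<le> lft Q" "p \<in> bots P" "q \<in> bots Q"
  shows "p < q"
  using P.bots_bounds[OF assms(2)] Q.bots_bounds[OF assms(3)] bots_neq[OF assms(2,3)] assms(1)
  by linarith

text \<open>An interior point of \<open>Q\<close> beyond the wall would lie left of all of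
  \<open>P\<close>, while the bottom of \<open>Q\<close> lies right of that of \<open>P\<close>; so
  \<open>Q\<close> would have to cross \<open>P\<close>. This reduces the left wall to a condition
  on the first tile.\<close>

lemma Re_ge_propagates:
  assumes "rgt P \<le> lft Q" "P \<subseteq> {z. r \<le> Re z}"
  shows "Q \<subseteq> {z. r \<le> Re z}"
proof -
  obtain p q where pq: "p \<in> bots P" "q \<in> bots Q" using P.bots_ne Q.bots_ne by blast
  have "p < q" using less_of_rgt_le_lft[OF assms(1) pq] .
  obtain K where K: "path_connected K" "interior P \<subseteq> K" "K \<subseteq> P" "Complex p 0 \<in> K" "\<exists>k\<in>K. Im k = 1"
    "\<And>z. z \<in> K \<Longrightarrow> Im z = 0 \<Longrightarrow> z = Complex p 0"
    "\<And>z. z \<in> K \<Longrightarrow> z \<in> interior P \<or> Im z = 1 \<or> z = Complex p 0"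
    using P.spanning_set[OF pq(1)] by blast
  obtain k where k: "k \<in> K" "Im k = 1" using K(5) by blast
  have "r \<le> Re z" if z: "z \<in> interior Q" for z
  proof (rule ccontr)
    assume "\<not> r \<le> Re z"
    have "K \<inter> insert (Complex q 0) (interior Q) \<noteq> {}"
    proof (rule strip_crossing[OF K(1) _ Q.path_connected_insert_bots[OF pq(2)] _ K(4) k(1) _ k(2)])
      show "K \<subseteq> {z. 0 \<le> Im z \<and> Im z \<le> 1}" using K(3) P.subset by blast
      show "insert (Complex q 0) (interior Q) \<subseteq> {z. 0 \<le> Im z \<and> Im z \<le> 1}"
        using Q.interior by fastforce
      show "z \<in> insert (Complex q 0) (interior Q)" "Complex q 0 \<in> insert (Complex q 0) (interior Q)"
        using z by auto
      show "Re z < Re w" if "w \<in> K" "Im w = Im z" for w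
        using that(1) K(3) assms(2) \<open>\<not> r \<le> Re z\<close> by fastforce
      show "Re w < Re (Complex q 0)" if "w \<in> K" "Im w = Im (Complex q 0)" for w
        using K(6)[OF that(1)] that(2) \<open>p < q\<close> by simp
    qed simp
    then obtain w where w: "w \<in> K" "w = Complex q 0 \<or> w \<in> interior Q" by blast
    then show False
      using K(7)[OF w(1)] K(6)[OF w(1)] disjoint P.interior[of w] Q.interior[of w] \<open>p < q\<close> by auto
  qed
  then have "closure (interior Q) \<subseteq> {z. r \<le> Re z}"
    by (intro closure_minimal closed_halfspace_Re_ge) auto
  then show ?thesis by (simp add: Q.closure)
qed

lemma Re_le_propagates:
  assumes "rgt P \<le> lft Q" "Q \<subseteq> {z. Re z \<le> r}"
  shows "P \<subseteq> {z. Re z \<le> r}"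
proof -
  obtain p q where pq: "p \<in> bots P" "q \<in> bots Q" using P.bots_ne Q.bots_ne by blast
  have "p < q" using less_of_rgt_le_lft[OF assms(1) pq] .
  obtain K where K: "path_connected K" "interior Q \<subseteq> K" "K \<subseteq> Q" "Complex q 0 \<in> K" "\<exists>k\<in>K. Im k = 1"
    "\<And>z. z \<in> K \<Longrightarrow> Im z = 0 \<Longrightarrow> z = Complex q 0"
    "\<And>z. z \<in> K \<Longrightarrow> z \<in> interior Q \<or> Im z = 1 \<or> z = Complex q 0"
    using Q.spanning_set[OF pq(2)] by blast
  obtain k where k: "k \<in> K" "Im k = 1" using K(5) by blast
  have "Re z \<le> r" if z: "z \<in> interior P" for z
  proof (rule ccontr)
    assume "\<not> Re z \<le> r"
    have "K \<inter> insert (Complex p 0) (interior P) \<noteq> {}"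
    proof (rule strip_crossing[OF K(1) _ P.path_connected_insert_bots[OF pq(1)] _ K(4) k(1) _ k(2)])
      show "K \<subseteq> {z. 0 \<le> Im z \<and> Im z \<le> 1}" using K(3) Q.subset by blast
      show "insert (Complex p 0) (interior P) \<subseteq> {z. 0 \<le> Im z \<and> Im z \<le> 1}"
        using P.interior by fastforce
      show "Complex p 0 \<in> insert (Complex p 0) (interior P)" "z \<in> insert (Complex p 0) (interior P)"
        using z by auto
      show "Re (Complex p 0) < Re w" if "w \<in> K" "Im w = Im (Complex p 0)" for w
        using K(6)[OF that(1)] that(2) \<open>p < q\<close> by simp
      show "Re w < Re z" if "w \<in> K" "Im w = Im z" for w
        using that(1) K(3) assms(2) \<open>\<not> Re z \<le> r\<close> by fastforce
    qed simp
    then obtain w where w: "w \<in> K" "w = Complex p 0 \<or> w \<in> interior P" by blast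
    then show False
      using K(7)[OF w(1)] K(6)[OF w(1)] disjoint P.interior[of w] Q.interior[of w] \<open>p < q\<close> by auto
  qed
  then have "closure (interior P) \<subseteq> {z. Re z \<le> r}"
    by (intro closure_minimal closed_halfspace_Re_le) auto
  then show ?thesis by (simp add: P.closure)
qed

end

text \<open>Overlapping interiors of \<open>A\<close> and \<open>C\<close> would form a connected
  set leading from the left of \<open>B\<close> to its right; it must cross a spanning set of
  \<open>B\<close>, although \<open>B\<close> overlaps neither.\<close>

lemma disjoint_of_between:
  assumes "two_tiles_in_strip A B" "two_tiles_in_strip B C" "rgt A \<le> lft B" "rgt B \<le> lft C"
  shows "two_tiles_in_strip A C"
proof -
  interpret AB: two_tiles_in_strip A B by fact
  interpret BC: two_tiles_in_strip B C by fact
  obtain a b c where abc: "a \<in> bots A" "b \<in> bots B" "c \<in> bots C"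
    using AB.P.bots_ne AB.Q.bots_ne BC.Q.bots_ne by blast
  have lt: "a < b" "b < c"
    using AB.less_of_rgt_le_lft[OF assms(3)] BC.less_of_rgt_le_lft[OF assms(4)] abc by auto
  have "interior A \<inter> interior C = {}"
  proof (rule ccontr)
    assume ne: "interior A \<inter> interior C \<noteq> {}"
    obtain K where K: "path_connected K" "interior B \<subseteq> K" "K \<subseteq> B" "Complex b 0 \<in> K" "\<exists>k\<in>K. Im k = 1"
      "\<And>z. z \<in> K \<Longrightarrow> Im z = 0 \<Longrightarrow> z = Complex b 0"
      "\<And>z. z \<in> K \<Longrightarrow> z \<in> interior B \<or> Im z = 1 \<or> z = Complex b 0"
      using AB.Q.spanning_set[OF abc(2)] by blast
    obtain k where k: "k \<in> K" "Im k = 1" using K(5) by blast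
    define L where "L = insert (Complex a 0) (interior A) \<union> insert (Complex c 0) (interior C)"
    have L: "path_connected L" unfolding L_def
      using AB.P.path_connected_insert_bots BC.Q.path_connected_insert_bots abc ne
      by (intro path_connected_Un) auto
    have "K \<inter> L \<noteq> {}"
    proof (rule strip_crossing[OF K(1) _ L _ K(4) k(1) _ k(2)])
      show "K \<subseteq> {z. 0 \<le> Im z \<and> Im z \<le> 1}" using K(3) AB.Q.subset by blast
      show "L \<subseteq> {z. 0 \<le> Im z \<and> Im z \<le> 1}"
        using AB.P.interior BC.Q.interior by (fastforce simp: L_def)
      show "Complex a 0 \<in> L" "Complex c 0 \<in> L" by (auto simp: L_def)
      show "Re (Complex a 0) < Re z" if "z \<in> K" "Im z = Im (Complex a 0)" for z
        using K(6)[OF that(1)] that(2) lt by simp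
      show "Re z < Re (Complex c 0)" if "z \<in> K" "Im z = Im (Complex c 0)" for z
        using K(6)[OF that(1)] that(2) lt by simp
    qed simp
    then obtain z where z: "z \<in> K" "z \<in> L" by blast
    then show False
      using K(7)[OF z(1)] K(6)[OF z(1)] AB.disjoint BC.disjoint AB.P.interior[of z]
        BC.Q.interior[of z] AB.Q.interior[of z] lt by (auto simp: L_def)
  qed
  then show ?thesis by unfold_locales
qed

section \<open>Tilings as words\<close>

definition shift :: "real \<Rightarrow> complex set \<Rightarrow> complex set" where
  "shift x P = (+) (of_real x) ` P"

lemma shift_shift: "shift x (shift y P) = shift (x + y) P"
  by (simp add: shift_def image_image add.assoc)

lemma shift_0 [simp]: "shift 0 P = P"
  by (simp add: shift_def)

lemma interior_shift: "interior (shift x P) = shift x (interior P)"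
  by (simp add: shift_def interior_translation)

lemma shift_Int: "shift x P \<inter> shift x Q = shift x (P \<inter> Q)"
  by (auto simp: shift_def)

lemma shift_eq_empty [simp]: "shift x P = {} \<longleftrightarrow> P = {}"
  by (simp add: shift_def)

lemma measure_shift: "measure lebesgue (shift x P) = measure lebesgue P"
  by (simp add: shift_def measure_translation)

lemma tile_in_strip_shift:
  assumes "tile_in_strip P"
  shows "tile_in_strip (shift x P)"
  using strip_tile_translation[of 0 P "of_real x"] assms by (simp add: tile_in_strip_def shift_def)

lemma bots_shift: "bots (shift x P) = (+) x ` bots P"
proof -
  have "z \<in> bots (shift x P) \<longleftrightarrow> z - x \<in> bots P" for z
    by (simp add: bots_def shift_def interior_translation accessible_translation_iff)
  then show ?thesis by (force simp: image_iff intro: bexI[of _ "_ - x"])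
qed

lemma lft_shift:
  assumes "tile_in_strip P"
  shows "lft (shift x P) = x + lft P"
proof -
  \<comment> \<open>The opposite inequality is this one for the shift by \<open>-x\<close>, applied
    to the shifted tile.\<close>
  have le: "x + lft P \<le> lft (shift x P)" if "tile_in_strip P" for x P
  proof -
    interpret tile_in_strip P by fact
    show ?thesis unfolding lft_def[of "shift x P"] bots_shift
      using bots_ne bots_bounds by (intro cInf_greatest) auto
  qed
  show ?thesis
    using le[OF assms, of x] le[OF tile_in_strip_shift[OF assms, of x], of "- x"]
    by (simp add: shift_shift)
qed

lemma rgt_shift:
  assumes "tile_in_strip P"
  shows "rgt (shift x P) = x + rgt P"
proof -
  have le: "rgt (shift x P) \<le> x + rgt P" if "tile_in_strip P" for x P
  proof -
    interpret tile_in_strip P by fact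
    show ?thesis unfolding rgt_def[of "shift x P"] bots_shift
      using bots_ne bots_bounds by (intro cSup_least) auto
  qed
  show ?thesis
    using le[OF assms, of x] le[OF tile_in_strip_shift[OF assms, of x], of "- x"]
    by (simp add: shift_shift)
qed

context tile_in_strip
begin

lemma lmeasurable: "P \<in> lmeasurable"
  using compact by (rule lmeasurable_compact)

lemma measure_pos: "measure lebesgue P > 0"
proof -
  have "\<not> negligible (interior P)" using interior_ne by (intro open_not_negligible) auto
  then have "\<not> negligible P" using negligible_subset interior_subset by blast
  then show ?thesis using negligible_iff_measure0[OF lmeasurable] by (simp add: zero_less_measure_iff)
qed

end

lemma measure_Union_tiles:
  assumes "finite C" "\<And>P. P \<in> C \<Longrightarrow> tile_in_strip P"
    and "\<And>P Q. P \<in> C \<Longrightarrow> Q \<in> C \<Longrightarrow> P \<noteq> Q \<Longrightarrow> interior P \<inter> interior Q = {}"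
  shows "measure lebesgue (\<Union>C) = (\<Sum>P\<in>C. measure lebesgue P)"
proof (rule measure_negligible_finite_Union[OF assms(1)])
  show "P \<in> lmeasurable" if "P \<in> C" for P
    using tile_in_strip.lmeasurable[OF assms(2)[OF that]] .
  have "negligible (P \<inter> Q)" if "P \<in> C" "Q \<in> C" "P \<noteq> Q" for P Q
  proof -
    have "negligible ((P - interior P) \<union> (Q - interior Q))"
      using tile_in_strip.negligible[OF assms(2)] that by simp
    moreover have "P \<inter> Q \<subseteq> (P - interior P) \<union> (Q - interior Q)"
      using assms(3)[OF that] by blast
    ultimately show ?thesis by (rule negligible_subset)
  qed
  then show "pairwise (\<lambda>P Q. negligible (P \<inter> Q)) C" by (simp add: pairwise_def)
qed

lemma strip_rect_eq_cbox: "strip_rect a = cbox 0 (Complex a 1)"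
  by (auto simp: strip_rect_def in_cbox_complex_iff)

lemma measure_strip_rect: "a \<ge> 0 \<Longrightarrow> measure lebesgue (strip_rect a) = a"
  unfolding strip_rect_eq_cbox
  by (simp add: measure_lborel_cbox_eq Basis_complex_def inner_complex_def complex_eq_iff)

text \<open>A point missed by the closed set has a neighbourhood that is missed too, and this meets
  the open rectangle in a nonempty open set, which is not negligible. So the area condition alone
  excludes gaps.\<close>

lemma closed_full_measure_strip_rect:
  assumes "closed F" "F \<subseteq> strip_rect a" "measure lebesgue F = a" "a > 0"
  shows "F = strip_rect a"
proof (rule ccontr)
  assume "F \<noteq> strip_rect a"
  then obtain z where z: "z \<in> strip_rect a" "z \<notin> F" using assms(2) by blast
  have F: "F \<in> sets lebesgue" using assms(1) by auto
  have lm: "strip_rect a \<in> lmeasurable" by (simp add: strip_rect_eq_cbox)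
  have "measure lebesgue (strip_rect a - F) = 0"
    using measurable_measure_Diff[OF lm F assms(2)] assms(3,4) by (simp add: measure_strip_rect)
  moreover have "strip_rect a - F \<in> lmeasurable"
    using lm F by (rule fmeasurable_Diff)
  ultimately have neg: "negligible (strip_rect a - F)" by (simp add: negligible_iff_measure0)
  have "box 0 (Complex a 1) \<noteq> {}"
    using assms(4) by (auto simp: box_ne_empty Basis_complex_def inner_complex_def)
  then have "z \<in> closure (box 0 (Complex a 1))" using z(1) by (simp add: strip_rect_eq_cbox closure_box)
  then have "(- F) \<inter> box 0 (Complex a 1) \<noteq> {}"
    using open_Int_closure_eq_empty[of "- F" "box 0 (Complex a 1)"] z(2) assms(1) by auto
  moreover have "open ((- F) \<inter> box 0 (Complex a 1))" using assms(1) by auto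
  ultimately have "\<not> negligible ((- F) \<inter> box 0 (Complex a 1))" by (intro open_not_negligible)
  moreover have "(- F) \<inter> box 0 (Complex a 1) \<subseteq> strip_rect a - F"
    using box_subset_cbox by (auto simp: strip_rect_eq_cbox)
  ultimately show False using neg negligible_subset by blast
qed

section \<open>From words to tilings\<close>

text \<open>The letters will be normalised to \<open>lft = 0\<close>: each bottom side starts where
  the preceding one ends, although higher up the tiles may reach across these positions.\<close>

fun places :: "real \<Rightarrow> complex set list \<Rightarrow> complex set set" where
  "places x [] = {}"
| "places x (\<alpha> # w) = insert (shift x \<alpha>) (places (x + rgt \<alpha>) w)"

lemma finite_places: "finite (places x w)"
  by (induction w arbitrary: x) auto

definition normalize_tile :: "complex set \<Rightarrow> complex set" where
  "normalize_tile P = shift (- lft P) P"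

locale tall_tiles =
  fixes T :: "complex set set"
  assumes finite_T: "finite T" and tall: "t \<in> T \<Longrightarrow> tall_tile t"
begin

definition translate :: "complex set \<Rightarrow> bool" where
  "translate P \<longleftrightarrow> (\<exists>t\<in>T. \<exists>v. P = (\<lambda>z. v + z) ` t)"

text \<open>The letters are point sets and not members of \<open>T\<close>, so members that are
  translates of each other yield one letter, in accordance with tilings being sets of placed
  tiles.\<close>

definition A :: "complex set set" where
  "A = normalize_tile ` {P. tile_in_strip P \<and> translate P}"

definition compat :: "complex set \<Rightarrow> complex set \<Rightarrow> bool" where
  "compat \<alpha> \<beta> \<longleftrightarrow> interior \<alpha> \<inter> interior (shift (rgt \<alpha>) \<beta>) = {}"

text \<open>The walls of the rectangle constrain only the first and the last letter. For a
  normalised tile the left wall is at 0, and the right wall is at the end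
  \<open>rgt \<alpha>\<close> of its own bottom side.\<close>

definition St :: "complex set set" where
  "St = {\<alpha>. \<alpha> \<subseteq> {z. 0 \<le> Re z}}"

definition En :: "complex set set" where
  "En = {\<alpha>. \<alpha> \<subseteq> {z. Re z \<le> rgt \<alpha>}}"

definition wt :: "complex set \<Rightarrow> complex" where
  "wt \<alpha> = Complex (measure lebesgue \<alpha>) (rgt \<alpha>)"

lemma translate_shift: "translate P \<Longrightarrow> translate (shift x P)"
proof -
  assume "translate P"
  then obtain t v where t: "t \<in> T" "P = (\<lambda>z. v + z) ` t" by (auto simp: translate_def)
  then have "shift x P = (\<lambda>z. (of_real x + v) + z) ` t" by (simp add: shift_def image_image add.assoc)
  then show ?thesis unfolding translate_def using t(1) by blast
qed

lemma translate_cases: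
  assumes "translate P"
  obtains t v where "t \<in> T" "tile_in_strip ((+) (Complex 0 (- Inf (Im ` t))) ` t)"
    "P = (+) v ` (+) (Complex 0 (- Inf (Im ` t))) ` t"
proof -
  obtain t v where t: "t \<in> T" "P = (\<lambda>z. v + z) ` t" using assms by (auto simp: translate_def)
  define y where "y = Inf (Im ` t)"
  have "strip_tile (y + Im (Complex 0 (- y))) ((+) (Complex 0 (- y)) ` t)"
    unfolding y_def by (intro strip_tile_translation tall_tile_strip_tile tall t)
  then have "tile_in_strip ((+) (Complex 0 (- y)) ` t)" by (simp add: tile_in_strip_def)
  moreover have "P = (+) (v + Complex 0 y) ` (+) (Complex 0 (- y)) ` t"
    by (simp add: t image_image complex_eq_iff algebra_simps Complex_eq)
  ultimately show thesis using t(1) that unfolding y_def by blast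
qed

text \<open>Touching both sides of the strip leaves no vertical freedom. Together with the
  horizontal normalisation this makes the alphabet finite.\<close>

lemma translation_in_strip:
  assumes "tile_in_strip P" "(+) v ` P \<subseteq> {z. 0 \<le> Im z \<and> Im z \<le> 1}"
  shows "Im v = 0"
proof -
  interpret tile_in_strip P by fact
  obtain x where "x \<in> bots P" using bots_ne by blast
  then have "v + Complex x 0 \<in> (+) v ` P" using bots_in by blast
  then have "Im v \<ge> 0" using assms(2) by fastforce
  obtain t where "accessible (- 1) 1 (interior P) t" using tops_ne by blast
  then have "v + Complex t 1 \<in> (+) v ` P" using accessible_in by blast
  then have "Im v \<le> 0" using assms(2) by fastforce
  with \<open>Im v \<ge> 0\<close> show ?thesis by simp
qed

lemma translate_in_strip_cases:
  assumes "translate P" "P \<subseteq> {z. 0 \<le> Im z \<and> Im z \<le> 1}"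
  obtains t x where "t \<in> T" "tile_in_strip ((+) (Complex 0 (- Inf (Im ` t))) ` t)"
    "P = shift x ((+) (Complex 0 (- Inf (Im ` t))) ` t)"
proof -
  obtain t v where t: "t \<in> T" "tile_in_strip ((+) (Complex 0 (- Inf (Im ` t))) ` t)"
    "P = (+) v ` (+) (Complex 0 (- Inf (Im ` t))) ` t"
    using translate_cases[OF assms(1)] by blast
  have "Im v = 0" using translation_in_strip[OF t(2)] assms(2) t(3) by blast
  then have "v = of_real (Re v)" by (simp add: complex_eq_iff)
  then show thesis using that[OF t(1,2), of "Re v"] t(3) by (simp add: shift_def)
qed

lemma tile_in_strip_translate:
  assumes "translate P" "P \<subseteq> {z. 0 \<le> Im z \<and> Im z \<le> 1}"
  shows "tile_in_strip P"
proof -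
  obtain t x where "tile_in_strip ((+) (Complex 0 (- Inf (Im ` t))) ` t)"
    "P = shift x ((+) (Complex 0 (- Inf (Im ` t))) ` t)"
    using translate_in_strip_cases[OF assms] .
  then show ?thesis by (simp add: tile_in_strip_shift)
qed

lemma normalize_shift: "tile_in_strip P \<Longrightarrow> normalize_tile (shift x P) = normalize_tile P"
  by (simp add: normalize_tile_def lft_shift shift_shift)

lemma finite_A: "finite A"
proof -
  have "A \<subseteq> (\<lambda>t. normalize_tile ((+) (Complex 0 (- Inf (Im ` t))) ` t)) ` T"
  proof
    fix \<alpha> assume "\<alpha> \<in> A"
    then obtain P where P: "tile_in_strip P" "translate P" "\<alpha> = normalize_tile P"
      by (auto simp: A_def)
    obtain t x where t: "t \<in> T" "tile_in_strip ((+) (Complex 0 (- Inf (Im ` t))) ` t)"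
      "P = shift x ((+) (Complex 0 (- Inf (Im ` t))) ` t)"
      using translate_in_strip_cases[OF P(2) tile_in_strip.subset[OF P(1)]] by blast
    then show "\<alpha> \<in> (\<lambda>t. normalize_tile ((+) (Complex 0 (- Inf (Im ` t))) ` t)) ` T"
      using P(3) normalize_shift by auto
  qed
  then show ?thesis using finite_T finite_surj by blast
qed

lemma A_tile:
  assumes "\<alpha> \<in> A"
  shows "tile_in_strip \<alpha>" "lft \<alpha> = 0" "rgt \<alpha> > 0" "translate \<alpha>"
proof -
  obtain P where P: "tile_in_strip P" "translate P" "\<alpha> = normalize_tile P"
    using assms by (auto simp: A_def)
  show 1: "tile_in_strip \<alpha>" unfolding P(3) normalize_tile_def using P(1) by (rule tile_in_strip_shift)
  show 2: "lft \<alpha> = 0" unfolding P(3) normalize_tile_def using lft_shift[OF P(1)] by simp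
  show "rgt \<alpha> > 0" using tile_in_strip.lft_less_rgt[OF 1] 2 by simp
  show "translate \<alpha>" unfolding P(3) normalize_tile_def using P(2) by (rule translate_shift)
qed

lemma shift_A:
  assumes "\<alpha> \<in> A"
  shows "tile_in_strip (shift x \<alpha>)" "lft (shift x \<alpha>) = x" "rgt (shift x \<alpha>) = x + rgt \<alpha>"
    "translate (shift x \<alpha>)"
  using A_tile[OF assms] by (simp_all add: tile_in_strip_shift lft_shift rgt_shift translate_shift)

lemma normalize_in_A:
  assumes "tile_in_strip P" "translate P"
  shows "normalize_tile P \<in> A" "shift (lft P) (normalize_tile P) = P"
    "rgt (normalize_tile P) = rgt P - lft P"
  using assms by (auto simp: A_def normalize_tile_def shift_shift rgt_shift)

lemma places_tiles:
  "set w \<subseteq> A \<Longrightarrow> Q \<in> places x w \<Longrightarrow> tile_in_strip Q \<and> translate Q \<and> x \<le> lft Q"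
proof (induction w arbitrary: x)
  case (Cons \<alpha> w)
  then have \<alpha>: "\<alpha> \<in> A" by simp
  from Cons.prems consider "Q = shift x \<alpha>" | "Q \<in> places (x + rgt \<alpha>) w" by auto
  then show ?case
  proof cases
    case 1
    then show ?thesis using shift_A[OF \<alpha>] by simp
  next
    case 2
    then show ?thesis using Cons.IH[of "x + rgt \<alpha>"] Cons.prems A_tile(3)[OF \<alpha>] by fastforce
  qed
qed simp

lemma two_tiles_shift:
  assumes "\<alpha> \<in> A" "\<beta> \<in> A" "compat \<alpha> \<beta>"
  shows "two_tiles_in_strip (shift x \<alpha>) (shift (x + rgt \<alpha>) \<beta>)"
proof -
  have "interior (shift x \<alpha>) \<inter> interior (shift (x + rgt \<alpha>) \<beta>) = {}"
    using assms(3) unfolding compat_def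
    by (simp add: interior_shift shift_Int flip: shift_shift)
  then show ?thesis using shift_A[OF assms(1)] shift_A[OF assms(2)]
    by (simp add: two_tiles_in_strip_def two_tiles_in_strip_axioms_def)
qed

text \<open>Compatibility of neighbours extends to all later tiles by induction, with the second
  tile as the separating one in \<open>disjoint_of_between\<close>.\<close>

lemma places_right_of:
  "successively compat (\<alpha> # w) \<Longrightarrow> set (\<alpha> # w) \<subseteq> A \<Longrightarrow> Q \<in> places (x + rgt \<alpha>) w \<Longrightarrow>
    two_tiles_in_strip (shift x \<alpha>) Q \<and> rgt (shift x \<alpha>) \<le> lft Q"
proof (induction w arbitrary: \<alpha> x)
  case (Cons \<beta> w)
  have AB: "two_tiles_in_strip (shift x \<alpha>) (shift (x + rgt \<alpha>) \<beta>)"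
    using Cons.prems by (intro two_tiles_shift) auto
  have \<alpha>\<beta>: "\<alpha> \<in> A" "\<beta> \<in> A" using Cons.prems by auto
  have eq: "rgt (shift x \<alpha>) = lft (shift (x + rgt \<alpha>) \<beta>)" using shift_A \<alpha>\<beta> by simp
  from Cons.prems(3) consider "Q = shift (x + rgt \<alpha>) \<beta>" | "Q \<in> places (x + rgt \<alpha> + rgt \<beta>) w" by auto
  then show ?case
  proof cases
    case 1
    then show ?thesis using AB eq by simp
  next
    case 2
    have BQ: "two_tiles_in_strip (shift (x + rgt \<alpha>) \<beta>) Q \<and> rgt (shift (x + rgt \<alpha>) \<beta>) \<le> lft Q"
      using Cons.prems 2 by (intro Cons.IH) auto
    have "two_tiles_in_strip (shift x \<alpha>) Q"
      using disjoint_of_between[OF AB] BQ eq by simp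
    moreover have "rgt (shift x \<alpha>) \<le> lft Q"
      using BQ eq shift_A[OF \<alpha>\<beta>(2), of "x + rgt \<alpha>"] A_tile(3)[OF \<alpha>\<beta>(2)] by linarith
    ultimately show ?thesis by blast
  qed
qed simp

lemma places_disjoint:
  "successively compat w \<Longrightarrow> set w \<subseteq> A \<Longrightarrow> P \<in> places x w \<Longrightarrow> Q \<in> places x w \<Longrightarrow> P \<noteq> Q
    \<Longrightarrow> interior P \<inter> interior Q = {}"
proof (induction w arbitrary: x)
  case (Cons \<alpha> w)
  have right: "interior (shift x \<alpha>) \<inter> interior R = {}" if "R \<in> places (x + rgt \<alpha>) w" for R
    using places_right_of[OF Cons.prems(1,2) that] two_tiles_in_strip.disjoint by blast
  have "successively compat w" "set w \<subseteq> A" using Cons.prems by (auto simp: successively_Cons)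
  then show ?case using Cons.IH[of "x + rgt \<alpha>"] Cons.prems(3-5) right by (auto simp: Int_commute)
qed simp

lemma places_Re_ge:
  assumes "successively compat w" "set w \<subseteq> A" "w \<noteq> []" "hd w \<in> St" "P \<in> places x w"
  shows "P \<subseteq> {z. x \<le> Re z}"
proof -
  obtain \<alpha> w' where w: "w = \<alpha> # w'" using assms(3) by (cases w) auto
  have first: "shift x \<alpha> \<subseteq> {z. x \<le> Re z}" using assms(4) by (auto simp: w St_def shift_def)
  from assms(5) consider "P = shift x \<alpha>" | "P \<in> places (x + rgt \<alpha>) w'" by (auto simp: w)
  then show ?thesis
  proof cases
    case 2
    then show ?thesis
      using places_right_of[of \<alpha> w' P x] assms(1,2) first two_tiles_in_strip.Re_ge_propagates
      unfolding w by blast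
  qed (use first in simp)
qed

lemma places_Re_le:
  "successively compat w \<Longrightarrow> set w \<subseteq> A \<Longrightarrow> w \<noteq> [] \<Longrightarrow> last w \<in> En \<Longrightarrow> P \<in> places x w
   \<Longrightarrow> P \<subseteq> {z. Re z \<le> x + sum_list (map rgt w)}"
proof (induction w arbitrary: x P)
  case (Cons \<alpha> w)
  show ?case
  proof (cases w)
    case Nil
    then show ?thesis using Cons.prems by (auto simp: En_def shift_def)
  next
    case (Cons \<beta> w')
    have IH: "Q \<subseteq> {z. Re z \<le> x + sum_list (map rgt (\<alpha> # w))}" if "Q \<in> places (x + rgt \<alpha>) w" for Q
      using Cons.IH[of Q "x + rgt \<alpha>"] Cons.prems that Cons by (simp add: add.assoc)
    have B: "shift (x + rgt \<alpha>) \<beta> \<in> places (x + rgt \<alpha>) w" by (simp add: Cons)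
    from places_right_of[OF Cons.prems(1,2) B] IH[OF B]
    have "shift x \<alpha> \<subseteq> {z. Re z \<le> x + sum_list (map rgt (\<alpha> # w))}"
      using two_tiles_in_strip.Re_le_propagates by blast
    then show ?thesis using Cons.prems(5) IH by auto
  qed
qed simp

text \<open>Repeated letters do not collapse in the set of placed tiles, since later tiles have
  strictly larger left ends.\<close>

lemma sum_places:
  "set w \<subseteq> A \<Longrightarrow> (\<Sum>P\<in>places x w. measure lebesgue P) = sum_list (map (measure lebesgue) w)"
proof (induction w arbitrary: x)
  case (Cons \<alpha> w)
  have \<alpha>: "\<alpha> \<in> A" using Cons.prems by simp
  have "shift x \<alpha> \<notin> places (x + rgt \<alpha>) w"
    using places_tiles[of w "shift x \<alpha>" "x + rgt \<alpha>"] Cons.prems shift_A[OF \<alpha>] A_tile(3)[OF \<alpha>] by auto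
  then show ?case using Cons by (simp add: finite_places measure_shift)
qed simp

text \<open>The first letter is recovered from the only placed tile whose left end is
  \<open>x\<close>.\<close>

lemma places_inj:
  "set w \<subseteq> A \<Longrightarrow> set w' \<subseteq> A \<Longrightarrow> places x w = places x w' \<Longrightarrow> w = w'"
proof (induction w arbitrary: x w')
  case Nil
  then show ?case by (cases w') auto
next
  case (Cons \<alpha> w)
  then obtain \<beta> v where w': "w' = \<beta> # v" by (cases w') auto
  have \<alpha>\<beta>: "\<alpha> \<in> A" "\<beta> \<in> A" "set w \<subseteq> A" "set v \<subseteq> A" using Cons.prems by (auto simp: w')
  have n1: "shift x \<gamma> \<notin> places (x + rgt \<delta>) u" if "\<gamma> \<in> A" "\<delta> \<in> A" "set u \<subseteq> A" for \<gamma> \<delta> u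
    using places_tiles[of u "shift x \<gamma>" "x + rgt \<delta>"] that shift_A[OF that(1)] A_tile(3)[OF that(2)] by auto
  have "shift x \<alpha> \<in> places x w'" using Cons.prems(3) by auto
  then have eq: "shift x \<alpha> = shift x \<beta>" using n1[OF \<alpha>\<beta>(1,2,4)] by (auto simp: w')
  then have "shift (- x) (shift x \<alpha>) = shift (- x) (shift x \<beta>)" by simp
  then have "\<alpha> = \<beta>" by (simp add: shift_shift)
  moreover have "places (x + rgt \<alpha>) w = places (x + rgt \<alpha>) v"
    using Cons.prems(3) n1[OF \<alpha>\<beta>(1,1,3)] n1[OF \<alpha>\<beta>(2,2,4)] \<open>\<alpha> = \<beta>\<close> by (auto simp: w' insert_eq_iff)
  ultimately show ?case using Cons.IH[of v "x + rgt \<alpha>"] \<alpha>\<beta> by (simp add: w')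
qed

end

context tall_tiles
begin

text \<open>The wall conditions put the union inside the rectangle. Disjoint interiors make its area
  the sum of the areas, namely \<open>a\<close>, and a closed subset of full area is
  everything.\<close>

lemma is_tiling_places:
  assumes w: "successively compat w" "set w \<subseteq> A" "w \<noteq> []" "hd w \<in> St" "last w \<in> En"
    and sums: "sum_list (map (measure lebesgue) w) = a" "sum_list (map rgt w) = a" and a: "a > 0"
  shows "is_tiling T a (places 0 w)"
proof -
  note tiles = places_tiles[OF w(2)]
  have sub: "P \<subseteq> strip_rect a" if "P \<in> places 0 w" for P
    using tile_in_strip.subset[of P] tiles[OF that] places_Re_ge[OF w(1-4) that]
      places_Re_le[OF w(1-3,5) that] sums(2) by (auto simp: strip_rect_def)
  have "\<Union>(places 0 w) = strip_rect a"
  proof (rule closed_full_measure_strip_rect[OF _ _ _ a])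
    show "closed (\<Union>(places 0 w))"
      using tiles tile_in_strip.compact compact_imp_closed
      by (intro closed_Union finite_places) blast
    show "\<Union>(places 0 w) \<subseteq> strip_rect a" using sub by blast
    show "measure lebesgue (\<Union>(places 0 w)) = a"
      using measure_Union_tiles[OF finite_places, of 0 w] tiles places_disjoint[OF w(1,2)]
        sum_places[OF w(2)] sums(1) by auto
  qed
  then show ?thesis
    using a tiles places_disjoint[OF w(1,2)] unfolding is_tiling_def translate_def by auto
qed

end

section \<open>From tilings to words\<close>

locale tiling = tall_tiles +
  fixes a C
  assumes a: "a > 0" and tiling: "is_tiling T a C"
begin

lemma Union: "\<Union>C = strip_rect a"
  and disjoint: "P \<in> C \<Longrightarrow> Q \<in> C \<Longrightarrow> P \<noteq> Q \<Longrightarrow> interior P \<inter> interior Q = {}"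
  and translate: "P \<in> C \<Longrightarrow> translate P"
  using tiling a by (auto simp: is_tiling_def translate_def)

lemma tile_subset: "P \<in> C \<Longrightarrow> P \<subseteq> strip_rect a"
  using Union by blast

lemma tile: "P \<in> C \<Longrightarrow> tile_in_strip P"
  using tile_subset by (intro tile_in_strip_translate translate) (auto simp: strip_rect_def)

lemma two_tiles: "P \<in> C \<Longrightarrow> Q \<in> C \<Longrightarrow> P \<noteq> Q \<Longrightarrow> two_tiles_in_strip P Q"
  using disjoint[of P Q] tile by (simp add: two_tiles_in_strip_def two_tiles_in_strip_axioms_def)

text \<open>Finiteness is not part of the notion of tiling. It follows because the finite alphabet
  gives a common lower bound for the areas, while any finite subfamily has total area at most
  \<open>a\<close>.\<close>

lemma finite_C: "finite C"
proof (cases "C = {}")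
  case False
  then have "A \<noteq> {}" using normalize_in_A(1) tile translate by blast
  define \<mu> where "\<mu> = Min (measure lebesgue ` A)"
  have "\<mu> \<in> measure lebesgue ` A" unfolding \<mu>_def using finite_A \<open>A \<noteq> {}\<close> by (intro Min_in) auto
  then have \<mu>: "\<mu> > 0" using A_tile(1) tile_in_strip.measure_pos by auto
  have le: "\<mu> \<le> measure lebesgue P" if "P \<in> C" for P
  proof -
    have "\<mu> \<le> measure lebesgue (normalize_tile P)"
      unfolding \<mu>_def using finite_A normalize_in_A(1)[OF tile translate] that by (intro Min_le) auto
    then show ?thesis by (simp add: normalize_tile_def measure_shift)
  qed
  have "card G \<le> nat \<lfloor>a / \<mu>\<rfloor>" if G: "G \<subseteq> C" "finite G" for G
  proof -
    have "real (card G) * \<mu> = (\<Sum>P\<in>G. \<mu>)" by simp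
    also have "\<dots> \<le> (\<Sum>P\<in>G. measure lebesgue P)" using le G by (intro sum_mono) auto
    also have "\<dots> = measure lebesgue (\<Union>G)"
      using G tile disjoint by (intro measure_Union_tiles[symmetric]) blast+
    also have "\<dots> \<le> measure lebesgue (strip_rect a)"
    proof (rule measure_mono_fmeasurable)
      show "\<Union>G \<subseteq> strip_rect a" using G(1) tile_subset by blast
      have "closed (\<Union>G)"
        using G tile tile_in_strip.compact compact_imp_closed by (intro closed_Union) blast+
      then show "\<Union>G \<in> sets lebesgue" by auto
    qed (simp add: strip_rect_eq_cbox)
    also have "\<dots> = a" using a by (simp add: measure_strip_rect)
    finally have "real (card G) \<le> a / \<mu>" using \<mu> by (simp add: field_simps)
    then show ?thesis by linarith
  qed
  then show ?thesis using finite_if_finite_subsets_card_bdd by blast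
qed simp

lemma lft_rgt_bounds:
  assumes "P \<in> C"
  shows "0 \<le> lft P" "rgt P \<le> a" "lft P < rgt P"
proof -
  interpret tile_in_strip P using assms by (rule tile)
  have "0 \<le> x \<and> x \<le> a" if "x \<in> bots P" for x
    using bots_in[OF that] tile_subset[OF assms] by (auto simp: strip_rect_def)
  then show "0 \<le> lft P" "rgt P \<le> a"
    unfolding lft_def rgt_def using bots_ne by (auto intro: cInf_greatest cSup_least)
  show "lft P < rgt P" by (rule lft_less_rgt)
qed

text \<open>A neighbourhood of an uncovered point would meet the tiles only in inaccessible bottom
  points; these are finitely many, but they would have to fill an interval.\<close>

lemma bottom_covered:
  assumes x: "0 \<le> x" "x \<le> a"
  shows "\<exists>P\<in>C. lft P \<le> x \<and> x \<le> rgt P"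
proof (rule ccontr)
  assume not: "\<not> ?thesis"
  define F where "F = (\<Union>P\<in>C. {lft P..rgt P})"
  have "closed F" unfolding F_def using finite_C by auto
  then have "open (- F)" by (rule open_Compl)
  moreover have "x \<in> - F" using not by (auto simp: F_def)
  ultimately obtain d where d: "d > 0" "ball x d \<subseteq> - F" by (meson open_contains_ball)
  have "{max 0 (x - d)<..<min a (x + d)} \<subseteq> (\<Union>P\<in>C. {x. Complex x 0 \<in> P \<and> x \<notin> bots P})"
  proof
    fix y assume y: "y \<in> {max 0 (x - d)<..<min a (x + d)}"
    then have "Complex y 0 \<in> strip_rect a" by (auto simp: strip_rect_def)
    then obtain P where P: "P \<in> C" "Complex y 0 \<in> P" using Union by blast
    have "y \<in> ball x d" using y by (auto simp: dist_real_def)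
    then have "y \<notin> F" using d by blast
    then have "y \<notin> bots P" using tile_in_strip.bots_bounds[OF tile[OF P(1)]] P(1) by (auto simp: F_def)
    with P show "y \<in> (\<Union>P\<in>C. {x. Complex x 0 \<in> P \<and> x \<notin> bots P})" by auto
  qed
  moreover have "finite (\<Union>P\<in>C. {x. Complex x 0 \<in> P \<and> x \<notin> bots P})"
    using finite_C tile_in_strip.finite_bad tile by blast
  ultimately have "finite {max 0 (x - d)<..<min a (x + d)}" by (rule finite_subset)
  moreover have "max 0 (x - d) < min a (x + d)" using x d(1) a by auto
  ultimately show False using infinite_Ioo by blast
qed

text \<open>The tile with the leftmost bottom side to the right of \<open>x\<close> is split off and
  \<open>x\<close> moves to its right end. The third hypothesis, that no bottom side straddles
  \<open>x\<close>, is what the recursion preserves.\<close>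

lemma places_exists:
  assumes "0 \<le> x" "x \<le> a" "\<forall>P\<in>C. rgt P \<le> x \<or> x \<le> lft P"
  shows "\<exists>w. set w \<subseteq> A \<and> successively compat w \<and> places x w = {P \<in> C. x \<le> lft P} \<and>
    x + sum_list (map rgt w) = a \<and> (w \<noteq> [] \<longrightarrow> last w \<in> En)"
  using assms
proof (induction "card {P \<in> C. x \<le> lft P}" arbitrary: x rule: less_induct)
  case less
  define D where "D = {P \<in> C. x \<le> lft P}"
  have finD: "finite D" using finite_C by (simp add: D_def)
  have covD: "\<exists>P\<in>D. lft P \<le> y" if y: "x < y" "y \<le> a" for y
  proof -
    obtain P where P: "P \<in> C" "lft P \<le> y" "y \<le> rgt P" using bottom_covered[of y] y less.prems by auto
    then have "x \<le> lft P" using less.prems(3) y(1) by fastforce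
    then show ?thesis using P by (auto simp: D_def)
  qed
  show ?case
  proof (cases "D = {}")
    case True
    then have "x = a" using covD[of a] less.prems(2) by fastforce
    then show ?thesis using True by (intro exI[of _ "[]"]) (auto simp: D_def)
  next
    case False
    have "Min (lft ` D) \<in> lft ` D" using finD False by (intro Min_in) auto
    then obtain P where P: "P \<in> D" "lft P = Min (lft ` D)" by auto
    have minP: "lft P \<le> lft Q" if "Q \<in> D" for Q
      unfolding P(2) using finD that by (intro Min_le) auto
    have PC: "P \<in> C" "x \<le> lft P" using P(1) by (auto simp: D_def)
    note Pb = lft_rgt_bounds[OF PC(1)]
    \<comment> \<open>Otherwise the midpoint between \<open>x\<close> and \<open>lft P\<close> would
      be covered by a bottom side that begins further left than the minimal one.\<close>
    have lftP: "lft P = x"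
    proof (rule ccontr)
      assume "lft P \<noteq> x"
      then have "x < (x + lft P) / 2" "(x + lft P) / 2 \<le> a" using PC(2) Pb less.prems by auto
      then obtain Q where "Q \<in> D" "lft Q \<le> (x + lft P) / 2" using covD by blast
      with minP[of Q] \<open>lft P \<noteq> x\<close> PC(2) show False by (simp add: field_simps)
    qed
    have sep: "rgt P \<le> lft Q" if "Q \<in> D" "Q \<noteq> P" for Q
    proof -
      have Q: "Q \<in> C" "x \<le> lft Q" using that(1) by (auto simp: D_def)
      show ?thesis
        using two_tiles_in_strip.separated[OF two_tiles[OF PC(1) Q(1)]] that(2) Q(2)
          lft_rgt_bounds(3)[OF Q(1)] lftP by auto
    qed
    have D': "{Q \<in> C. rgt P \<le> lft Q} = D - {P}"
      using sep Pb(3) lftP by (auto simp: D_def)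
    have "\<exists>w. set w \<subseteq> A \<and> successively compat w \<and> places (rgt P) w = {Q \<in> C. rgt P \<le> lft Q} \<and>
      rgt P + sum_list (map rgt w) = a \<and> (w \<noteq> [] \<longrightarrow> last w \<in> En)"
    proof (rule less.hyps)
      show "card {Q \<in> C. rgt P \<le> lft Q} < card {Q \<in> C. x \<le> lft Q}"
        unfolding D' D_def[symmetric] using finD P(1) by (intro card_Diff1_less)
      show "0 \<le> rgt P" "rgt P \<le> a" using Pb by auto
      show "\<forall>Q\<in>C. rgt Q \<le> rgt P \<or> rgt P \<le> lft Q"
      proof
        fix Q assume Q: "Q \<in> C"
        show "rgt Q \<le> rgt P \<or> rgt P \<le> lft Q"
          using less.prems(3) Q sep[of Q] Pb(3) lftP by (cases "Q \<in> D"; cases "Q = P") (auto simp: D_def)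
      qed
    qed
    then obtain w where w: "set w \<subseteq> A" "successively compat w" "places (rgt P) w = D - {P}"
      "rgt P + sum_list (map rgt w) = a" "w \<noteq> [] \<longrightarrow> last w \<in> En"
      unfolding D' by blast
    define \<alpha> where "\<alpha> = normalize_tile P"
    have \<alpha>: "\<alpha> \<in> A" "shift x \<alpha> = P" "rgt \<alpha> = rgt P - x"
      using normalize_in_A[OF tile translate] PC(1) lftP by (auto simp: \<alpha>_def)
    have "compat \<alpha> \<beta>" if "w = \<beta> # w'" for \<beta> w'
    proof -
      have "shift (rgt P) \<beta> \<in> D - {P}" using w(3) that by auto
      then have "interior P \<inter> interior (shift (rgt P) \<beta>) = {}"
        using PC(1) by (intro disjoint) (auto simp: D_def)
      moreover have "interior P = shift x (interior \<alpha>)" by (simp add: \<alpha>(2) flip: interior_shift)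
      moreover have "interior (shift (rgt P) \<beta>) = shift x (interior (shift (rgt \<alpha>) \<beta>))"
        by (simp add: \<alpha>(3) interior_shift shift_shift)
      ultimately have "interior \<alpha> \<inter> interior (shift (rgt \<alpha>) \<beta>) = {}"
        by (simp only: shift_Int shift_eq_empty)
      then show ?thesis by (simp add: compat_def)
    qed
    then have "successively compat (\<alpha> # w)" using w(2) by (cases w) auto
    moreover have "last (\<alpha> # w) \<in> En"
    proof (cases "w = []")
      case True
      then have "rgt P = a" using w(4) by simp
      then have "\<alpha> \<subseteq> {z. Re z \<le> rgt \<alpha>}"
        using tile_subset[OF PC(1)] \<alpha>(3) lftP
        by (auto simp: \<alpha>_def normalize_tile_def shift_def strip_rect_def)
      then show ?thesis using True by (simp add: En_def)
    qed (use w(5) in simp)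
    moreover have "places x (\<alpha> # w) = D" using \<alpha> w(3) P(1) by auto
    moreover have "x + sum_list (map rgt (\<alpha> # w)) = a" using \<alpha>(3) w(4) by simp
    moreover have "set (\<alpha> # w) \<subseteq> A" using \<alpha>(1) w(1) by simp
    ultimately show ?thesis unfolding D_def by blast
  qed
qed

lemma tiling_word:
  "\<exists>w. successively compat w \<and> set w \<subseteq> A \<and> w \<noteq> [] \<and> hd w \<in> St \<and> last w \<in> En \<and>
    sum_list (map (measure lebesgue) w) = a \<and> sum_list (map rgt w) = a \<and> places 0 w = C"
proof -
  have all: "{P \<in> C. 0 \<le> lft P} = C" using lft_rgt_bounds by auto
  obtain w where w: "set w \<subseteq> A" "successively compat w" "places 0 w = C"
    "sum_list (map rgt w) = a" "w \<noteq> [] \<longrightarrow> last w \<in> En"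
    using places_exists[of 0] lft_rgt_bounds a unfolding all by auto
  have "w \<noteq> []" using w(4) a by auto
  then obtain \<alpha> w' where cons: "w = \<alpha> # w'" by (cases w) auto
  have "\<alpha> \<in> C" using w(3) by (auto simp: cons)
  then have "hd w \<in> St" using tile_subset by (fastforce simp: cons St_def strip_rect_def)
  moreover have "sum_list (map (measure lebesgue) w) = a"
    using sum_places[OF w(1), of 0] measure_Union_tiles[OF finite_C tile disjoint] Union a
    by (simp add: w(3) measure_strip_rect)
  ultimately show ?thesis using w \<open>w \<noteq> []\<close> by blast
qed

end

context tall_tiles
begin

lemma tile_count_dichotomy:
  assumes "\<epsilon> \<ge> 0"
  shows "\<exists>m\<ge>1. \<forall>i\<le>m - 1. grows_exponentially (\<lambda>n. tile_count T \<epsilon> (n * m + i)) \<or>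
    eventually_polynomial (\<lambda>n. tile_count T \<epsilon> (n * m + i))"
proof -
  \<comment> \<open>Lengthening the rectangle by one raises the required area and the required
    bottom width by one each, hence the direction (1, 1); the offset \<epsilon> likewise enters both
    coordinates.\<close>
  interpret W: weighted_words A compat St En wt "Complex 1 1" "Complex \<epsilon> \<epsilon>"
    by unfold_locales (use finite_A A_tile(1) tile_in_strip.measure_pos in \<open>auto simp: wt_def\<close>)
  have weight: "W.weight w = Complex (sum_list (map (measure lebesgue) w)) (sum_list (map rgt w))" for w
  proof -
    have "sum_list (map wt w) = Complex (sum_list (map (measure lebesgue) w)) (sum_list (map rgt w))"
      by (induction w) (simp_all add: wt_def complex_eq_iff)
    then show ?thesis by (simp only: W.weight_def)
  qed
  \<comment> \<open>For \<open>n \<ge> 1\<close> the length \<open>a\<close> is positive. Length 0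
    would have the empty tiling, to which no word corresponds because walks are nonempty.\<close>
  have "tile_count T \<epsilon> n = card (W.words n)" if "n \<ge> 1" for n
  proof -
    define a where "a = real n + \<epsilon>"
    have a: "a > 0" using that assms by (simp add: a_def)
    have "of_nat n * Complex 1 1 + Complex \<epsilon> \<epsilon> = Complex a a"
      by (simp add: complex_eq_iff a_def)
    then have words: "w \<in> W.words n \<longleftrightarrow> successively compat w \<and> set w \<subseteq> A \<and> w \<noteq> [] \<and> hd w \<in> St \<and>
        last w \<in> En \<and> sum_list (map (measure lebesgue) w) = a \<and> sum_list (map rgt w) = a" for w
      by (auto simp: W.words_def W.accepted_def W.walk_def weight)
    have "{C. is_tiling T a C} = places 0 ` W.words n"
    proof (intro set_eqI iffI)
      fix C assume "C \<in> {C. is_tiling T a C}"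
      then interpret tiling T a C by unfold_locales (use a in auto)
      show "C \<in> places 0 ` W.words n" using tiling_word words by blast
    next
      fix C assume "C \<in> places 0 ` W.words n"
      then show "C \<in> {C. is_tiling T a C}" using words is_tiling_places[OF _ _ _ _ _ _ _ a] by blast
    qed
    moreover have "inj_on (places 0) (W.words n)"
      by (rule inj_onI) (use places_inj words in blast)
    ultimately show ?thesis by (simp add: tile_count_def card_image flip: a_def)
  qed
  then show ?thesis by (rule W.words_exponential_or_polynomial)
qed

end

theorem theorem4p2:
  fixes f :: "nat \<Rightarrow> nat"
  assumes "f \<in> tile_counting_functions"
  shows "\<exists>m::nat. m \<ge> 1 \<and>
           (\<forall>i. i \<le> m - 1 \<longrightarrow>
              grows_exponentially (\<lambda>n. f (n * m + i)) \<or>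
              eventually_polynomial (\<lambda>n. f (n * m + i)))"
proof -
  obtain T \<epsilon> where f: "f = tile_count T \<epsilon>" and T: "finite T" "\<forall>t\<in>T. tall_tile t" and \<epsilon>: "\<epsilon> \<ge> 0"
    using assms by (auto simp: tile_counting_functions_def)
  interpret tall_tiles T by unfold_locales (use T in auto)
  show ?thesis unfolding f by (rule tile_count_dichotomy[OF \<epsilon>])
qed

end
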